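(* Let $N\ge 1$ be an integer and let $m>2-N$ be a real number. Let $\tilde C(N,m)$ denote the optimal (i.e. largest) constant for which $$\int_{\mathbb{R}^N} |\Delta u|^2|x|^{m}\, dx \;\ge\; \tilde C(N,m) \int_{\mathbb{R}^N} |x\cdot\nabla u|^2|x|^{m-4}\, dx\qquad \text{for all } u\in C_c^\infty(\mathbb{R}^N).$$ Then $\tilde C(N,m)$ is given as follows. (i) If $N=1$ and $m>1$, or if $N\ge 2$ and $m\in\left[2-\sqrt{(N-1)^2+1},\ 2+\sqrt{(N-1)^2+1}\right]$, then $$\tilde C(N,m)=\left(\frac{N-m}{2}\right)^2,$$ and this constant is approximated, as $\epsilon\searrow 0$, by the sequence $\{u_\epsilon\}_{\epsilon>0}$ given by $$u_\epsilon(x)=|x|^{-\frac{N+m-4}{2}+\epsilon}\,g(|x|).$$ (ii) If $N\ge 2$ and $m\in\left(2-N,\ 2-\sqrt{(N-1)^2+1}\right)$, then $$\tilde C(N,m)=\frac{\left((m-2)^2-N^2\right)^2}{4(N+m-4)^2},$$ and this constant is approximated, as $\epsilon\searrow 0$, by the sequence $\{u_\epsilon\}_{\epsilon>0}$ given by $$u_\epsilon(x)=|x|^{-\frac{N+m-4}{2}+\epsilon}\,g(|x|)\,\phi_1\!\left(\frac{x}{|x|}\right),$$ where $\phi_1$ is a spherical harmonic of degree $1$ with $\|\phi_1\|_{L^2(S^{N-1})}=1$. (iii) If $N\ge 2$ and $m\in\left(2+\sqrt{(N-1)^2+1},\ \infty\right)$, then $$\tilde C(N,m)=\min_{0\le l\le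 k(m)}\tilde C(N,m,l),\qquad \tilde C(N,m,l):=\frac{(-N+m-2l)^2\,(2l+m+N-4)^2}{4(m+N-4)^2},$$ where $l$ ranges over integers, and this constant is approximated, as $\epsilon\searrow 0$, by the sequence $\{u_\epsilon\}_{\epsilon>0}$ given by $$u_\epsilon(x)=|x|^{-\frac{N+m-4}{2}+\epsilon}\,g(|x|)\,\phi_{l_{\min}}\!\left(\frac{x}{|x|}\right),$$ where $l_{\min}:=\arg\min_{0\le l\le k(m)}\tilde C(N,m,l)$ and $\phi_{l_{\min}}$ is a spherical harmonic of degree $l_{\min}$ with $\|\phi_{l_{\min}}\|_{L^2(S^{N-1})}=1$.
   Context: Functions are real-valued and $C_c^\infty(\mathbb{R}^N)$ is the space of smooth compactly supported functions on $\mathbb{R}^N$. The function $g\in C^\infty([0,\infty))$ is a fixed cut-off function with $0\le g\le 1$, $g(r)=1$ for $0\le r\le 1$ and $g(r)=0$ for $r\ge 2$. A constant $C$ is said to be approximated by a sequence $\{u_\epsilon\}_{\epsilon>0}$ if $$\frac{\int_{\mathbb{R}^N}|\Delta u_\epsilon|^2|x|^m\,dx}{\int_{\mathbb{R}^N}|x\cdot\nabla u_\epsilon|^2|x|^{m-4}\,dx}\longrightarrow C\qquad\text{as }\epsilon\searrow 0.$$ The functions $u_\epsilon$ need not belong to $C_c^\infty(\mathbb{R}^N)$ (they may be singular at the origin), but both integrals in the quotient are finite for them; derivatives of $u_\epsilon$ are taken on $\mathbb{R}^N\setminus\{0\}$. A spherical harmonic of degree $k\ge 0$ is an eigenfunction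 $\phi_k$ of the Laplace–Beltrami operator on the unit sphere $S^{N-1}$ with $-\Delta_{S^{N-1}}\phi_k=c_k\phi_k$, where $c_k=k(k+N-2)$. For integers $k\ge 0$ set $$I_k(m,N):=2\left(\frac{N+m-4}{2}\right)^2+c_k-(m-2)(N+m-4),\qquad c_k=k(k+N-2),$$ and, for $m>2+\sqrt{(N-1)^2+1}$, $$k(m):=\min\{k\in\mathbb{N}\ :\ I_k(m,N)\ge 0\}.$$
   Formalization: In case (i), that the constant is approximated by u_ε is claimed only for m ≠ 4−N: at m = 4−N the unit ball contributes nothing in the limit and the quotient tends to a value larger than ((N−m)/2)². The optimal constant itself is still asserted at m = 4−N. *)

theory Defs
  imports "HOL-Analysis.Analysis"
begin

text \<open>
  \<open>Ck_on k S f\<close>: all iterated partial derivatives of \<open>f\<close> of order at most \<open>k\<close> exist and are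
  continuous on \<open>S\<close>, and those of order less than \<open>k\<close> are differentiable on \<open>S\<close>. Derivatives are
  taken within \<open>S\<close>, so that they are one-sided at the boundary point of \<open>[0,\<infinity>)\<close>. The definition
  is meant for sets where the derivative within \<open>S\<close> is unique; here \<open>S\<close> is always open or
  \<open>[0,\<infinity>)\<close>.
\<close>

primrec Ck_on :: "nat \<Rightarrow> 'a::euclidean_space set \<Rightarrow> ('a \<Rightarrow> real) \<Rightarrow> bool" where
  "Ck_on 0 S f \<longleftrightarrow> continuous_on S f"
| "Ck_on (Suc k) S f \<longleftrightarrow> f differentiable_on S \<and>
     (\<forall>i\<in>Basis. Ck_on k S (\<lambda>x. frechet_derivative f (at x within S) i))"

definition smooth_on :: "'a::euclidean_space set \<Rightarrow> ('a \<Rightarrow> real) \<Rightarrow> bool" where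
  "smooth_on S f \<longleftrightarrow> (\<forall>k. Ck_on k S f)"

definition test_functions :: "('a::euclidean_space \<Rightarrow> real) set" where
  "test_functions = {u. smooth_on UNIV u \<and> compact (closure {x. u x \<noteq> 0})}"

definition partial_deriv :: "'a::euclidean_space \<Rightarrow> ('a \<Rightarrow> real) \<Rightarrow> 'a \<Rightarrow> real" where
  "partial_deriv i u x = frechet_derivative u (at x) i"

definition grad :: "('a::euclidean_space \<Rightarrow> real) \<Rightarrow> 'a \<Rightarrow> 'a" where
  "grad u x = (\<Sum>i\<in>Basis. partial_deriv i u x *\<^sub>R i)"

definition laplacian :: "('a::euclidean_space \<Rightarrow> real) \<Rightarrow> 'a \<Rightarrow> real" where
  "laplacian u x = (\<Sum>i\<in>Basis. partial_deriv i (partial_deriv i u) x)"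

text \<open>
  Both integrands vanish at the origin because \<open>0 powr a = 0\<close>, so the (possibly meaningless)
  derivatives of a singular \<open>u\<close> at the origin play no role.
\<close>

definition rellich_integrand :: "real \<Rightarrow> ('a::euclidean_space \<Rightarrow> real) \<Rightarrow> 'a \<Rightarrow> real" where
  "rellich_integrand m u x = (laplacian u x)\<^sup>2 * norm x powr m"

definition hardy_integrand :: "real \<Rightarrow> ('a::euclidean_space \<Rightarrow> real) \<Rightarrow> 'a \<Rightarrow> real" where
  "hardy_integrand m u x = (x \<bullet> grad u x)\<^sup>2 * norm x powr (m - 4)"

text \<open>
  For \<open>m > 2 - N\<close> both integrals are finite for every test function, so that the convention that
  a divergent Bochner integral is \<open>0\<close> does not interfere.
\<close>

definition admissible_constant :: "'a::euclidean_space itself \<Rightarrow> real \<Rightarrow> real \<Rightarrow> bool" where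
  "admissible_constant _ m C \<longleftrightarrow>
     (\<forall>u \<in> (test_functions :: ('a \<Rightarrow> real) set).
        (LINT x|lborel. rellich_integrand m u x) \<ge> C * (LINT x|lborel. hardy_integrand m u x))"

definition optimal_constant :: "'a::euclidean_space itself \<Rightarrow> real \<Rightarrow> real \<Rightarrow> bool" where
  "optimal_constant T m C \<longleftrightarrow>
     admissible_constant T m C \<and> (\<forall>C'. admissible_constant T m C' \<longrightarrow> C' \<le> C)"

definition approximated_by :: "real \<Rightarrow> real \<Rightarrow> (real \<Rightarrow> 'a::euclidean_space \<Rightarrow> real) \<Rightarrow> bool" where
  "approximated_by m C u \<longleftrightarrow>
     (\<forall>\<epsilon>>0. integrable lborel (rellich_integrand m (u \<epsilon>)) \<and>
            integrable lborel (hardy_integrand m (u \<epsilon>)) \<and>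
            (LINT x|lborel. hardy_integrand m (u \<epsilon>) x) \<noteq> 0) \<and>
     ((\<lambda>\<epsilon>. (LINT x|lborel. rellich_integrand m (u \<epsilon>) x) /
            (LINT x|lborel. hardy_integrand m (u \<epsilon>) x)) \<longlongrightarrow> C) (at_right 0)"

text \<open>
  In the radial case the family \<open>|x| powr (-(N+m-4)/2 + \<epsilon>) * g |x|\<close> does not approximate the
  optimal constant at the single exponent \<open>m = 4 - N\<close>: there it reads \<open>|x| powr \<epsilon> * g |x|\<close>, and
  the contributions of the unit ball to both integrals tend to \<open>0\<close>. The quotient tends to that of
  \<open>g |x|\<close>, which, by the one-dimensional Hardy inequality for \<open>g'\<close>, exceeds \<open>(N-2)\<^sup>2\<close>.
\<close>

definition cutoff :: "(real \<Rightarrow> real) \<Rightarrow> bool" where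
  "cutoff g \<longleftrightarrow> smooth_on {0..} g \<and> (\<forall>r\<ge>0. 0 \<le> g r \<and> g r \<le> 1) \<and>
     (\<forall>r. 0 \<le> r \<and> r \<le> 1 \<longrightarrow> g r = 1) \<and> (\<forall>r\<ge>2. g r = 0)"

text \<open>
  A function on the unit sphere is represented by a function on the whole space of which only the
  values on \<open>sphere 0 1\<close> matter. The Laplace-Beltrami operator is the Euclidean Laplacian of the
  extension that is homogeneous of degree \<open>0\<close>, restricted to the sphere.
\<close>

definition radial_extension :: "('a::euclidean_space \<Rightarrow> real) \<Rightarrow> 'a \<Rightarrow> real" where
  "radial_extension \<phi> x = \<phi> (x /\<^sub>R norm x)"

definition sphere_laplacian :: "('a::euclidean_space \<Rightarrow> real) \<Rightarrow> 'a \<Rightarrow> real" where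
  "sphere_laplacian \<phi> = laplacian (radial_extension \<phi>)"

definition sphere_eigenvalue :: "nat \<Rightarrow> nat \<Rightarrow> real" where
  "sphere_eigenvalue N k = real k * (real k + real N - 2)"

definition spherical_harmonic :: "nat \<Rightarrow> ('a::euclidean_space \<Rightarrow> real) \<Rightarrow> bool" where
  "spherical_harmonic k \<phi> \<longleftrightarrow>
     smooth_on (- {0}) (radial_extension \<phi>) \<and>
     (\<exists>x\<in>sphere 0 1. \<phi> x \<noteq> 0) \<and>
     (\<forall>x\<in>sphere 0 1. - sphere_laplacian \<phi> x = sphere_eigenvalue DIM('a) k * \<phi> x)"

text \<open>
  Surface measure as cone measure: the surface area of \<open>A\<close> is \<open>N\<close> times the volume of the cone
  \<open>{x. 0 < |x| < 1 \<and> x/|x| \<in> A}\<close>.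
\<close>

definition sphere_measure :: "'a::euclidean_space measure" where
  "sphere_measure = scale_measure (ennreal (real DIM('a)))
     (distr (restrict_space lborel (ball 0 1 - {0})) borel (\<lambda>x. x /\<^sub>R norm x))"

definition sphere_L2_norm :: "('a::euclidean_space \<Rightarrow> real) \<Rightarrow> real" where
  "sphere_L2_norm \<phi> = sqrt (LINT x:sphere 0 1|sphere_measure. (\<phi> x)\<^sup>2)"

definition I_coeff :: "nat \<Rightarrow> real \<Rightarrow> nat \<Rightarrow> real" where
  "I_coeff N m k = 2 * ((real N + m - 4) / 2)\<^sup>2 + sphere_eigenvalue N k - (m - 2) * (real N + m - 4)"

definition k_min :: "nat \<Rightarrow> real \<Rightarrow> nat" where
  "k_min N m = (LEAST k. I_coeff N m k \<ge> 0)"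

definition C_mode :: "nat \<Rightarrow> real \<Rightarrow> nat \<Rightarrow> real" where
  "C_mode N m l = (- real N + m - 2 * real l)\<^sup>2 * (2 * real l + m + real N - 4)\<^sup>2 /
     (4 * (m + real N - 4)\<^sup>2)"

end

theory Submission
  imports Defs
begin

text \<open>
  In logarithmic polar coordinates the substitution \<open>u = |x| powr (-a) w\<close>, \<open>a = (N + m - 4) / 2\<close>,
  \<open>b = (N - m) / 2\<close>, turns the two integrands into \<open>(\<partial>\<^sub>t\<^sup>2 w + (b - a) \<partial>\<^sub>t w + \<Delta>\<^sub>S w - a b w)\<^sup>2\<close> and
  \<open>(\<partial>\<^sub>t w - a w)\<^sup>2\<close> on the cylinder with measure \<open>|x| powr (-N) dx\<close>, where \<open>\<partial>\<^sub>t\<close> is the Euler field.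
  Integrating by parts, the first integral minus \<open>C\<close> times the second is the integral of
  \<open>(\<partial>\<^sub>t\<^sup>2 w)\<^sup>2 + 2 |\<nabla>\<^sub>S \<partial>\<^sub>t w|\<^sup>2 + (a\<^sup>2 + b\<^sup>2 - C) (\<partial>\<^sub>t w)\<^sup>2 + ((\<Delta>\<^sub>S w - a b w)\<^sup>2 - C a\<^sup>2 w\<^sup>2)\<close>.
  Hence \<open>C\<close> is admissible as soon as \<open>C \<le> b\<^sup>2\<close> and \<open>C a\<^sup>2 \<le> (c\<^sub>k + a b)\<^sup>2\<close> for all eigenvalues \<open>c\<^sub>k\<close> of
  \<open>-\<Delta>\<^sub>S\<close>. Conversely, slowly varying multiples of \<open>|x| powr (-a) \<phi>\<^sub>k\<close> show that no admissible
  constant exceeds \<open>(c\<^sub>k + a b)\<^sup>2 / a\<^sup>2\<close>, and the three cases of the theorem only differ in the \<open>k\<close>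
  that minimises this quantity.
\<close>

section \<open>Smooth functions\<close>

text \<open>Modes are compared through \<open>(c_k + a b)^2 - (a b)^2 = c_k (c_k + 2 a b)\<close>.
  The last factor is \<open>I_coeff\<close>; for \<open>k = 1\<close> it equals
  \<open>((N - 1)^2 + 1 - (m - 2)^2) / 2\<close>, and its zeros are the endpoints
  \<open>2 - sqrt ((N - 1)^2 + 1)\<close> and \<open>2 + sqrt ((N - 1)^2 + 1)\<close>. The
  integrations by parts are free of boundary terms for functions that vanish near the origin and
  near infinity, whereas a test function may be nonzero at the origin. The sign of \<open>a\<close>
  decides how to pass from one to the other: the weight \<open>|x| powr (m - 4)\<close> is
  integrable at the origin iff \<open>a > 0\<close> and at infinity iff \<open>a < 0\<close>.
  Neither integrand sees constants, so \<open>u\<close> itself is cut off if \<open>a > 0\<close>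
  and \<open>u - u 0\<close> if \<open>a < 0\<close>; the case \<open>a = 0\<close> is a limit in
  \<open>m\<close>. All calculations stay in Cartesian coordinates. The angular Laplacian commutes
  with multiplication by radial functions, so weights and cutoffs move through it freely. The single
  profile \<open>g\<close> supplies every bump function, in the radius as well as in its
  logarithm.\<close>

lemma partial_deriv_eqI:
  assumes "(f has_derivative f') (at x)"
  shows "partial_deriv i f x = f' i"
  using frechet_derivative_at[OF assms] by (simp add: partial_deriv_def)

text \<open>\<open>frechet_derivative\<close> chooses from the set of all derivatives at the point.
  Functions that agree near \<open>x\<close> have the same such set, so the choices coincide even
  where no derivative exists.\<close>

lemma partial_deriv_cong:
  assumes "open S" "x \<in> S" "\<And>y. y \<in> S \<Longrightarrow> f y = g y"
  shows "partial_deriv i f x = partial_deriv i g x"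
proof -
  have "(f has_derivative D) (at x) \<longleftrightarrow> (g has_derivative D) (at x)" for D
    using assms has_derivative_transform_within_open[of f D x UNIV S g]
      has_derivative_transform_within_open[of g D x UNIV S f] by auto
  then show ?thesis by (simp add: partial_deriv_def frechet_derivative_def)
qed

lemma differentiable_on_cong:
  assumes "\<And>x. x \<in> S \<Longrightarrow> f x = g x" "f differentiable_on S"
  shows "g differentiable_on S"
  using assms unfolding differentiable_on_def differentiable_def
  by (metis has_derivative_transform)

lemma Ck_on_cong:
  assumes "open S" "\<And>x. x \<in> S \<Longrightarrow> f x = g x" "Ck_on k S f"
  shows "Ck_on k S g"
  using assms(2,3)
proof (induction k arbitrary: f g)
  case 0
  then show ?case using continuous_on_cong by (metis Ck_on.simps(1))
next
  case (Suc k)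
  have "Ck_on k S (\<lambda>x. frechet_derivative g (at x within S) i)" if "i \<in> Basis" for i
  proof (rule Suc.IH)
    show "Ck_on k S (\<lambda>x. frechet_derivative f (at x within S) i)"
      using Suc.prems that by simp
    show "frechet_derivative f (at x within S) i = frechet_derivative g (at x within S) i"
      if "x \<in> S" for x
      using partial_deriv_cong[OF \<open>open S\<close> that, of f g i] Suc.prems that
      by (simp add: partial_deriv_def at_within_open[OF that \<open>open S\<close>])
  qed
  then show ?case
    using Suc.prems differentiable_on_cong[of S f g] by auto
qed

lemma Ck_on_Suc_open:
  assumes "open S"
  shows "Ck_on (Suc k) S f \<longleftrightarrow>
    (\<forall>x\<in>S. f differentiable (at x)) \<and> (\<forall>i\<in>Basis. Ck_on k S (partial_deriv i f))"
proof -
  have "Ck_on k S (\<lambda>x. frechet_derivative f (at x within S) i) \<longleftrightarrow> Ck_on k S (partial_deriv i f)" for i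
    by (rule iffI; erule Ck_on_cong[OF assms, rotated])
      (simp_all add: partial_deriv_def at_within_open[OF _ assms])
  moreover have "f differentiable_on S \<longleftrightarrow> (\<forall>x\<in>S. f differentiable (at x))"
    using assms by (simp add: differentiable_on_eq_differentiable_at)
  ultimately show ?thesis by simp
qed

lemma Ck_on_SucI:
  assumes "open S" "\<And>x. x \<in> S \<Longrightarrow> (f has_derivative f' x) (at x)"
    and "\<And>i. i \<in> Basis \<Longrightarrow> Ck_on k S (\<lambda>x. f' x i)"
  shows "Ck_on (Suc k) S f"
proof -
  have "Ck_on k S (partial_deriv i f)" if "i \<in> Basis" for i
    by (rule Ck_on_cong[OF assms(1) _ assms(3)[OF that]]) (simp add: partial_deriv_eqI[OF assms(2)])
  then show ?thesis
    using assms(2) by (auto simp: Ck_on_Suc_open[OF assms(1)] differentiable_def simp del: Ck_on.simps)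
qed

lemma Ck_on_has_derivative:
  assumes "Ck_on (Suc k) S f" "open S" "x \<in> S"
  shows "(f has_derivative (\<lambda>v. frechet_derivative f (at x) v)) (at x)"
  using assms by (simp add: Ck_on_Suc_open frechet_derivative_works del: Ck_on.simps)

lemma Ck_on_imp_continuous_on:
  assumes "Ck_on k S f"
  shows "continuous_on S f"
  using assms by (cases k) (auto simp: differentiable_imp_continuous_on)

lemma Ck_on_SucD:
  assumes "open S" "Ck_on (Suc k) S f"
  shows "Ck_on k S f"
  using assms(2)
proof (induction k arbitrary: f)
  case 0
  then show ?case using Ck_on_imp_continuous_on[of "Suc 0" S f] by simp
next
  case (Suc k)
  then show ?case by (auto simp: Ck_on_Suc_open[OF assms(1)] simp del: Ck_on.simps)
qed

lemma Ck_on_const: "open S \<Longrightarrow> Ck_on k S (\<lambda>x. c)"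
  by (induction k arbitrary: c) (auto intro!: Ck_on_SucI has_derivative_const simp del: Ck_on.simps(2))

lemma Ck_on_add:
  assumes "open S" "Ck_on k S f" "Ck_on k S g"
  shows "Ck_on k S (\<lambda>x. f x + g x)"
  using assms(2,3)
proof (induction k arbitrary: f g)
  case 0
  then show ?case by (auto intro: continuous_intros)
next
  case (Suc k)
  show ?case
  proof (rule Ck_on_SucI[OF assms(1)])
    fix x assume "x \<in> S"
    then show "((\<lambda>x. f x + g x) has_derivative
      (\<lambda>v. frechet_derivative f (at x) v + frechet_derivative g (at x) v)) (at x)"
      using Suc.prems assms(1) by (intro has_derivative_add Ck_on_has_derivative)
  next
    fix i :: 'a assume "i \<in> Basis"
    then show "Ck_on k S (\<lambda>x. frechet_derivative f (at x) i + frechet_derivative g (at x) i)"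
      using Suc.prems[unfolded Ck_on_Suc_open[OF assms(1)]]
      by (intro Suc.IH) (auto simp: partial_deriv_def[abs_def])
  qed
qed

lemma Ck_on_mult:
  assumes "open S" "Ck_on k S f" "Ck_on k S g"
  shows "Ck_on k S (\<lambda>x. f x * g x)"
  using assms(2,3)
proof (induction k arbitrary: f g)
  case 0
  then show ?case by (auto intro: continuous_intros)
next
  case (Suc k)
  show ?case
  proof (rule Ck_on_SucI[OF assms(1)])
    fix x assume "x \<in> S"
    then show "((\<lambda>x. f x * g x) has_derivative
      (\<lambda>v. f x * frechet_derivative g (at x) v + frechet_derivative f (at x) v * g x)) (at x)"
      using Suc.prems assms(1) by (intro has_derivative_mult Ck_on_has_derivative)
  next
    fix i :: 'a assume "i \<in> Basis"
    then show "Ck_on k S (\<lambda>x. f x * frechet_derivative g (at x) i + frechet_derivative f (at x) i * g x)"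
      using Suc.prems[unfolded Ck_on_Suc_open[OF assms(1)]] Suc.prems[THEN Ck_on_SucD[OF assms(1)]]
      by (intro Ck_on_add Suc.IH assms(1)) (auto simp: partial_deriv_def[abs_def])
  qed
qed

text \<open>The chain rule keeps the inner function: the derivative is \<open>h'\<close> composed
  with the same \<open>f\<close>, times a derivative of \<open>f\<close>. So the induction
  generalises over \<open>h\<close> only.\<close>

lemma Ck_on_compose:
  fixes h :: "real \<Rightarrow> real"
  assumes "open S" "open T" "f ` S \<subseteq> T" "Ck_on k T h" "Ck_on k S f"
  shows "Ck_on k S (\<lambda>x. h (f x))"
  using assms(4,5)
proof (induction k arbitrary: h)
  case 0
  then show ?case using assms(3) continuous_on_compose2 by (metis Ck_on.simps(1))
next
  case (Suc k)
  show ?case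
  proof (rule Ck_on_SucI[OF assms(1)])
    fix x assume x: "x \<in> S"
    have "(h has_derivative (\<lambda>v. frechet_derivative h (at (f x)) v)) (at (f x))"
      using Suc.prems assms x by (intro Ck_on_has_derivative) auto
    from has_derivative_compose[OF Ck_on_has_derivative[OF Suc.prems(2) assms(1) x] this]
    have 1: "((\<lambda>x. h (f x)) has_derivative
      (\<lambda>v. frechet_derivative h (at (f x)) (frechet_derivative f (at x) v))) (at x)" .
    have "linear (frechet_derivative h (at (f x)))"
      using Suc.prems assms x by (intro linear_frechet_derivative) (auto simp: Ck_on_Suc_open simp del:
          Ck_on.simps)
    then have "frechet_derivative h (at (f x)) v = v * partial_deriv 1 h (f x)" for v
      using linear_scale[of "frechet_derivative h (at (f x))" v 1] by (simp add: partial_deriv_def)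
    with 1 show "((\<lambda>x. h (f x)) has_derivative
      (\<lambda>v. frechet_derivative f (at x) v * partial_deriv 1 h (f x))) (at x)" by simp
  next
    fix i :: 'a assume "i \<in> Basis"
    then show "Ck_on k S (\<lambda>x. frechet_derivative f (at x) i * partial_deriv 1 h (f x))"
      using Suc.prems(2)[unfolded Ck_on_Suc_open[OF assms(1)]]
        Suc.prems(1)[unfolded Ck_on_Suc_open[OF assms(2)]]
        Suc.IH[of "partial_deriv 1 h", OF _ Suc.prems(2)[THEN Ck_on_SucD[OF assms(1)]]]
      by (intro Ck_on_mult assms(1)) (simp_all add: partial_deriv_def[abs_def])
  qed
qed

text \<open>Turns the one-sided smoothness of a cutoff on \<open>{0..}\<close> into ordinary
  smoothness on \<open>{0<..}\<close>, since in the interior a derivative within the set is a full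
  derivative.\<close>

lemma Ck_on_subset:
  assumes "Ck_on k S f" "open T" "T \<subseteq> interior S"
  shows "Ck_on k T f"
  using assms(1)
proof (induction k arbitrary: f)
  case 0
  then show ?case using assms interior_subset continuous_on_subset
    by (metis Ck_on.simps(1) subset_trans)
next
  case (Suc k)
  have *: "at x within S = at x" if "x \<in> T" for x
    using at_within_interior assms that by auto
  have "Ck_on k T (partial_deriv i f)" if "i \<in> Basis" for i
    by (rule Ck_on_cong[OF assms(2) _ Suc.IH[of "\<lambda>x. frechet_derivative f (at x within S) i"]])
      (use * Suc.prems that in \<open>simp_all add: partial_deriv_def\<close>)
  moreover have "f differentiable (at x)" if "x \<in> T" for x
    using Suc.prems * that assms(3) interior_subset[of S]
    by (metis Ck_on.simps(2) differentiable_on_def subsetD)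
  ultimately show ?case by (simp add: Ck_on_Suc_open[OF assms(2)] del: Ck_on.simps)
qed

lemma Ck_on_Un:
  assumes "open S" "open T" "Ck_on k S f" "Ck_on k T f"
  shows "Ck_on k (S \<union> T) f"
  using assms(3,4)
proof (induction k arbitrary: f)
  case 0
  then show ?case using assms by (simp add: continuous_on_open_Un)
next
  case (Suc k)
  then show ?case
    using assms(1,2) by (auto simp: Ck_on_Suc_open open_Un simp del: Ck_on.simps)
qed

lemma smooth_on_cong:
  assumes "smooth_on S f" "open S" "\<And>x. x \<in> S \<Longrightarrow> f x = g x"
  shows "smooth_on S g"
  using assms Ck_on_cong unfolding smooth_on_def by metis

lemma smooth_on_const [simp]: "open S \<Longrightarrow> smooth_on S (\<lambda>x. c)"
  by (simp add: smooth_on_def Ck_on_const)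

lemma smooth_on_add:
  "open S \<Longrightarrow> smooth_on S f \<Longrightarrow> smooth_on S g \<Longrightarrow> smooth_on S (\<lambda>x. f x + g x)"
  by (simp add: smooth_on_def Ck_on_add)

lemma smooth_on_mult:
  "open S \<Longrightarrow> smooth_on S f \<Longrightarrow> smooth_on S g \<Longrightarrow> smooth_on S (\<lambda>x. f x * g x)"
  by (simp add: smooth_on_def Ck_on_mult)

lemma smooth_on_minus: "open S \<Longrightarrow> smooth_on S f \<Longrightarrow> smooth_on S (\<lambda>x. - f x)"
  using smooth_on_mult[of S "\<lambda>x. -1" f] by simp

lemma smooth_on_diff:
  "open S \<Longrightarrow> smooth_on S f \<Longrightarrow> smooth_on S g \<Longrightarrow> smooth_on S (\<lambda>x. f x - g x)"
  using smooth_on_add[of S f "\<lambda>x. - g x"] smooth_on_minus[of S g] by simp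

lemma smooth_on_divide_const:
  "open S \<Longrightarrow> smooth_on S f \<Longrightarrow> smooth_on S (\<lambda>x. f x / c)"
  using smooth_on_mult[of S f "\<lambda>x. 1 / c"] by simp

lemma smooth_on_power:
  "open S \<Longrightarrow> smooth_on S f \<Longrightarrow> smooth_on S (\<lambda>x. f x ^ n)"
  by (induction n) (simp_all add: smooth_on_mult)

lemma smooth_on_sum:
  assumes "open S" "\<And>i. i \<in> I \<Longrightarrow> smooth_on S (f i)"
  shows "smooth_on S (\<lambda>x. \<Sum>i\<in>I. f i x)"
  using assms(2)
  by (induction I rule: infinite_finite_induct) (simp_all add: assms(1) smooth_on_add)

lemma smooth_on_compose:
  fixes h :: "real \<Rightarrow> real"
  assumes "open S" "open T" "smooth_on T h" "smooth_on S f" "f ` S \<subseteq> T"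
  shows "smooth_on S (\<lambda>x. h (f x))"
  using assms Ck_on_compose unfolding smooth_on_def by blast

lemma smooth_on_subset:
  "smooth_on S f \<Longrightarrow> open T \<Longrightarrow> T \<subseteq> interior S \<Longrightarrow> smooth_on T f"
  using Ck_on_subset unfolding smooth_on_def by blast

lemma smooth_on_Un:
  "open S \<Longrightarrow> open T \<Longrightarrow> smooth_on S f \<Longrightarrow> smooth_on T f \<Longrightarrow> smooth_on (S \<union> T) f"
  by (simp add: smooth_on_def Ck_on_Un)

lemma smooth_on_partial_deriv:
  "open S \<Longrightarrow> smooth_on S f \<Longrightarrow> i \<in> Basis \<Longrightarrow> smooth_on S (partial_deriv i f)"
  unfolding smooth_on_def by (metis Ck_on_Suc_open)

lemma smooth_on_imp_continuous_on: "smooth_on S f \<Longrightarrow> continuous_on S f"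
  unfolding smooth_on_def by (metis Ck_on_imp_continuous_on)

lemma smooth_on_has_derivative:
  assumes "smooth_on S f" "open S" "x \<in> S"
  shows "(f has_derivative (\<lambda>v. frechet_derivative f (at x) v)) (at x)"
  using assms Ck_on_has_derivative unfolding smooth_on_def by blast

lemma smooth_on_SucI:
  assumes "open S" "\<And>x. x \<in> S \<Longrightarrow> (f has_derivative f' x) (at x)"
    and "\<And>i. i \<in> Basis \<Longrightarrow> smooth_on S (\<lambda>x. f' x i)"
  shows "smooth_on S f"
  unfolding smooth_on_def
proof
  fix k
  show "Ck_on k S f"
    using Ck_on_SucI[OF assms(1,2), where k = k] assms(3) Ck_on_SucD[OF assms(1)]
    unfolding smooth_on_def by blast
qed

lemma smooth_on_inner: "open S \<Longrightarrow> smooth_on S (\<lambda>x. x \<bullet> v)"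
  by (rule smooth_on_SucI[where f' = "\<lambda>_ u. u \<bullet> v"]) (auto intro!: derivative_eq_intros)

section \<open>Rules for partial derivatives and their symmetry\<close>

lemma frechet_derivative_eq_sum:
  fixes f :: "'a::euclidean_space \<Rightarrow> real"
  assumes "smooth_on S f" "open S" "x \<in> S"
  shows "frechet_derivative f (at x) v = (\<Sum>i\<in>Basis. (v \<bullet> i) * partial_deriv i f x)"
proof -
  have lin: "linear (frechet_derivative f (at x))"
    using smooth_on_has_derivative[OF assms] has_derivative_linear by blast
  have "frechet_derivative f (at x) v = frechet_derivative f (at x) (\<Sum>i\<in>Basis. (v \<bullet> i) *\<^sub>R i)"
    by (simp add: euclidean_representation)
  also have "\<dots> = (\<Sum>i\<in>Basis. (v \<bullet> i) * partial_deriv i f x)"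
    using lin by (simp add: linear_sum linear_scale partial_deriv_def)
  finally show ?thesis .
qed

lemma partial_deriv_const [simp]: "partial_deriv i (\<lambda>x. c) x = 0"
  by (simp add: partial_deriv_def)

lemma partial_deriv_add:
  assumes "smooth_on S f" "smooth_on S g" "open S" "x \<in> S"
  shows "partial_deriv i (\<lambda>x. f x + g x) x = partial_deriv i f x + partial_deriv i g x"
  using partial_deriv_eqI[OF has_derivative_add[OF smooth_on_has_derivative[OF assms(1,3,4)]
      smooth_on_has_derivative[OF assms(2-4)]], of i] by (simp add: partial_deriv_def)

lemma partial_deriv_mult:
  assumes "smooth_on S f" "smooth_on S g" "open S" "x \<in> S"
  shows "partial_deriv i (\<lambda>x. f x * g x) x = f x * partial_deriv i g x + partial_deriv i f x * g x"
  using partial_deriv_eqI[OF has_derivative_mult[OF smooth_on_has_derivative[OF assms(1,3,4)]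
      smooth_on_has_derivative[OF assms(2-4)]], of i] by (simp add: partial_deriv_def)

lemma partial_deriv_minus:
  assumes "smooth_on S f" "open S" "x \<in> S"
  shows "partial_deriv i (\<lambda>x. - f x) x = - partial_deriv i f x"
  using partial_deriv_mult[of S "\<lambda>_. -1" f x i] assms by simp

lemma partial_deriv_cmult:
  assumes "smooth_on S f" "open S" "x \<in> S"
  shows "partial_deriv i (\<lambda>x. c * f x) x = c * partial_deriv i f x"
  using partial_deriv_mult[of S "\<lambda>_. c" f x i] assms by simp

lemma partial_deriv_diff:
  assumes "smooth_on S f" "smooth_on S g" "open S" "x \<in> S"
  shows "partial_deriv i (\<lambda>x. f x - g x) x = partial_deriv i f x - partial_deriv i g x"
  using partial_deriv_add[OF assms(1) smooth_on_minus[OF assms(3,2)] assms(3,4), of i]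
    partial_deriv_minus[OF assms(2-4), of i] by simp

lemma partial_deriv_sum:
  assumes "\<And>j. j \<in> I \<Longrightarrow> smooth_on S (f j)" "open S" "x \<in> S"
  shows "partial_deriv i (\<lambda>x. \<Sum>j\<in>I. f j x) x = (\<Sum>j\<in>I. partial_deriv i (f j) x)"
  using assms(1)
  by (induction I rule: infinite_finite_induct)
    (simp_all add: partial_deriv_add[OF _ _ assms(2,3)] smooth_on_sum assms(2))

lemma partial_deriv_inner: "partial_deriv i (\<lambda>x. x \<bullet> v) x = i \<bullet> v"
  by (rule partial_deriv_eqI[where f' = "\<lambda>u. u \<bullet> v"]) (auto intro!: derivative_eq_intros)

lemma partial_deriv_compose:
  fixes h :: "real \<Rightarrow> real"
  assumes "smooth_on S f" "open S" "x \<in> S" "(h has_field_derivative h') (at (f x))"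
  shows "partial_deriv i (\<lambda>x. h (f x)) x = h' * partial_deriv i f x"
  using partial_deriv_eqI[OF has_derivative_compose[OF smooth_on_has_derivative[OF assms(1-3)]
      assms(4)[unfolded has_field_derivative_def]]]
  by (simp add: partial_deriv_def)

lemma has_field_derivative_along_line:
  assumes "smooth_on S f" "open S" "p + s *\<^sub>R v \<in> S"
  shows "((\<lambda>s. f (p + s *\<^sub>R v)) has_field_derivative partial_deriv v f (p + s *\<^sub>R v)) (at s)"
proof -
  have "((\<lambda>s. p + s *\<^sub>R v) has_derivative (\<lambda>t. t *\<^sub>R v)) (at s)"
    by (auto intro!: derivative_eq_intros)
  from has_derivative_compose[OF this smooth_on_has_derivative[OF assms]]
  have *: "((\<lambda>s. f (p + s *\<^sub>R v)) has_derivative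
      (\<lambda>t. frechet_derivative f (at (p + s *\<^sub>R v)) (t *\<^sub>R v))) (at s)" .
  have "linear (frechet_derivative f (at (p + s *\<^sub>R v)))"
    using smooth_on_has_derivative[OF assms] has_derivative_linear by blast
  then have "frechet_derivative f (at (p + s *\<^sub>R v)) (t *\<^sub>R v) =
      partial_deriv v f (p + s *\<^sub>R v) * t" for t
    by (simp add: linear_scale partial_deriv_def)
  with * show ?thesis by (simp add: has_field_derivative_def)
qed

text \<open>Two mean value theorems, first along \<open>i\<close> and then along \<open>j\<close>;
  each moves by at most \<open>h\<close>, whence the radius \<open>2 * h\<close>. The second
  difference is symmetric in the two directions, so exchanging them yields both mixed derivatives at
  points close to \<open>x\<close>. This is the source of
  \<open>partial_deriv_commute\<close>.\<close>

lemma second_difference_eq: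
  fixes f :: "'a::euclidean_space \<Rightarrow> real"
  assumes f: "smooth_on S f" and S: "open S" and i: "i \<in> Basis" and j: "j \<in> Basis"
    and h: "0 < h" and sub: "cball x (2 * h) \<subseteq> S"
  shows "\<exists>y\<in>cball x (2 * h). f (x + h *\<^sub>R i + h *\<^sub>R j) - f (x + h *\<^sub>R i) - f (x + h *\<^sub>R j) + f x
    = h\<^sup>2 * partial_deriv j (partial_deriv i f) y"
proof -
  have near: "x + s *\<^sub>R i + t *\<^sub>R j \<in> cball x (2 * h)" if "0 \<le> s" "s \<le> h" "0 \<le> t" "t \<le> h" for s t
  proof -
    have "norm (s *\<^sub>R i + t *\<^sub>R j) \<le> norm (s *\<^sub>R i) + norm (t *\<^sub>R j)" by (rule norm_triangle_ineq)
    also have "\<dots> \<le> 2 * h" using that i j by simp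
    finally show ?thesis using norm_minus_cancel[of "s *\<^sub>R i + t *\<^sub>R j"]
      by (simp add: dist_norm)
  qed
  note near' = near[THEN subsetD[OF sub]]
  define \<phi> where "\<phi> s = f (x + h *\<^sub>R j + s *\<^sub>R i) - f (x + s *\<^sub>R i)" for s
  have "\<exists>s. 0 < s \<and> s < h \<and> \<phi> h - \<phi> 0 = (h - 0) *
      (partial_deriv i f (x + h *\<^sub>R j + s *\<^sub>R i) - partial_deriv i f (x + s *\<^sub>R i))"
  proof (rule MVT2[OF h])
    fix s assume s: "0 \<le> s" "s \<le> h"
    show "DERIV \<phi> s :> partial_deriv i f (x + h *\<^sub>R j + s *\<^sub>R i) - partial_deriv i f (x + s *\<^sub>R i)"
      unfolding \<phi>_def using near'[OF s, of h] near'[OF s, of 0] h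
      by (intro DERIV_diff has_field_derivative_along_line[OF f S]) (auto simp: algebra_simps)
  qed
  then obtain s where s: "0 < s" "s < h" and 1: "\<phi> h - \<phi> 0 = h *
      (partial_deriv i f (x + h *\<^sub>R j + s *\<^sub>R i) - partial_deriv i f (x + s *\<^sub>R i))" by auto
  have "\<exists>t. 0 < t \<and> t < h \<and> partial_deriv i f (x + s *\<^sub>R i + h *\<^sub>R j) - partial_deriv i f (x + s *\<^sub>R i
      + 0 *\<^sub>R j)
     = (h - 0) * partial_deriv j (partial_deriv i f) (x + s *\<^sub>R i + t *\<^sub>R j)"
    using s near' by (intro MVT2[OF h] has_field_derivative_along_line[OF smooth_on_partial_deriv[OF S f
        i] S]) auto
  then obtain t where t: "0 < t" "t < h" and 2: "partial_deriv i f (x + s *\<^sub>R i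
      + h *\<^sub>R j) - partial_deriv i f (x + s *\<^sub>R i)
     = h * partial_deriv j (partial_deriv i f) (x + s *\<^sub>R i + t *\<^sub>R j)" by auto
  have "f (x + h *\<^sub>R i + h *\<^sub>R j) - f (x + h *\<^sub>R i) - f (x + h *\<^sub>R j) + f x = \<phi> h - \<phi> 0"
    by (simp add: \<phi>_def algebra_simps)
  also have "\<dots> = h\<^sup>2 * partial_deriv j (partial_deriv i f) (x + s *\<^sub>R i + t *\<^sub>R j)"
    using 1 2 by (simp add: algebra_simps power2_eq_square)
  finally show ?thesis using near[of s t] s t by force
qed

lemma partial_deriv_commute:
  fixes f :: "'a::euclidean_space \<Rightarrow> real"
  assumes f: "smooth_on S f" and S: "open S" and x: "x \<in> S" and i: "i \<in> Basis" and j: "j \<in> Basis"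
  shows "partial_deriv i (partial_deriv j f) x = partial_deriv j (partial_deriv i f) x"
proof -
  obtain r where r: "r > 0" "cball x r \<subseteq> S" using S x open_contains_cball by blast
  define h where "h n = r / (2 * Suc n)" for n
  have h: "h n > 0" "2 * h n \<le> r" for n using r by (auto simp: h_def field_simps)
  have sub: "cball x (2 * h n) \<subseteq> S" for n using r h[of n] subset_cball[of "2 * h n" r x] by blast
  have h0: "(\<lambda>n. 2 * h n) \<longlonglongrightarrow> 0"
  proof -
    have "(\<lambda>n. 2 * h n) = (\<lambda>n. r / real (Suc n))" by (auto simp: h_def field_simps)
    then show ?thesis using LIMSEQ_Suc[OF lim_const_over_n[of r]] by simp
  qed
  have "\<forall>n. \<exists>y z. y \<in> cball x (2 * h n) \<and> z \<in> cball x (2 * h n) \<and>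
    partial_deriv j (partial_deriv i f) y = partial_deriv i (partial_deriv j f) z"
  proof
    fix n
    obtain y where y: "y \<in> cball x (2 * h n)"
      "f (x + h n *\<^sub>R i + h n *\<^sub>R j) - f (x + h n *\<^sub>R i) - f (x + h n *\<^sub>R j) + f x
        = (h n)\<^sup>2 * partial_deriv j (partial_deriv i f) y"
      using second_difference_eq[OF f S i j h(1) sub] by blast
    obtain z where z: "z \<in> cball x (2 * h n)"
      "f (x + h n *\<^sub>R j + h n *\<^sub>R i) - f (x + h n *\<^sub>R j) - f (x + h n *\<^sub>R i) + f x
        = (h n)\<^sup>2 * partial_deriv i (partial_deriv j f) z"
      using second_difference_eq[OF f S j i h(1) sub] by blast
    have eq: "x + h n *\<^sub>R j + h n *\<^sub>R i = x + h n *\<^sub>R i + h n *\<^sub>R j" by (simp add: algebra_simps)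
    have "(h n)\<^sup>2 * partial_deriv j (partial_deriv i f) y = (h n)\<^sup>2 * partial_deriv i (partial_deriv j f) z"
      using y(2) z(2) unfolding eq by linarith
    then show "\<exists>y z. y \<in> cball x (2 * h n) \<and> z \<in> cball x (2 * h n) \<and>
      partial_deriv j (partial_deriv i f) y = partial_deriv i (partial_deriv j f) z"
      using h(1)[of n] y(1) z(1) by (metis less_irrefl mult_left_cancel power_not_zero)
  qed
  then obtain y z where yz: "\<And>n. y n \<in> cball x (2 * h n)" "\<And>n. z n \<in> cball x (2 * h n)"
    "\<And>n. partial_deriv j (partial_deriv i f) (y n) = partial_deriv i (partial_deriv j f) (z n)"
    by metis
  have conv: "y' \<longlonglongrightarrow> x" if "\<And>n. y' n \<in> cball x (2 * h n)" for y'
  proof -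
    have "(\<lambda>n. dist (y' n) x) \<longlonglongrightarrow> 0"
      by (rule tendsto_sandwich[OF _ _ tendsto_const h0]) (use that in \<open>auto simp: dist_commute\<close>)
    then show ?thesis using tendsto_dist_iff by blast
  qed
  have lim: "(\<lambda>n. g (y' n)) \<longlonglongrightarrow> g x" if "\<And>n. y' n \<in> cball x (2 * h n)" "smooth_on S g"
    for y' and g :: "'a \<Rightarrow> real"
  proof (rule isCont_tendsto_compose[OF _ conv[OF that(1)]])
    show "isCont g x" using smooth_on_imp_continuous_on[OF that(2)] S x continuous_on_eq_continuous_at
        by blast
  qed
  have "(\<lambda>n. partial_deriv j (partial_deriv i f) (y n)) \<longlonglongrightarrow> partial_deriv j (partial_deriv i f) x"
    by (rule lim[OF yz(1)]) (intro smooth_on_partial_deriv S f i j)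
  moreover have "(\<lambda>n. partial_deriv i (partial_deriv j f) (z n)) \<longlonglongrightarrow> partial_deriv i (partial_deriv j f) x"
    by (rule lim[OF yz(2)]) (intro smooth_on_partial_deriv S f i j)
  ultimately show ?thesis using LIMSEQ_unique unfolding yz(3) by blast
qed

lemma partial_deriv_norm_power2: "partial_deriv i (\<lambda>x. (norm x)\<^sup>2) x = 2 * (x \<bullet> i)"
  unfolding power2_norm_eq_inner
  by (rule partial_deriv_eqI[where f' = "\<lambda>u. 2 * (x \<bullet> u)"])
    (auto intro!: derivative_eq_intros simp: inner_commute)

section \<open>The Euler field and the angular Laplacian\<close>

definition euler :: "('a::euclidean_space \<Rightarrow> real) \<Rightarrow> 'a \<Rightarrow> real" where
  "euler f x = (\<Sum>i\<in>Basis. (x \<bullet> i) * partial_deriv i f x)"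

text \<open>In polar coordinates \<open>euler\<close> is \<open>r \<partial>\<^sub>r\<close> and \<open>ang_laplacian\<close> is the Laplace-Beltrami operator
  in the angular variable.\<close>

definition ang_laplacian :: "('a::euclidean_space \<Rightarrow> real) \<Rightarrow> 'a \<Rightarrow> real" where
  "ang_laplacian f x =
     (norm x)\<^sup>2 * laplacian f x - euler (euler f) x - (real DIM('a) - 2) * euler f x"

text \<open>The inner product of the spherical gradients: \<open>|x|^2\<close> times the Euclidean
  one minus its radial part. It is the carre du champ of \<open>ang_laplacian\<close>.\<close>

definition ang_form :: "('a::euclidean_space \<Rightarrow> real) \<Rightarrow> ('a \<Rightarrow> real) \<Rightarrow> 'a \<Rightarrow> real" where
  "ang_form f h x =
     (norm x)\<^sup>2 * (\<Sum>i\<in>Basis. partial_deriv i f x * partial_deriv i h x) - euler f x * euler h x"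

lemma inner_grad_eq_euler: "x \<bullet> grad f x = euler f x"
  by (simp add: grad_def euler_def inner_sum_right mult.commute)

lemma norm_power2_eq_sum: "(norm x)\<^sup>2 = (\<Sum>i\<in>Basis. (x \<bullet> i) * (x \<bullet> i))"
  using euclidean_inner[of x x] by (simp add: power2_norm_eq_inner)

lemma euler_cong:
  assumes "open S" "x \<in> S" "\<And>y. y \<in> S \<Longrightarrow> f y = g y"
  shows "euler f x = euler g x"
  unfolding euler_def by (simp only: partial_deriv_cong[OF assms])

lemma laplacian_cong:
  assumes "open S" "x \<in> S" "\<And>y. y \<in> S \<Longrightarrow> f y = g y"
  shows "laplacian f x = laplacian g x"
  unfolding laplacian_def
  by (intro sum.cong refl partial_deriv_cong[OF assms(1,2)]) (rule partial_deriv_cong[OF assms(1) _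
      assms(3)])

lemma smooth_on_norm_power2: "open S \<Longrightarrow> smooth_on S (\<lambda>x. (norm x)\<^sup>2)"
  unfolding norm_power2_eq_sum by (intro smooth_on_sum smooth_on_mult smooth_on_inner)

lemma smooth_on_euler: "open S \<Longrightarrow> smooth_on S f \<Longrightarrow> smooth_on S (euler f)"
  unfolding euler_def[abs_def]
  by (intro smooth_on_sum smooth_on_mult smooth_on_inner smooth_on_partial_deriv)

lemma smooth_on_laplacian: "open S \<Longrightarrow> smooth_on S f \<Longrightarrow> smooth_on S (laplacian f)"
  unfolding laplacian_def[abs_def] by (intro smooth_on_sum smooth_on_partial_deriv)

lemma smooth_on_ang_laplacian: "open S \<Longrightarrow> smooth_on S f \<Longrightarrow> smooth_on S (ang_laplacian f)"
  unfolding ang_laplacian_def[abs_def]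
  by (intro smooth_on_diff smooth_on_mult smooth_on_norm_power2 smooth_on_euler smooth_on_laplacian
      smooth_on_const)

lemma smooth_on_ang_form:
  "open S \<Longrightarrow> smooth_on S f \<Longrightarrow> smooth_on S h \<Longrightarrow> smooth_on S (ang_form f h)"
  unfolding ang_form_def[abs_def]
  by (intro smooth_on_diff smooth_on_sum smooth_on_mult smooth_on_norm_power2 smooth_on_euler
      smooth_on_partial_deriv)

lemma ang_form_commute: "ang_form f h x = ang_form h f x"
  by (simp add: ang_form_def mult.commute)

lemma ang_form_nonneg: "0 \<le> ang_form f f x"
proof -
  have "(x \<bullet> grad f x)\<^sup>2 \<le> (x \<bullet> x) * (grad f x \<bullet> grad f x)" by (rule Cauchy_Schwarz_ineq)
  moreover have "grad f x \<bullet> grad f x = (\<Sum>i\<in>Basis. partial_deriv i f x * partial_deriv i f x)"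
    by (simp add: grad_def inner_sum_right inner_sum_left inner_Basis if_distrib cong: if_cong)
  ultimately show ?thesis
    by (simp add: ang_form_def inner_grad_eq_euler power2_eq_square dot_square_norm)
qed

section \<open>Product rules and commutators of the Euler field and the angular Laplacian\<close>

context
  fixes S :: "'a::euclidean_space set"
  assumes S: "open S"
begin

lemma euler_const [simp]: "euler (\<lambda>x::'a. c) x = 0"
  by (simp add: euler_def)

lemma euler_add:
  "smooth_on S f \<Longrightarrow> smooth_on S h \<Longrightarrow> x \<in> S \<Longrightarrow> euler (\<lambda>x. f x + h x) x = euler f x + euler h x"
  by (simp add: euler_def partial_deriv_add[OF _ _ S] sum.distrib algebra_simps)

lemma euler_diff:
  "smooth_on S f \<Longrightarrow> smooth_on S h \<Longrightarrow> x \<in> S \<Longrightarrow> euler (\<lambda>x. f x - h x) x = euler f x - euler h x"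
  by (simp add: euler_def partial_deriv_diff[OF _ _ S] sum_subtractf algebra_simps)

lemma euler_mult:
  "smooth_on S f \<Longrightarrow> smooth_on S h \<Longrightarrow> x \<in> S \<Longrightarrow>
    euler (\<lambda>x. f x * h x) x = f x * euler h x + euler f x * h x"
  by (simp add: euler_def partial_deriv_mult[OF _ _ S] sum.distrib algebra_simps sum_distrib_left)

lemma euler_cmult: "smooth_on S f \<Longrightarrow> x \<in> S \<Longrightarrow> euler (\<lambda>x. c * f x) x = c * euler f x"
  by (simp add: euler_def partial_deriv_cmult[OF _ S] algebra_simps sum_distrib_left)

lemma euler_sum:
  "(\<And>j. j \<in> I \<Longrightarrow> smooth_on S (f j)) \<Longrightarrow> x \<in> S \<Longrightarrow>
    euler (\<lambda>x. \<Sum>j\<in>I. f j x) x = (\<Sum>j\<in>I. euler (f j) x)"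
  by (simp add: euler_def partial_deriv_sum[OF _ S] sum_distrib_left) (rule sum.swap)

lemma laplacian_add:
  assumes f: "smooth_on S f" and h: "smooth_on S h" and x: "x \<in> S"
  shows "laplacian (\<lambda>x. f x + h x) x = laplacian f x + laplacian h x"
proof -
  have "partial_deriv i (partial_deriv i (\<lambda>x. f x + h x)) x
      = partial_deriv i (partial_deriv i f) x + partial_deriv i (partial_deriv i h) x"
          if i: "i \<in> Basis" for i
  proof -
    have "partial_deriv i (partial_deriv i (\<lambda>x. f x + h x)) x
      = partial_deriv i (\<lambda>x. partial_deriv i f x + partial_deriv i h x) x"
      by (rule partial_deriv_cong[OF S x partial_deriv_add[OF f h S]])
    also have "\<dots> = partial_deriv i (partial_deriv i f) x + partial_deriv i (partial_deriv i h) x"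
      using x i by (intro partial_deriv_add[OF _ _ S] smooth_on_partial_deriv S f h) auto
    finally show ?thesis .
  qed
  then show ?thesis by (simp add: laplacian_def sum.distrib)
qed

lemma laplacian_mult:
  assumes f: "smooth_on S f" and h: "smooth_on S h" and x: "x \<in> S"
  shows "laplacian (\<lambda>x. f x * h x) x =
    f x * laplacian h x + 2 * (\<Sum>i\<in>Basis. partial_deriv i f x * partial_deriv i h x) + laplacian f x * h x"
proof -
  have "partial_deriv i (partial_deriv i (\<lambda>x. f x * h x)) x
      = f x * partial_deriv i (partial_deriv i h) x + 2 * (partial_deriv i f x * partial_deriv i h x)
        + partial_deriv i (partial_deriv i f) x * h x" if i: "i \<in> Basis" for i
  proof -
    note [intro] = f h S x smooth_on_partial_deriv[OF S f i] smooth_on_partial_deriv[OF S h i]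
    have "partial_deriv i (partial_deriv i (\<lambda>x. f x * h x)) x
      = partial_deriv i (\<lambda>x. f x * partial_deriv i h x + partial_deriv i f x * h x) x"
      by (rule partial_deriv_cong[OF S x partial_deriv_mult[OF f h S]])
    also have "\<dots> = partial_deriv i (\<lambda>x. f x * partial_deriv i h x) x
        + partial_deriv i (\<lambda>x. partial_deriv i f x * h x) x"
      by (intro partial_deriv_add[OF _ _ S]) (auto intro!: smooth_on_mult)
    also have "partial_deriv i (\<lambda>x. f x * partial_deriv i h x) x =
        f x * partial_deriv i (partial_deriv i h) x + partial_deriv i f x * partial_deriv i h x"
      by (intro partial_deriv_mult[OF _ _ S]) auto
    also have "partial_deriv i (\<lambda>x. partial_deriv i f x * h x) x =
        partial_deriv i f x * partial_deriv i h x + partial_deriv i (partial_deriv i f) x * h x"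
      by (intro partial_deriv_mult[OF _ _ S]) auto
    finally show ?thesis by simp
  qed
  then show ?thesis by (simp add: laplacian_def sum.distrib sum_distrib_left sum_distrib_right)
qed

lemma euler_euler_mult:
  assumes f: "smooth_on S f" and h: "smooth_on S h" and x: "x \<in> S"
  shows "euler (euler (\<lambda>x. f x * h x)) x =
    f x * euler (euler h) x + 2 * (euler f x * euler h x) + euler (euler f) x * h x"
proof -
  have "euler (euler (\<lambda>x. f x * h x)) x = euler (\<lambda>x. f x * euler h x + euler f x * h x) x"
    by (rule euler_cong[OF S x euler_mult[OF f h]])
  also have "\<dots> = euler (\<lambda>x. f x * euler h x) x + euler (\<lambda>x. euler f x * h x) x"
    by (intro euler_add smooth_on_mult smooth_on_euler S f h x)
  finally show ?thesis
    by (simp add: euler_mult[OF f smooth_on_euler[OF S h] x] euler_mult[OF smooth_on_euler[OF S f] h x])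
qed

text \<open>Both second-order parts of \<open>ang_laplacian\<close> produce a mixed term, and the
  difference of these is \<open>2 * ang_form f h\<close>; the first-order part is a
  derivation.\<close>

lemma ang_laplacian_mult:
  assumes f: "smooth_on S f" and h: "smooth_on S h" and x: "x \<in> S"
  shows "ang_laplacian (\<lambda>x. f x * h x) x =
    f x * ang_laplacian h x + 2 * ang_form f h x + ang_laplacian f x * h x"
  unfolding ang_laplacian_def ang_form_def laplacian_mult[OF assms] euler_euler_mult[OF assms]
    euler_mult[OF assms] by (simp add: algebra_simps)

lemma ang_laplacian_add:
  assumes f: "smooth_on S f" and h: "smooth_on S h" and x: "x \<in> S"
  shows "ang_laplacian (\<lambda>x. f x + h x) x = ang_laplacian f x + ang_laplacian h x"
proof -
  have "euler (euler (\<lambda>x. f x + h x)) x = euler (\<lambda>x. euler f x + euler h x) x"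
    by (rule euler_cong[OF S x euler_add[OF f h]])
  also have "\<dots> = euler (euler f) x + euler (euler h) x"
    by (intro euler_add smooth_on_euler S f h x)
  finally show ?thesis
    unfolding ang_laplacian_def laplacian_add[OF assms] euler_add[OF assms] by (simp add: algebra_simps)
qed

lemma ang_laplacian_const: "ang_laplacian (\<lambda>x::'a. c) x = 0"
  by (simp add: ang_laplacian_def laplacian_def euler_def[abs_def] partial_deriv_def[abs_def])

lemma ang_laplacian_cmult:
  assumes f: "smooth_on S f" and x: "x \<in> S"
  shows "ang_laplacian (\<lambda>x. c * f x) x = c * ang_laplacian f x"
  using ang_laplacian_mult[OF smooth_on_const[OF S] f x]
  by (simp add: ang_laplacian_const ang_form_def)

lemma ang_laplacian_sum:
  assumes "\<And>j. j \<in> I \<Longrightarrow> smooth_on S (f j)" "x \<in> S"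
  shows "ang_laplacian (\<lambda>x. \<Sum>j\<in>I. f j x) x = (\<Sum>j\<in>I. ang_laplacian (f j) x)"
  using assms(1)
  by (induction I rule: infinite_finite_induct)
    (simp_all add: ang_laplacian_const ang_laplacian_add[OF _ _ assms(2)] smooth_on_sum S)

text \<open>Differentiating the coefficient \<open>x \<bullet> j\<close> gives the extra
  \<open>partial_deriv i f\<close>; exchanging the order of the second derivatives gives the
  rest.\<close>

lemma partial_deriv_euler:
  assumes f: "smooth_on S f" and x: "x \<in> S" and i: "i \<in> Basis"
  shows "partial_deriv i (euler f) x = partial_deriv i f x + euler (partial_deriv i f) x"
proof -
  have "partial_deriv i (euler f) x = (\<Sum>j\<in>Basis. partial_deriv i (\<lambda>x. (x \<bullet> j) * partial_deriv j f x) x)"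
    unfolding euler_def[abs_def]
    by (intro partial_deriv_sum[OF _ S x] smooth_on_mult smooth_on_inner smooth_on_partial_deriv S f)
  also have "\<dots> = (\<Sum>j\<in>Basis. (x \<bullet> j) * partial_deriv i (partial_deriv j f) x
      + (i \<bullet> j) * partial_deriv j f x)"
    using partial_deriv_mult[OF smooth_on_inner[OF S] smooth_on_partial_deriv[OF S f] S x]
    by (intro sum.cong) (simp_all add: partial_deriv_inner)
  also have "\<dots> = (\<Sum>j\<in>Basis. (x \<bullet> j) * partial_deriv j (partial_deriv i f) x)
      + (\<Sum>j\<in>Basis. (i \<bullet> j) * partial_deriv j f x)"
    using partial_deriv_commute[OF f S x] i by (simp add: sum.distrib)
  also have "(\<Sum>j\<in>Basis. (i \<bullet> j) * partial_deriv j f x) = partial_deriv i f x"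
    using i by (simp add: inner_Basis if_distrib[of "\<lambda>c. c * _"] cong: if_cong)
  finally show ?thesis by (simp add: euler_def[abs_def])
qed

lemma euler_norm_power2: "euler (\<lambda>x::'a. (norm x)\<^sup>2) x = 2 * (norm x)\<^sup>2"
  unfolding euler_def partial_deriv_norm_power2
  by (simp add: norm_power2_eq_sum sum_distrib_left algebra_simps)

text \<open>The axial derivative of the cylinder commutes with the angular gradient. In coordinates,
  differentiating the weight \<open>(norm x)\<^sup>2\<close> produces
  \<open>2 * (norm x)\<^sup>2 * ?G x\<close>, which cancels the two commutator terms from
  \<open>partial_deriv_euler\<close>.\<close>

lemma euler_ang_form:
  assumes f: "smooth_on S f" and h: "smooth_on S h" and x: "x \<in> S"
  shows "euler (ang_form f h) x = ang_form (euler f) h x + ang_form f (euler h) x"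
proof -
  note sm = smooth_on_mult smooth_on_euler smooth_on_partial_deriv smooth_on_sum smooth_on_norm_power2 S
      f h x
  let ?G = "\<lambda>x. \<Sum>i\<in>Basis. partial_deriv i f x * partial_deriv i h x"
  have "euler (ang_form f h) x = euler (\<lambda>x. (norm x)\<^sup>2 * ?G x) x - euler (\<lambda>x. euler f x * euler h x) x"
    unfolding ang_form_def[abs_def] by (intro euler_diff sm)
  also have "euler (\<lambda>x. (norm x)\<^sup>2 * ?G x) x = (norm x)\<^sup>2 * euler ?G x + 2 * (norm x)\<^sup>2 * ?G x"
    by (subst euler_mult) (intro sm | simp add: euler_norm_power2)+
  also have "euler ?G x = (\<Sum>i\<in>Basis. euler (\<lambda>x. partial_deriv i f x * partial_deriv i h x) x)"
    by (intro euler_sum sm)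
  also have "\<dots> = (\<Sum>i\<in>Basis. partial_deriv i f x * euler (partial_deriv i h) x
      + euler (partial_deriv i f) x * partial_deriv i h x)"
    by (intro sum.cong refl euler_mult sm)
  also have "\<dots> = (\<Sum>i\<in>Basis. partial_deriv i f x * partial_deriv i (euler h) x
      + partial_deriv i (euler f) x * partial_deriv i h x
          - 2 * (partial_deriv i f x * partial_deriv i h x))"
    by (intro sum.cong) (simp_all add: partial_deriv_euler f h x algebra_simps)
  also have "\<dots> = (\<Sum>i\<in>Basis. partial_deriv i f x * partial_deriv i (euler h) x)
      + (\<Sum>i\<in>Basis. partial_deriv i (euler f) x * partial_deriv i h x) - 2 * ?G x"
    by (simp add: sum.distrib sum_subtractf sum_distrib_left)
  also have "euler (\<lambda>x. euler f x * euler h x) x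
      = euler f x * euler (euler h) x + euler (euler f) x * euler h x"
    by (intro euler_mult sm)
  finally show ?thesis
    by (simp add: ang_form_def[abs_def] algebra_simps)
qed

end

section \<open>Integration by parts\<close>

definition bounded_support :: "('a::real_normed_vector \<Rightarrow> real) \<Rightarrow> bool" where
  "bounded_support f \<longleftrightarrow> (\<exists>R. \<forall>x. R < norm x \<longrightarrow> f x = 0)"

text \<open>Support away from the origin and from infinity. Such a function, if smooth off the
  origin, may be multiplied by any power of \<open>norm x\<close> without losing smoothness or
  integrability, and it leaves no boundary terms.\<close>

definition annular :: "('a::real_normed_vector \<Rightarrow> real) \<Rightarrow> bool" where
  "annular f \<longleftrightarrow> (\<exists>\<rho>>0. \<exists>R. \<forall>x. norm x < \<rho> \<or> R < norm x \<longrightarrow> f x = 0)"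

lemma annularE:
  assumes "annular f"
  obtains \<rho> R where "0 < \<rho>" "\<rho> < R" "\<And>x. norm x < \<rho> \<Longrightarrow> f x = 0" "\<And>x. R < norm x \<Longrightarrow> f x = 0"
proof -
  obtain \<rho> R where "0 < \<rho>" "\<And>x. norm x < \<rho> \<or> R < norm x \<Longrightarrow> f x = 0"
    using assms unfolding annular_def by blast
  then show thesis by (intro that[of \<rho> "max R (\<rho> + 1)"]) auto
qed

lemma annular_imp_bounded_support: "annular f \<Longrightarrow> bounded_support f"
  unfolding annular_def bounded_support_def by blast

lemma annular_mult_left: "annular f \<Longrightarrow> annular (\<lambda>x. f x * g x)"
  unfolding annular_def by (metis mult_eq_0_iff)

lemma annular_mult_right: "annular f \<Longrightarrow> annular (\<lambda>x. g x * f x)"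
  unfolding annular_def by (metis mult_eq_0_iff)

lemma annular_add:
  assumes "annular f" "annular g" shows "annular (\<lambda>x. f x + g x)"
proof -
  obtain \<rho> R \<rho>' R' where "0 < \<rho>" "0 < \<rho>'" "\<forall>x. norm x < \<rho> \<or> R < norm x \<longrightarrow> f x = 0"
    "\<forall>x. norm x < \<rho>' \<or> R' < norm x \<longrightarrow> g x = 0"
    using assms unfolding annular_def by metis
  then show ?thesis unfolding annular_def
    by (intro exI[of _ "min \<rho> \<rho>'"] conjI exI[of _ "max R R'"]) auto
qed

lemma annular_diff: "annular f \<Longrightarrow> annular g \<Longrightarrow> annular (\<lambda>x. f x - g x)"
  using annular_add[of f "\<lambda>x. -1 * g x"] annular_mult_right[of g "\<lambda>_. -1"] by simp

lemma partial_deriv_eq_0_if_locally_0: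
  assumes "open S" "x \<in> S" "\<And>y. y \<in> S \<Longrightarrow> f y = 0"
  shows "partial_deriv i f x = 0"
  using partial_deriv_cong[OF assms(1,2), of f "\<lambda>_. 0" i] assms(3) by simp

lemma open_norm_less: "open {x::'a::real_normed_vector. norm x < r}"
  by (intro open_Collect_less continuous_intros)

lemma open_norm_greater: "open {x::'a::real_normed_vector. r < norm x}"
  by (intro open_Collect_less continuous_intros)

lemma bounded_support_partial_deriv:
  assumes "bounded_support f" shows "bounded_support (partial_deriv i f)"
proof -
  obtain R where R: "\<And>x. R < norm x \<Longrightarrow> f x = 0" using assms unfolding bounded_support_def by blast
  have "partial_deriv i f x = 0" if "R < norm x" for x
    using partial_deriv_eq_0_if_locally_0[OF open_norm_greater[of R], of x f i] R that by simp
  then show ?thesis unfolding bounded_support_def by blast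
qed

lemma annular_partial_deriv:
  assumes "annular f" shows "annular (partial_deriv i f)"
proof -
  obtain \<rho> R where \<rho>: "0 < \<rho>" and R: "\<And>x. norm x < \<rho> \<or> R < norm x \<Longrightarrow> f x = 0"
    using assms unfolding annular_def by blast
  have "partial_deriv i f x = 0" if "norm x < \<rho> \<or> R < norm x" for x
    using partial_deriv_eq_0_if_locally_0[OF open_norm_greater[of R], of x f i]
      partial_deriv_eq_0_if_locally_0[OF open_norm_less[of \<rho>], of x f i] R that by auto
  then show ?thesis using \<rho> unfolding annular_def by blast
qed

lemma annular_0: "annular (\<lambda>x. 0)"
  by (auto simp: annular_def intro: exI[of _ 1])

lemma annular_sum: "finite I \<Longrightarrow> (\<And>i. i \<in> I \<Longrightarrow> annular (f i)) \<Longrightarrow> annular (\<lambda>x. \<Sum>i\<in>I. f i x)"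
  by (induction I rule: finite_induct) (auto intro: annular_add annular_0)

lemma annular_euler: "annular f \<Longrightarrow> annular (euler f)"
  unfolding euler_def[abs_def]
  by (intro annular_sum annular_mult_right annular_partial_deriv finite_Basis)

lemma annular_laplacian: "annular f \<Longrightarrow> annular (laplacian f)"
  unfolding laplacian_def[abs_def]
  by (intro annular_sum annular_partial_deriv finite_Basis)

lemma annular_ang_laplacian: "annular f \<Longrightarrow> annular (ang_laplacian f)"
  unfolding ang_laplacian_def[abs_def]
  by (intro annular_diff annular_mult_right annular_euler annular_laplacian)

lemma annular_ang_form: "annular f \<Longrightarrow> annular (ang_form f h)"
  unfolding ang_form_def[abs_def]
  by (intro annular_diff annular_mult_right annular_sum annular_mult_left annular_euler
      annular_partial_deriv finite_Basis)

text \<open>A ball on which the function is zero and the punctured space together cover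
  everything.\<close>

lemma smooth_on_annular:
  fixes f :: "'a::euclidean_space \<Rightarrow> real"
  assumes "smooth_on (-{0}) f" "annular f"
  shows "smooth_on UNIV f"
proof -
  obtain \<rho> R where "0 < \<rho>" "\<And>x. norm x < \<rho> \<Longrightarrow> f x = 0" using annularE[OF assms(2)] by metis
  then have "smooth_on (ball 0 \<rho>) f"
    by (intro smooth_on_cong[OF smooth_on_const[of "ball 0 \<rho>" 0]]) auto
  from smooth_on_Un[OF _ _ assms(1) this] have "smooth_on (-{0} \<union> ball 0 \<rho>) f" by auto
  moreover have "-{0} \<union> ball (0::'a) \<rho> = UNIV" using \<open>0 < \<rho>\<close> by auto
  ultimately show ?thesis by (simp only:)
qed

lemma integrable_continuous_bounded_support:
  assumes "continuous_on UNIV f" "bounded_support f"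
  shows "integrable lborel f"
proof -
  obtain R where R: "\<And>x. R < norm x \<Longrightarrow> f x = 0" using assms(2) unfolding bounded_support_def by blast
  have "integrable lborel (\<lambda>x. indicator (cball 0 R) x *\<^sub>R f x)"
    by (intro borel_integrable_compact compact_cball continuous_on_subset[OF assms(1)]) auto
  moreover have "(\<lambda>x. indicator (cball 0 R) x *\<^sub>R f x) = f"
    using R by (auto simp: indicator_def fun_eq_iff not_le)
  ultimately show ?thesis by simp
qed

lemma integrable_annular:
  "smooth_on (-{0}) f \<Longrightarrow> annular f \<Longrightarrow> integrable lborel f"
  by (intro integrable_continuous_bounded_support annular_imp_bounded_support
      smooth_on_imp_continuous_on smooth_on_annular)

lemma bounded_support_bounded:
  fixes f :: "'a::euclidean_space \<Rightarrow> real"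
  assumes "continuous_on UNIV f" "bounded_support f"
  obtains M where "\<And>x. \<bar>f x\<bar> \<le> M" "0 \<le> M"
proof -
  obtain R where R: "\<And>x. R < norm x \<Longrightarrow> f x = 0" using assms(2) unfolding bounded_support_def by blast
  have "compact (f ` cball 0 R)"
    by (intro compact_continuous_image continuous_on_subset[OF assms(1)]) auto
  then obtain M where M: "\<And>x. norm x \<le> R \<Longrightarrow> \<bar>f x\<bar> \<le> M"
    using compact_imp_bounded[THEN bounded_iff[THEN iffD1]] by fastforce
  show thesis
    by (rule that[of "max M 0"]) (use R M in \<open>force simp: le_max_iff_disj not_le\<close>)+
qed

lemma integral_translation:
  fixes f :: "'a::euclidean_space \<Rightarrow> real"
  assumes "f \<in> borel_measurable borel"
  shows "(LINT x|lborel. f (x + c)) = (LINT x|lborel. f x)"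
proof -
  have "(LINT x|lborel. f x) = (LINT x|distr lborel borel ((+) c). f x)"
    by (simp add: lborel_distr_plus)
  also have "\<dots> = (LINT x|lborel. f (c + x))"
    using assms by (intro integral_distr) auto
  finally show ?thesis by (simp add: add.commute)
qed

text \<open>By translation invariance the difference quotients of \<open>f\<close> have integral zero.\<close>

lemma integral_partial_deriv_eq_0:
  fixes f :: "'a::euclidean_space \<Rightarrow> real"
  assumes f: "smooth_on UNIV f" and supp: "bounded_support f" and i: "i \<in> Basis"
  shows "(LINT x|lborel. partial_deriv i f x) = 0"
proof -
  have cont: "continuous_on UNIV f" "continuous_on UNIV (partial_deriv i f)"
    using smooth_on_imp_continuous_on smooth_on_partial_deriv[OF open_UNIV f i] f by blast+
  then have [measurable]: "f \<in> borel_measurable borel" "partial_deriv i f \<in> borel_measurable borel"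
    by (auto intro: borel_measurable_continuous_onI)
  obtain M where M: "\<And>x. \<bar>partial_deriv i f x\<bar> \<le> M" "0 \<le> M"
    using bounded_support_bounded[OF cont(2) bounded_support_partial_deriv[OF supp]] by blast
  obtain R where R: "\<And>x. R < norm x \<Longrightarrow> f x = 0" using supp unfolding bounded_support_def by blast
  define h where "h n = 1 / real (Suc n)" for n
  have h: "0 < h n" "h n \<le> 1" for n by (auto simp: h_def)
  have h0: "h \<longlonglongrightarrow> 0" unfolding h_def by (rule LIMSEQ_Suc[OF lim_const_over_n])
  define q where "q n x = (f (x + h n *\<^sub>R i) - f x) / h n" for n x
  have q_eq: "\<exists>s. q n x = partial_deriv i f (x + s *\<^sub>R i)" for n x
  proof -
    have "\<exists>z. 0 < z \<and> z < h n \<and> f (x + h n *\<^sub>R i) - f (x + 0 *\<^sub>R i)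
        = (h n - 0) * partial_deriv i f (x + z *\<^sub>R i)"
      by (intro MVT2 has_field_derivative_along_line[OF f] h) auto
    then show ?thesis using h(1)[of n] by (auto simp: q_def field_simps)
  qed
  \<comment> \<open>The quotient is a derivative at an intermediate point, hence bounded by
    \<open>M\<close>; since \<open>h n \<le> 1\<close>, the support grows by at most 1.\<close>
  have q_bound: "norm (q n x) \<le> indicator (cball 0 (R + 1)) x *\<^sub>R M" for n x
  proof (cases "norm x \<le> R + 1")
    case True
    then show ?thesis using q_eq[of n x] M by auto
  next
    case False
    have "norm x \<le> norm (x + h n *\<^sub>R i) + norm (h n *\<^sub>R i)"
      using norm_triangle_ineq4[of "x + h n *\<^sub>R i" "h n *\<^sub>R i"] by simp
    moreover have "norm (h n *\<^sub>R i) \<le> 1" using i h[of n] by simp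
    ultimately have "f (x + h n *\<^sub>R i) = 0" "f x = 0" using False R by auto
    then show ?thesis using False by (simp add: q_def)
  qed
  have lim: "(\<lambda>n. q n x) \<longlonglongrightarrow> partial_deriv i f x" for x
  proof -
    have "((\<lambda>s. f (x + s *\<^sub>R i)) has_field_derivative partial_deriv i f (x + 0 *\<^sub>R i)) (at 0)"
      by (rule has_field_derivative_along_line[OF f]) auto
    then have "(\<lambda>s. (f (x + s *\<^sub>R i) - f x) / s) \<midarrow>0\<rightarrow> partial_deriv i f x"
      by (simp add: DERIV_def)
    moreover have "filterlim h (at 0) sequentially"
      using h0 h(1) by (auto simp: filterlim_at intro!: always_eventually less_imp_neq[THEN not_sym])
    ultimately show ?thesis unfolding q_def by (rule filterlim_compose)
  qed
  have "(\<lambda>n. LINT x|lborel. q n x) \<longlonglongrightarrow> (LINT x|lborel. partial_deriv i f x)"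
  proof (rule integral_dominated_convergence[where w = "\<lambda>x. indicator (cball 0 (R + 1)) x *\<^sub>R M"])
    show "integrable lborel (\<lambda>x::'a. indicator (cball 0 (R + 1)) x *\<^sub>R M)"
      by (intro borel_integrable_compact) auto
    show "AE x in lborel. (\<lambda>n. q n x) \<longlonglongrightarrow> partial_deriv i f x" using lim by simp
    show "AE x in lborel. norm (q n x) \<le> indicator (cball 0 (R + 1)) x *\<^sub>R M" for n using q_bound by simp
  qed (auto simp: q_def[abs_def])
  moreover have "(LINT x|lborel. q n x) = 0" for n
  proof -
    have int: "integrable lborel f" by (rule integrable_continuous_bounded_support[OF cont(1) supp])
    have "integrable lborel (\<lambda>x. f (x + h n *\<^sub>R i))"
    proof (rule integrable_continuous_bounded_support)
      show "continuous_on UNIV (\<lambda>x. f (x + h n *\<^sub>R i))"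
        by (intro continuous_on_compose2[OF cont(1)] continuous_intros) auto
      have "f (x + h n *\<^sub>R i) = 0" if "R + norm (h n *\<^sub>R i) < norm x" for x
        using R[of "x + h n *\<^sub>R i"] norm_triangle_ineq4[of "x + h n *\<^sub>R i" "h n *\<^sub>R i"] that by simp
      then show "bounded_support (\<lambda>x. f (x + h n *\<^sub>R i))" unfolding bounded_support_def by blast
    qed
    then show ?thesis
      using int integral_translation[of f "h n *\<^sub>R i"] by (simp add: q_def)
  qed
  ultimately show ?thesis by (simp add: LIMSEQ_const_iff)
qed

lemma open_punctured: "open (- {0::'a::euclidean_space})"
  by auto

lemma integral_divergence_eq_0:
  fixes V :: "'a::euclidean_space \<Rightarrow> 'a \<Rightarrow> real"
  assumes "\<And>i. i \<in> Basis \<Longrightarrow> smooth_on (-{0}) (V i)" "\<And>i. i \<in> Basis \<Longrightarrow> annular (V i)"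
  shows "(LINT x|lborel. (\<Sum>i\<in>Basis. partial_deriv i (V i) x)) = 0"
proof -
  have "integrable lborel (partial_deriv i (V i))" if "i \<in> Basis" for i
    using that assms by (intro integrable_annular annular_partial_deriv smooth_on_partial_deriv) auto
  moreover have "(LINT x|lborel. partial_deriv i (V i) x) = 0" if "i \<in> Basis" for i
    using that assms by (intro integral_partial_deriv_eq_0 annular_imp_bounded_support
        smooth_on_annular) auto
  ultimately show ?thesis by simp
qed

lemma sum_partial_deriv_inner_mult:
  assumes f: "smooth_on S f" and S: "open S" and x: "(x::'a::euclidean_space) \<in> S"
  shows "(\<Sum>i\<in>Basis. partial_deriv i (\<lambda>x. (x \<bullet> i) * f x) x) = euler f x + real DIM('a) * f x"
  using partial_deriv_mult[OF smooth_on_inner[OF S] f S x]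
  by (simp add: partial_deriv_inner sum.distrib euler_def inner_same_Basis)

lemma integral_euler:
  fixes f :: "'a::euclidean_space \<Rightarrow> real"
  assumes "smooth_on (-{0}) f" "annular f"
  shows "(LINT x|lborel. euler f x + real DIM('a) * f x) = 0"
proof -
  have "(LINT x|lborel. (\<Sum>i\<in>Basis. partial_deriv i (\<lambda>x::'a. (x \<bullet> i) * f x) x)) = 0"
    using assms by (intro integral_divergence_eq_0 annular_mult_right smooth_on_mult smooth_on_inner) auto
  then show ?thesis
    by (simp add: sum_partial_deriv_inner_mult[OF smooth_on_annular[OF assms] open_UNIV])
qed

text \<open>Green's formula on all spheres at once. The field \<open>V\<close> is \<open>h\<close>
  times \<open>|x|^2 grad f - (x . grad f) x\<close>, which is tangent to the spheres and has
  divergence \<open>ang_laplacian f\<close>; the derivatives that fall on \<open>h\<close> make up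
  \<open>ang_form f h\<close>.\<close>

lemma integral_ang_laplacian_mult:
  fixes f h :: "'a::euclidean_space \<Rightarrow> real"
  assumes f: "smooth_on (-{0}) f" and h: "smooth_on (-{0}) h" and ann: "annular h"
  shows "(LINT x|lborel. h x * ang_laplacian f x + ang_form f h x) = 0"
proof -
  note S = open_punctured[where 'a='a]
  define V where "V i x = h x * ((norm x)\<^sup>2 * partial_deriv i f x - (x \<bullet> i) * euler f x)" for i x
  have "(\<Sum>i\<in>Basis. partial_deriv i (V i) x) = h x * ang_laplacian f x + ang_form f h x"
      if x: "x \<in> -{0}" for x
  proof -
    note sm = smooth_on_mult smooth_on_diff smooth_on_inner smooth_on_norm_power2 smooth_on_euler f h x S
    have "partial_deriv i (V i) x = h x * ((norm x)\<^sup>2 * partial_deriv i (partial_deriv i f) x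
        + 2 * ((x \<bullet> i) * partial_deriv i f x))
        - h x * partial_deriv i (\<lambda>x. (x \<bullet> i) * euler f x) x
        + partial_deriv i h x * ((norm x)\<^sup>2 * partial_deriv i f x - (x \<bullet> i) * euler f x)"
            if i: "i \<in> Basis" for i
    proof -
      note sd = smooth_on_partial_deriv[OF S f i]
      have "partial_deriv i (V i) x = h x * partial_deriv i (\<lambda>x. (norm x)\<^sup>2 * partial_deriv i f x
          - (x \<bullet> i) * euler f x) x
        + partial_deriv i h x * ((norm x)\<^sup>2 * partial_deriv i f x - (x \<bullet> i) * euler f x)"
        unfolding V_def[abs_def] by (intro partial_deriv_mult[of "-{0}"] sm sd)
      also have "partial_deriv i (\<lambda>x. (norm x)\<^sup>2 * partial_deriv i f x - (x \<bullet> i) * euler f x) x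
        = partial_deriv i (\<lambda>x. (norm x)\<^sup>2 * partial_deriv i f x) x
            - partial_deriv i (\<lambda>x. (x \<bullet> i) * euler f x) x"
        by (intro partial_deriv_diff[of "-{0}"] sm sd)
      also have "partial_deriv i (\<lambda>x. (norm x)\<^sup>2 * partial_deriv i f x) x =
        (norm x)\<^sup>2 * partial_deriv i (partial_deriv i f) x
            + partial_deriv i (\<lambda>x. (norm x)\<^sup>2) x * partial_deriv i f x"
        by (intro partial_deriv_mult[of "-{0}"] sm sd)
      finally show ?thesis by (simp add: partial_deriv_norm_power2 algebra_simps)
    qed
    then have "(\<Sum>i\<in>Basis. partial_deriv i (V i) x) =
        (\<Sum>i\<in>Basis. h x * (norm x)\<^sup>2 * partial_deriv i (partial_deriv i f) x
          + 2 * h x * ((x \<bullet> i) * partial_deriv i f x)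
          - h x * partial_deriv i (\<lambda>x. (x \<bullet> i) * euler f x) x
          + (norm x)\<^sup>2 * (partial_deriv i f x * partial_deriv i h x)
          - euler f x * ((x \<bullet> i) * partial_deriv i h x))"
      by (intro sum.cong refl) (simp add: algebra_simps)
    also have "\<dots> = h x * (norm x)\<^sup>2 * laplacian f x + 2 * h x * euler f x
        - h x * (\<Sum>i\<in>Basis. partial_deriv i (\<lambda>x. (x \<bullet> i) * euler f x) x)
        + (norm x)\<^sup>2 * (\<Sum>i\<in>Basis. partial_deriv i f x * partial_deriv i h x) - euler f x * euler h x"
      unfolding sum.distrib sum_subtractf sum_distrib_left[symmetric]
      by (simp add: laplacian_def[symmetric] euler_def[symmetric])
    also have "(\<Sum>i\<in>Basis. partial_deriv i (\<lambda>x. (x \<bullet> i) * euler f x) x)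
        = euler (euler f) x + real DIM('a) * euler f x"
      by (intro sum_partial_deriv_inner_mult[of "-{0}"] sm)
    finally show ?thesis by (simp add: ang_laplacian_def ang_form_def algebra_simps)
  qed
  then have "AE x in lborel. (\<Sum>i\<in>Basis. partial_deriv i (V i) x) = h x * ang_laplacian f x + ang_form f h x"
    using AE_lborel_singleton[of 0] by (auto elim!: eventually_mono)
  moreover have "integrable lborel (\<lambda>x. \<Sum>i\<in>Basis. partial_deriv i (V i) x)"
    using f h ann unfolding V_def[abs_def]
    by (intro Bochner_Integration.integrable_sum integrable_annular smooth_on_partial_deriv
        smooth_on_mult smooth_on_diff
        smooth_on_inner smooth_on_norm_power2 smooth_on_euler annular_partial_deriv annular_mult_left) auto
  moreover have "integrable lborel (\<lambda>x. h x * ang_laplacian f x + ang_form f h x)"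
    using f h ann annular_ang_form[OF ann, of f] ang_form_commute[of h f, abs_def]
    by (intro integrable_annular smooth_on_add smooth_on_mult smooth_on_ang_laplacian smooth_on_ang_form
        annular_add annular_mult_left) auto
  ultimately have "(LINT x|lborel. h x * ang_laplacian f x + ang_form f h x) =
      (LINT x|lborel. (\<Sum>i\<in>Basis. partial_deriv i (V i) x))"
    by (intro integral_cong_AE) (auto simp: borel_measurable_integrable elim!: eventually_mono)
  also have "\<dots> = 0"
    using f h ann unfolding V_def[abs_def]
    by (intro integral_divergence_eq_0 smooth_on_mult smooth_on_diff smooth_on_partial_deriv
        smooth_on_inner smooth_on_norm_power2 smooth_on_euler annular_mult_left) auto
  finally show ?thesis .
qed

section \<open>Radial functions\<close>

text \<open>Dependence on \<open>|x|\<close> alone, expressed infinitesimally: the gradient is a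
  multiple of \<open>x\<close>. This form passes through products and compositions and is what the
  angular operators see. In dimension one it holds for every function that is smooth off the
  origin.\<close>

definition radial :: "('a::euclidean_space \<Rightarrow> real) \<Rightarrow> bool" where
  "radial r \<longleftrightarrow> smooth_on (-{0}) r \<and>
     (\<forall>x. x \<noteq> 0 \<longrightarrow> (\<forall>i\<in>Basis. (norm x)\<^sup>2 * partial_deriv i r x = (x \<bullet> i) * euler r x))"

lemma radial_smooth: "radial r \<Longrightarrow> smooth_on (-{0}) r"
  by (simp add: radial_def)

lemma radialI:
  assumes "smooth_on (-{0}) r"
    and "\<And>x i. x \<noteq> 0 \<Longrightarrow> i \<in> Basis \<Longrightarrow> partial_deriv i r x = (x \<bullet> i) * c x"
  shows "radial r"
proof -
  have "euler r x = (norm x)\<^sup>2 * c x" if "x \<noteq> 0" for x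
    using assms(2)[OF that] by (simp add: euler_def norm_power2_eq_sum sum_distrib_right mult.assoc)
  then show ?thesis using assms by (simp add: radial_def)
qed

lemma radial_norm_power2: "radial (\<lambda>x::'a::euclidean_space. (norm x)\<^sup>2)"
  by (rule radialI[where c = "\<lambda>_. 2"]) (auto simp: partial_deriv_norm_power2 intro!: smooth_on_norm_power2)

lemma has_derivative_norm_powr:
  fixes x :: "'a::euclidean_space"
  assumes "x \<noteq> 0"
  shows "((\<lambda>x. norm x powr p) has_derivative (\<lambda>v. p * (x \<bullet> v) * norm x powr (p - 2))) (at x)"
proof -
  have "((\<lambda>z. z powr p) has_derivative (\<lambda>t. p * norm x powr (p - 1) * t)) (at (norm x))"
    using has_real_derivative_powr[of "norm x" p] assms by (simp add: has_field_derivative_def)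
  from has_derivative_compose[OF has_derivative_norm[OF assms] this]
  have "((\<lambda>x. norm x powr p) has_derivative (\<lambda>v. p * norm x powr (p - 1) * (v \<bullet> sgn x))) (at x)" .
  moreover have "norm x powr (p - 1) / norm x = norm x powr (p - 2)"
    using assms powr_diff[of "norm x" "p - 1" 1] by simp
  then have "p * norm x powr (p - 1) * (v \<bullet> sgn x) = p * (x \<bullet> v) * norm x powr (p - 2)" for v
    by (simp add: sgn_div_norm inner_commute divide_inverse[symmetric] flip: times_divide_eq_right)
  ultimately show ?thesis by simp
qed

lemma smooth_on_norm_powr: "smooth_on (-{0}) (\<lambda>x::'a::euclidean_space. norm x powr p)"
  unfolding smooth_on_def
proof
  fix k show "Ck_on k (-{0}) (\<lambda>x::'a. norm x powr p)"
  proof (induction k arbitrary: p)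
    case 0
    then show ?case by (auto intro!: continuous_intros)
  next
    case (Suc k)
    show ?case
    proof (rule Ck_on_SucI[OF open_punctured])
      show "((\<lambda>x. norm x powr p) has_derivative (\<lambda>v. p * (x \<bullet> v) * norm x powr (p - 2))) (at x)"
        if "x \<in> -{0}" for x :: 'a using that by (intro has_derivative_norm_powr) auto
      have "Ck_on k (-{0}) (\<lambda>x::'a. x \<bullet> i)" for i
        using smooth_on_inner[OF open_punctured] by (auto simp: smooth_on_def)
      then show "Ck_on k (-{0}) (\<lambda>x::'a. p * (x \<bullet> i) * norm x powr (p - 2))" for i
        by (intro Ck_on_mult open_punctured Suc Ck_on_const)
    qed
  qed
qed

lemma partial_deriv_norm_powr:
  "x \<noteq> 0 \<Longrightarrow> partial_deriv i (\<lambda>x. norm x powr p) x = p * (x \<bullet> i) * norm x powr (p - 2)"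
  by (rule partial_deriv_eqI[OF has_derivative_norm_powr])

lemma norm_powr_minus_2: "x \<noteq> 0 \<Longrightarrow> (norm x)\<^sup>2 * norm x powr (p - 2) = norm x powr p"
  by (simp add: powr_diff)

lemma euler_norm_powr:
  fixes x :: "'a::euclidean_space"
  assumes "x \<noteq> 0"
  shows "euler (\<lambda>x. norm x powr p) x = p * norm x powr p"
proof -
  have "euler (\<lambda>x. norm x powr p) x = p * ((norm x)\<^sup>2 * norm x powr (p - 2))"
    using assms by (simp add: euler_def partial_deriv_norm_powr norm_power2_eq_sum sum_distrib_left
        sum_distrib_right mult_ac)
  then show ?thesis using norm_powr_minus_2[OF assms] by simp
qed

lemma radial_norm_powr: "radial (\<lambda>x. norm x powr p)"
  by (rule radialI[OF smooth_on_norm_powr, where c = "\<lambda>x. p * norm x powr (p - 2)"])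
    (simp add: partial_deriv_norm_powr)

lemma DERIV_partial_deriv:
  fixes h :: "real \<Rightarrow> real"
  assumes "smooth_on T h" "open T" "t \<in> T"
  shows "(h has_field_derivative partial_deriv 1 h t) (at t)"
  using has_field_derivative_along_line[of T h 0 t 1] assms by simp

lemma euler_compose:
  fixes h :: "real \<Rightarrow> real"
  assumes "smooth_on (-{0}) r" "smooth_on T h" "open T" "r x \<in> T" "x \<noteq> 0"
  shows "euler (\<lambda>x. h (r x)) x = partial_deriv 1 h (r x) * euler r x"
  using partial_deriv_compose[OF assms(1) open_punctured _ DERIV_partial_deriv[OF assms(2-4)]] assms(5)
  by (simp add: euler_def sum_distrib_left algebra_simps)

lemma radial_compose:
  fixes h :: "real \<Rightarrow> real"
  assumes r: "radial r" and h: "smooth_on T h" "open T" and sub: "\<And>x. x \<noteq> 0 \<Longrightarrow> r x \<in> T"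
  shows "radial (\<lambda>x. h (r x))"
  unfolding radial_def
proof (intro conjI allI ballI impI)
  show "smooth_on (-{0}) (\<lambda>x. h (r x))"
    using sub by (intro smooth_on_compose[OF open_punctured h(2,1) radial_smooth[OF r]]) auto
  fix x i :: 'a assume x: "x \<noteq> 0" and i: "i \<in> Basis"
  have "partial_deriv i (\<lambda>x. h (r x)) x = partial_deriv 1 h (r x) * partial_deriv i r x"
    using x by (intro partial_deriv_compose[OF radial_smooth[OF r] open_punctured]
        DERIV_partial_deriv[OF h] sub) auto
  moreover have "(norm x)\<^sup>2 * partial_deriv i r x = (x \<bullet> i) * euler r x"
    using r x i by (simp add: radial_def)
  ultimately show "(norm x)\<^sup>2 * partial_deriv i (\<lambda>x. h (r x)) x = (x \<bullet> i) * euler (\<lambda>x. h (r x)) x"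
    using euler_compose[OF radial_smooth[OF r] h sub[OF x] x] by (simp add: mult.left_commute)
qed

lemma radial_mult:
  assumes r: "radial r" and s: "radial s" shows "radial (\<lambda>x. r x * s x)"
  unfolding radial_def
proof (intro conjI allI ballI impI)
  show "smooth_on (-{0}) (\<lambda>x. r x * s x)"
    by (intro smooth_on_mult open_punctured radial_smooth r s)
  fix x i :: 'a assume x: "x \<noteq> 0" and i: "i \<in> Basis"
  have x': "x \<in> -{0}" using x by simp
  note eqs = partial_deriv_mult[OF radial_smooth[OF r] radial_smooth[OF s] open_punctured x']
    euler_mult[OF open_punctured radial_smooth[OF r] radial_smooth[OF s] x']
  have "(norm x)\<^sup>2 * partial_deriv i r x = (x \<bullet> i) * euler r x"
    "(norm x)\<^sup>2 * partial_deriv i s x = (x \<bullet> i) * euler s x"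
    using r s x i by (auto simp: radial_def)
  then show "(norm x)\<^sup>2 * partial_deriv i (\<lambda>x. r x * s x) x = (x \<bullet> i) * euler (\<lambda>x. r x * s x) x"
    unfolding eqs by (simp add: algebra_simps)
qed

lemma ang_form_radial:
  assumes "radial r" "x \<noteq> 0"
  shows "ang_form r f x = 0"
proof -
  have "(norm x)\<^sup>2 * (\<Sum>i\<in>Basis. partial_deriv i r x * partial_deriv i f x)
      = (\<Sum>i\<in>Basis. ((norm x)\<^sup>2 * partial_deriv i r x) * partial_deriv i f x)"
    by (simp add: sum_distrib_left mult.assoc)
  also have "\<dots> = (\<Sum>i\<in>Basis. euler r x * ((x \<bullet> i) * partial_deriv i f x))"
    using assms by (intro sum.cong) (simp_all add: radial_def)
  also have "\<dots> = euler r x * euler f x"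
    by (simp add: euler_def[of f] sum_distrib_left)
  finally show ?thesis by (simp add: ang_form_def)
qed

text \<open>Take the divergence of the identity \<open>(norm x)\<^sup>2 * partial_deriv i r x = (x
  \<bullet> i) * euler r x\<close> that defines \<open>radial\<close>: the difference of its two
  sides is \<open>ang_laplacian r\<close>.\<close>

lemma ang_laplacian_radial:
  fixes r :: "'a::euclidean_space \<Rightarrow> real"
  assumes r: "radial r" and x: "x \<noteq> 0"
  shows "ang_laplacian r x = 0"
proof -
  note S = open_punctured[where 'a='a]
  have x': "x \<in> -{0}" using x by simp
  have r': "smooth_on (-{0}) r" by (rule radial_smooth[OF r])
  have "2 * ((x \<bullet> i) * partial_deriv i r x) + (norm x)\<^sup>2 * partial_deriv i (partial_deriv i r) x
      = partial_deriv i (\<lambda>x. (x \<bullet> i) * euler r x) x" if i: "i \<in> Basis" for i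
  proof -
    have "partial_deriv i (\<lambda>x. (x \<bullet> i) * euler r x) x
        = partial_deriv i (\<lambda>x. (norm x)\<^sup>2 * partial_deriv i r x) x"
      using r i by (intro partial_deriv_cong[OF S x']) (simp add: radial_def)
    also have "\<dots> = (norm x)\<^sup>2 * partial_deriv i (partial_deriv i r) x
        + partial_deriv i (\<lambda>x. (norm x)\<^sup>2) x * partial_deriv i r x"
      by (intro partial_deriv_mult[OF _ _ S x'] smooth_on_norm_power2 smooth_on_partial_deriv S r' i)
    finally show ?thesis by (simp add: partial_deriv_norm_power2)
  qed
  then have "(\<Sum>i\<in>Basis. 2 * ((x \<bullet> i) * partial_deriv i r x)
      + (norm x)\<^sup>2 * partial_deriv i (partial_deriv i r) x)
      = (\<Sum>i\<in>Basis. partial_deriv i (\<lambda>x. (x \<bullet> i) * euler r x) x)" by simp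
  also have "\<dots> = euler (euler r) x + real DIM('a) * euler r x"
    by (rule sum_partial_deriv_inner_mult[OF smooth_on_euler[OF S r'] S x'])
  finally have "2 * euler r x + (norm x)\<^sup>2 * laplacian r x = euler (euler r) x + real DIM('a) * euler r x"
    unfolding sum.distrib sum_distrib_left[symmetric]
        by (simp add: laplacian_def[symmetric] euler_def[symmetric])
  then show ?thesis by (simp add: ang_laplacian_def algebra_simps)
qed

text \<open>Both \<open>ang_form\<close> and \<open>ang_laplacian\<close> annihilate radial
  functions, so the product rule leaves one term. This is how weights, powers of the norm and
  cutoffs are moved in and out.\<close>

lemma ang_laplacian_radial_mult:
  assumes r: "radial r" and f: "smooth_on (-{0}) f" and x: "x \<noteq> 0"
  shows "ang_laplacian (\<lambda>x. r x * f x) x = r x * ang_laplacian f x"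
  using ang_laplacian_mult[OF open_punctured radial_smooth[OF r] f, of x] x
  by (simp add: ang_form_radial[OF r x] ang_laplacian_radial[OF r x])

lemma ang_form_mult_right:
  assumes f: "smooth_on S f" and h: "smooth_on S h" and S: "open S" and x: "x \<in> S"
  shows "ang_form k (\<lambda>x. f x * h x) x = f x * ang_form k h x + h x * ang_form k f x"
  unfolding ang_form_def euler_mult[OF S f h x] partial_deriv_mult[OF f h S x]
  by (simp add: algebra_simps sum.distrib sum_distrib_left)

lemma ang_form_radial_mult:
  assumes r: "radial r" and f: "smooth_on (-{0}) f" and x: "x \<noteq> 0"
  shows "ang_form h (\<lambda>x. r x * f x) x = r x * ang_form h f x"
  using ang_form_mult_right[OF radial_smooth[OF r] f open_punctured, of x h] x
    ang_form_radial[OF r x, of h] by (simp add: ang_form_commute[of h r])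

section \<open>Functions and integrals up to the value at the origin\<close>

lemma borel_measurable_cong_punctured:
  fixes f h :: "'a::euclidean_space \<Rightarrow> real"
  assumes [measurable]: "f \<in> borel_measurable borel" and "\<And>x. x \<noteq> 0 \<Longrightarrow> f x = h x"
  shows "h \<in> borel_measurable borel"
proof -
  have "(\<lambda>x. if x = 0 then h 0 else f x) \<in> borel_measurable borel" by measurable
  moreover have "(\<lambda>x. if x = 0 then h 0 else f x) = h" using assms(2) by auto
  ultimately show ?thesis by simp
qed

lemma AE_punctured:
  fixes P :: "'a::euclidean_space \<Rightarrow> bool"
  assumes "\<And>x. x \<noteq> 0 \<Longrightarrow> P x"
  shows "AE x in lborel. P x"
  using AE_lborel_singleton[of 0] assms by (auto elim!: eventually_mono)

text \<open>Changing a function at one point preserves measurability in both directions. If one of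
  the two functions fails to be measurable, so does the other, and both integrals take the default
  value 0.\<close>

lemma lborel_integral_cong_punctured:
  fixes f h :: "'a::euclidean_space \<Rightarrow> real"
  assumes eq: "\<And>x. x \<noteq> 0 \<Longrightarrow> f x = h x"
  shows "(LINT x|lborel. f x) = (LINT x|lborel. h x)"
proof (cases "f \<in> borel_measurable borel")
  case True
  then show ?thesis
    using borel_measurable_cong_punctured[OF True eq] AE_punctured[of "\<lambda>x. f x = h x", OF eq]
    by (intro integral_cong_AE) auto
next
  case False
  moreover from this have "h \<notin> borel_measurable borel"
    using borel_measurable_cong_punctured[of h f] eq by metis
  ultimately have "\<not> integrable lborel f" "\<not> integrable lborel h"
    using borel_measurable_integrable[of lborel f] borel_measurable_integrable[of lborel h] by auto
  then show ?thesis by (simp add: not_integrable_integral_eq)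
qed

text \<open>The weight is put with \<open>h\<close>, and \<open>ang_form\<close> treats it as a
  constant. Annularity is demanded of the product, so that either the weight or the function can
  provide it.\<close>

lemma integral_radial_ang_laplacian:
  fixes f h :: "'a::euclidean_space \<Rightarrow> real"
  assumes r: "radial r" and f: "smooth_on (-{0}) f" and h: "smooth_on (-{0}) h"
    and ann: "annular (\<lambda>x. r x * h x)"
  shows "(LINT x|lborel. r x * (h x * ang_laplacian f x)) = - (LINT x|lborel. r x * ang_form f h x)"
proof -
  note S = open_punctured[where 'a='a]
  have rh: "smooth_on (-{0}) (\<lambda>x. r x * h x)" by (intro smooth_on_mult S radial_smooth r h)
  have int: "integrable lborel (\<lambda>x. (r x * h x) * ang_laplacian f x)"
    by (intro integrable_annular annular_mult_left ann smooth_on_mult S rh smooth_on_ang_laplacian f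
        radial_smooth r h)
  have "annular (ang_form f (\<lambda>x. r x * h x))"
    using annular_ang_form[OF ann, of f] ang_form_commute[of f, abs_def] by simp
  then have int2: "integrable lborel (ang_form f (\<lambda>x. r x * h x))"
    by (intro integrable_annular smooth_on_ang_form S f rh)
  have "(LINT x|lborel. (r x * h x) * ang_laplacian f x) + (LINT x|lborel. ang_form f (\<lambda>x. r x * h x) x)
      = 0"
    using integral_ang_laplacian_mult[OF f rh ann] int int2 by simp
  moreover have "(LINT x|lborel. ang_form f (\<lambda>x. r x * h x) x) = (LINT x|lborel. r x * ang_form f h x)"
    by (rule lborel_integral_cong_punctured) (rule ang_form_radial_mult[OF r h])
  ultimately show ?thesis by (simp add: mult.assoc)
qed

section \<open>Radial cutoffs\<close>

lemma smooth_on_cutoff: "cutoff g \<Longrightarrow> smooth_on {0<..} g"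
  unfolding cutoff_def by (auto intro: smooth_on_subset)

lemma cutoff_eq: "cutoff g \<Longrightarrow> 0 \<le> r \<Longrightarrow> r \<le> 1 \<Longrightarrow> g r = 1" "cutoff g \<Longrightarrow> 2 \<le> r \<Longrightarrow> g r = 0"
  "cutoff g \<Longrightarrow> 0 \<le> r \<Longrightarrow> 0 \<le> g r" "cutoff g \<Longrightarrow> 0 \<le> r \<Longrightarrow> g r \<le> 1"
  unfolding cutoff_def by auto

lemma radial_norm: "radial (\<lambda>x. norm x)"
proof -
  show ?thesis using radial_norm_powr[of 1] by simp
qed

lemma smooth_on_cmult_real: "open S \<Longrightarrow> smooth_on S (\<lambda>t::real. c * t)"
  using smooth_on_inner[of S c] by (simp add: mult.commute)

lemma radial_cutoff:
  assumes "cutoff g" "c > 0"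
  shows "radial (\<lambda>x. g (c * norm x))"
proof -
  have "smooth_on {0<..} (\<lambda>t. g (c * t))"
    by (rule smooth_on_compose[OF open_greaterThan open_greaterThan smooth_on_cutoff[OF assms(1)]
        smooth_on_cmult_real[OF open_greaterThan]]) (use assms(2) in auto)
  from radial_compose[OF radial_norm this] show ?thesis by auto
qed

lemma radial_one_minus:
  assumes "radial r" shows "radial (\<lambda>x. 1 - r x)"
proof -
  have "smooth_on UNIV (\<lambda>t::real. 1 - t)"
    using smooth_on_diff[OF open_UNIV smooth_on_const[OF open_UNIV, of 1] smooth_on_cmult_real[of UNIV
        1]] by simp
  from radial_compose[OF assms this] show ?thesis by auto
qed

lemma annular_cutoff:
  assumes g: "cutoff g" and \<rho>: "0 < \<rho>" "0 < R"
  shows "\<exists>\<psi> :: ('a::euclidean_space) \<Rightarrow> real. radial \<psi> \<and> annular \<psi> \<and> (\<forall>x. 0 \<le> \<psi> x \<and> \<psi> x \<le> 1) \<and>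
    (\<forall>x. \<rho> \<le> norm x \<and> norm x \<le> R \<longrightarrow> \<psi> x = 1)"
proof -
  \<comment> \<open>The first factor vanishes for \<open>|x| \<le> \<rho> / 2\<close> and is 1 from
    \<open>\<rho>\<close> on; the second is 1 up to \<open>R\<close> and vanishes from
    \<open>2 * R\<close> on.\<close>
  let ?\<psi> = "\<lambda>x::'a. (1 - g (2 / \<rho> * norm x)) * g (1 / R * norm x)"
  have "radial ?\<psi>"
    using assms by (intro radial_mult radial_one_minus radial_cutoff) auto
  moreover have "annular ?\<psi>"
  proof -
    have "?\<psi> x = 0" if "norm x < \<rho> / 2 \<or> 2 * R < norm x" for x
      using that
      using assms cutoff_eq(1)[OF g, of "2 / \<rho> * norm x"] cutoff_eq(2)[OF g, of "1 / R * norm x"]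
      by (auto simp: field_simps)
    then show ?thesis unfolding annular_def using half_gt_zero[OF \<rho>(1)] by blast
  qed
  moreover have "\<forall>x. 0 \<le> ?\<psi> x \<and> ?\<psi> x \<le> 1"
    using assms cutoff_eq(3,4)[OF g] by (auto intro!: mult_nonneg_nonneg mult_le_one)
  moreover have "\<forall>x. \<rho> \<le> norm x \<and> norm x \<le> R \<longrightarrow> ?\<psi> x = 1"
    using assms cutoff_eq(1)[OF g] cutoff_eq(2)[OF g] by (auto simp: field_simps)
  ultimately show ?thesis by blast
qed

section \<open>Homogeneous polynomials and the spherical spectrum\<close>

text \<open>Sums of products of \<open>d\<close> linear forms and a constant. The zero function
  belongs to every degree, which keeps each degree closed under linear combinations.\<close>

inductive hom_poly :: "nat \<Rightarrow> ('a::euclidean_space \<Rightarrow> real) \<Rightarrow> bool" where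
  const: "hom_poly 0 (\<lambda>_. c)"
| inner_mult: "hom_poly d p \<Longrightarrow> hom_poly (Suc d) (\<lambda>x. (x \<bullet> v) * p x)"
| add: "hom_poly d p \<Longrightarrow> hom_poly d q \<Longrightarrow> hom_poly d (\<lambda>x. p x + q x)"

lemma hom_poly_0: "hom_poly d (\<lambda>_. 0)"
proof (induction d)
  case (Suc d)
  from inner_mult[OF this, of 0] show ?case by simp
qed (rule const)

lemma hom_poly_cmult: "hom_poly d p \<Longrightarrow> hom_poly d (\<lambda>x. c * p x)"
proof (induction rule: hom_poly.induct)
  case (inner_mult d p v)
  from hom_poly.inner_mult[OF inner_mult.IH, of v] show ?case by (simp add: mult.left_commute)
qed (simp_all add: hom_poly.const hom_poly.add distrib_left)

lemma hom_poly_sum: "(\<And>i. i \<in> I \<Longrightarrow> hom_poly d (p i)) \<Longrightarrow> hom_poly d (\<lambda>x. \<Sum>i\<in>I. p i x)"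
  by (induction I rule: infinite_finite_induct) (auto intro: hom_poly_0 hom_poly.add)

lemma hom_poly_diff: "hom_poly d p \<Longrightarrow> hom_poly d q \<Longrightarrow> hom_poly d (\<lambda>x. p x - q x)"
  using hom_poly.add[of d p "\<lambda>x. -1 * q x"] hom_poly_cmult[of d q "-1"] by simp

lemma hom_poly_mult: "hom_poly d p \<Longrightarrow> hom_poly e q \<Longrightarrow> hom_poly (d + e) (\<lambda>x. p x * q x)"
proof (induction rule: hom_poly.induct)
  case (inner_mult d p v)
  from hom_poly.inner_mult[OF inner_mult.IH[OF inner_mult.prems], of v] show ?case by (simp add: mult.assoc)
qed (simp_all add: hom_poly_cmult hom_poly.add distrib_right)

lemma hom_poly_inner: "hom_poly 1 (\<lambda>x. x \<bullet> v)"
  using inner_mult[OF const[of 1], of v] by simp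

lemma hom_poly_norm_power2: "hom_poly 2 (\<lambda>x. (norm x)\<^sup>2)"
  unfolding norm_power2_eq_sum
  using hom_poly_mult[OF hom_poly_inner hom_poly_inner] by (intro hom_poly_sum) (simp add: numeral_2_eq_2)

lemma hom_poly_smooth: "hom_poly d p \<Longrightarrow> smooth_on UNIV p"
  by (induction rule: hom_poly.induct) (auto intro!: smooth_on_mult smooth_on_add smooth_on_inner)

lemma hom_poly_smooth': "hom_poly d p \<Longrightarrow> smooth_on (-{0}) p"
  by (rule smooth_on_subset[OF hom_poly_smooth]) auto

lemma hom_poly_partial_deriv:
  assumes "hom_poly d p" "i \<in> Basis"
  shows "(d = 0 \<longrightarrow> partial_deriv i p = (\<lambda>_. 0)) \<and> (\<forall>e. d = Suc e \<longrightarrow> hom_poly e (partial_deriv i p))"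
  using assms
proof (induction rule: hom_poly.induct)
  case (const c)
  then show ?case by auto
next
  case (inner_mult d p v)
  have eq: "partial_deriv i (\<lambda>x. (x \<bullet> v) * p x) = (\<lambda>x. (x \<bullet> v) * partial_deriv i p x + (i \<bullet> v) * p x)"
    using partial_deriv_mult[OF smooth_on_inner hom_poly_smooth[OF inner_mult.hyps]]
    by (auto simp: partial_deriv_inner)
  show ?case
  proof (cases d)
    case 0
    then show ?thesis using inner_mult by (auto simp: eq intro!: hom_poly_cmult)
  next
    case (Suc e)
    then have "hom_poly d (\<lambda>x. (x \<bullet> v) * partial_deriv i p x)"
      using inner_mult hom_poly.inner_mult by blast
    then show ?thesis using inner_mult(1) by (auto simp: eq intro!: hom_poly_cmult hom_poly.add)
  qed
next
  case (add d p q)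
  have eq: "partial_deriv i (\<lambda>x. p x + q x) = (\<lambda>x. partial_deriv i p x + partial_deriv i q x)"
    using partial_deriv_add[OF hom_poly_smooth[OF add.hyps(1)] hom_poly_smooth[OF add.hyps(2)]] by auto
  show ?case using add by (auto simp: eq intro: hom_poly.add)
qed

lemma hom_poly_euler:
  assumes "hom_poly d p"
  shows "euler p x = real d * p x"
  using assms
proof (induction rule: hom_poly.induct)
  case (const c)
  then show ?case by (simp add: euler_def)
next
  case (inner_mult d p v)
  have "euler (\<lambda>x. x \<bullet> v) x = x \<bullet> v"
    by (simp add: euler_def partial_deriv_inner euclidean_inner[of x v] inner_commute[of v])
  then show ?case
    using euler_mult[OF open_UNIV smooth_on_inner hom_poly_smooth[OF inner_mult.hyps]] inner_mult.IH
    by (simp add: algebra_simps)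
next
  case (add d p q)
  then show ?case
    using euler_add[OF open_UNIV hom_poly_smooth[OF add.hyps(1)] hom_poly_smooth[OF add.hyps(2)]]
    by (simp add: algebra_simps)
qed

lemma hom_poly_laplacian:
  assumes "hom_poly d p"
  shows "d < 2 \<Longrightarrow> laplacian p = (\<lambda>_. 0)" and "d = Suc (Suc e) \<Longrightarrow> hom_poly e (laplacian p)"
proof -
  assume d: "d < 2"
  have "partial_deriv i (partial_deriv i p) = (\<lambda>_. 0)" if i: "i \<in> Basis" for i
  proof (cases d)
    case 0
    then show ?thesis using hom_poly_partial_deriv[OF assms i] by auto
  next
    case (Suc k)
    then show ?thesis
      using hom_poly_partial_deriv[OF assms i] hom_poly_partial_deriv[of 0 "partial_deriv i p" i] i d
          by auto
  qed
  then show "laplacian p = (\<lambda>_. 0)" by (auto simp: laplacian_def)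
next
  assume d: "d = Suc (Suc e)"
  have "hom_poly e (partial_deriv i (partial_deriv i p))" if i: "i \<in> Basis" for i
    using hom_poly_partial_deriv[OF assms i] hom_poly_partial_deriv[of "Suc e"
        "partial_deriv i p" i] i d by auto
  then show "hom_poly e (laplacian p)" unfolding laplacian_def[abs_def] by (rule hom_poly_sum)
qed

text \<open>By Euler's identity the radial part acts as the scalar \<open>d^2 + (N - 2) d\<close>,
  which is the eigenvalue \<open>c_d\<close>.\<close>

lemma hom_poly_ang_laplacian:
  fixes p :: "'a::euclidean_space \<Rightarrow> real"
  assumes "hom_poly d p"
  shows "ang_laplacian p x = (norm x)\<^sup>2 * laplacian p x - sphere_eigenvalue DIM('a) d * p x"
proof -
  have "euler p = (\<lambda>x. real d * p x)" using hom_poly_euler[OF assms] by auto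
  then have "euler (euler p) x = real d * (real d * p x)"
    using euler_cmult[OF open_UNIV hom_poly_smooth[OF assms], of x
        "real d"] hom_poly_euler[OF assms, of x] by simp
  then show ?thesis
    using hom_poly_euler[OF assms, of x] by (simp add: ang_laplacian_def sphere_eigenvalue_def
        algebra_simps)
qed

text \<open>\<open>c_d - c_j = (d - j) (d + j + N - 2)\<close>. A gap of two, the degree lost by the
  Laplacian, keeps the last factor positive in dimension one as well, where
  \<open>c_0 = c_1\<close>.\<close>

lemma sphere_eigenvalue_less:
  assumes "N \<ge> 1" "j + 2 \<le> d"
  shows "sphere_eigenvalue N j < sphere_eigenvalue N d"
proof -
  have "sphere_eigenvalue N d - sphere_eigenvalue N j = (real d - real j) * (real d + real j + real N - 2)"
    by (simp add: sphere_eigenvalue_def algebra_simps)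
  moreover have "\<dots> > 0" using assms by (intro mult_pos_pos) auto
  ultimately show ?thesis by simp
qed

lemma sphere_eigenvalue_strict_mono:
  assumes "N \<ge> 2" "j < d"
  shows "sphere_eigenvalue N j < sphere_eigenvalue N d"
proof -
  have "sphere_eigenvalue N d - sphere_eigenvalue N j = (real d - real j) * (real d + real j + real N - 2)"
    by (simp add: sphere_eigenvalue_def algebra_simps)
  moreover have "\<dots> > 0" using assms by (intro mult_pos_pos) auto
  ultimately show ?thesis by simp
qed

text \<open>The index stands for the eigenvalue, not for a degree: radial factors pass through
  \<open>ang_laplacian\<close>, so a harmonic polynomial times a power of \<open>|x|\<close> keeps
  its index. Components may be zero.\<close>

definition eigen_family :: "(nat \<Rightarrow> 'a::euclidean_space \<Rightarrow> real) \<Rightarrow> bool" where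
  "eigen_family q \<longleftrightarrow> (\<forall>k. smooth_on (-{0}) (q k)) \<and>
     (\<forall>k x. x \<noteq> 0 \<longrightarrow> ang_laplacian (q k) x = - sphere_eigenvalue DIM('a) k * q k x)"

text \<open>If \<open>p\<close> is homogeneous of degree \<open>d\<close> then \<open>ang_laplacian p + c\<^sub>d p = |x|\<^sup>2 laplacian p\<close>, and the
  right-hand side is decomposed by induction; dividing its components by \<open>c\<^sub>d - c\<^sub>k\<close> and subtracting
  them from \<open>p\<close> leaves an eigenfunction for \<open>c\<^sub>d\<close>.\<close>

lemma hom_poly_eigen_decomposition:
  fixes p :: "'a::euclidean_space \<Rightarrow> real"
  assumes "hom_poly d p"
  shows "\<exists>q. (\<forall>k. hom_poly d (q k)) \<and> eigen_family q \<and> (\<forall>k>d. q k = (\<lambda>_. 0)) \<and>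
    (\<forall>x. p x = (\<Sum>k\<le>d. q k x))"
  using assms
proof (induction d arbitrary: p rule: less_induct)
  case (less d)
  let ?c = "sphere_eigenvalue DIM('a)"
  have ang0: "ang_laplacian (\<lambda>_::'a. 0) x = 0" for x
    by (rule ang_laplacian_const[OF open_UNIV])
  show ?case
  proof (cases "d < 2")
    case True
    have eig: "ang_laplacian p x = - ?c d * p x" for x
      using hom_poly_ang_laplacian[OF less.prems] hom_poly_laplacian(1)[OF less.prems True] by simp
    show ?thesis
    proof (intro exI[of _ "\<lambda>k. if k = d then p else (\<lambda>_. 0)"] conjI allI)
      show "eigen_family (\<lambda>k. if k = d then p else (\<lambda>_. 0))"
        using eig ang0 hom_poly_smooth'[OF less.prems] hom_poly_smooth'[OF hom_poly_0]
            by (auto simp: eigen_family_def)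
      show "p x = (\<Sum>k\<le>d. (if k = d then p else (\<lambda>_. 0)) x)" for x
        by (simp add: if_distrib[of "\<lambda>f. f x"] cong: if_cong)
    qed (auto intro: less.prems hom_poly_0)
  next
    case False
    define e where "e = d - 2"
    have e: "d = Suc (Suc e)" using False by (simp add: e_def)
    have "e < d" using e by simp
    from less.IH[OF this hom_poly_laplacian(2)[OF less.prems e]]
    obtain q' where q': "\<And>k. hom_poly e (q' k)" "eigen_family q'"
      and lap: "\<And>x. laplacian p x = (\<Sum>k\<le>e. q' k x)"
      by (elim exE conjE) metis
    define s where "s k x = (norm x)\<^sup>2 * q' k x / (?c d - ?c k)" for k and x :: 'a
    have cpos: "?c d - ?c k \<noteq> 0" if "k \<le> e" for k
      using sphere_eigenvalue_less[of "DIM('a)" k d] that e DIM_positive[where 'a='a] by auto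
    have s_hom: "hom_poly d (s k)" for k
      unfolding s_def[abs_def]
      using hom_poly_cmult[OF hom_poly_mult[OF hom_poly_norm_power2 q'(1)], of "1 / (?c d - ?c k)" k] e
      by simp
    have s_eig: "ang_laplacian (s k) x = - ?c k * s k x" if "x \<noteq> 0" for k x
    proof -
      have "ang_laplacian (\<lambda>x. (1 / (?c d - ?c k)) * ((norm x)\<^sup>2 * q' k x)) x
          = (1 / (?c d - ?c k)) * ang_laplacian (\<lambda>x. (norm x)\<^sup>2 * q' k x) x"
        using that by (intro ang_laplacian_cmult[OF open_punctured] smooth_on_mult smooth_on_norm_power2
            hom_poly_smooth'[OF q'(1)]) auto
      then show ?thesis
        using ang_laplacian_radial_mult[OF radial_norm_power2 hom_poly_smooth'[OF q'(1)] that, of k]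
            q'(2) that
        by (simp add: s_def[abs_def] eigen_family_def)
    qed
    define t where "t x = p x - (\<Sum>k\<le>e. s k x)" for x
    have t_hom: "hom_poly d t"
      unfolding t_def[abs_def] by (intro hom_poly_diff less.prems hom_poly_sum s_hom)
    have t_eig: "ang_laplacian t x = - ?c d * t x" if x: "x \<noteq> 0" for x
    proof -
      have sum_smooth: "smooth_on (-{0}) (\<lambda>x. \<Sum>k\<le>e. s k x)"
        by (intro hom_poly_smooth'[of d] hom_poly_sum s_hom)
      have "p = (\<lambda>x. t x + (\<Sum>k\<le>e. s k x))" by (auto simp: t_def)
      then have "ang_laplacian p x = ang_laplacian t x + ang_laplacian (\<lambda>x. \<Sum>k\<le>e. s k x) x"
        using ang_laplacian_add[OF open_punctured hom_poly_smooth'[OF t_hom] sum_smooth, of x] x by simp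
      also have "ang_laplacian (\<lambda>x. \<Sum>k\<le>e. s k x) x = (\<Sum>k\<le>e. - ?c k * s k x)"
        using x by (subst ang_laplacian_sum[OF open_punctured hom_poly_smooth'[OF s_hom]]) (auto simp:
            s_eig)
      finally have "ang_laplacian t x = (norm x)\<^sup>2 * laplacian p x - ?c d * p x + (\<Sum>k\<le>e. ?c k * s k x)"
        using hom_poly_ang_laplacian[OF less.prems, of x] by (simp add: sum_negf)
      also have "(norm x)\<^sup>2 * laplacian p x = (\<Sum>k\<le>e. (?c d - ?c k) * s k x)"
        using cpos by (simp add: lap s_def sum_distrib_left)
      finally show ?thesis
        by (simp add: t_def[abs_def] algebra_simps sum_distrib_left sum_subtractf sum.distrib sum_negf)
    qed
    define q where "q k = (if k \<le> e then s k else if k = d then t else (\<lambda>_. 0))" for k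
    show ?thesis
    proof (intro exI[of _ q] conjI allI impI)
      show "hom_poly d (q k)" for k by (simp add: q_def s_hom t_hom hom_poly_0)
      then show "eigen_family q"
        using s_eig t_eig ang0 hom_poly_smooth'[of d "q _"] unfolding eigen_family_def
        by (intro conjI allI impI) (auto simp: q_def)
      show "q k = (\<lambda>_. 0)" if "k > d" for k using that e by (simp add: q_def)
      show "p x = (\<Sum>k\<le>d. q k x)" for x
        by (simp add: e q_def t_def)
    qed
  qed
qed

text \<open>Sums of homogeneous polynomials of mixed degrees, mediating between the graded
  \<open>hom_poly\<close> and the \<open>real_polynomial_function\<close> of
  Stone-Weierstrass.\<close>

inductive poly_span :: "('a::euclidean_space \<Rightarrow> real) \<Rightarrow> bool" where
  hom: "hom_poly d p \<Longrightarrow> poly_span p"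
| add: "poly_span p \<Longrightarrow> poly_span q \<Longrightarrow> poly_span (\<lambda>x. p x + q x)"

lemma poly_span_mult: "poly_span p \<Longrightarrow> poly_span q \<Longrightarrow> poly_span (\<lambda>x. p x * q x)"
proof (induction arbitrary: q rule: poly_span.induct)
  case (hom d p)
  from hom.prems show ?case
  proof (induction rule: poly_span.induct)
    case (hom e q)
    then show ?case using hom_poly_mult[OF \<open>hom_poly d p\<close>] poly_span.hom by blast
  next
    case (add q q')
    then show ?case using poly_span.add by (simp add: distrib_left)
  qed
next
  case (add p p')
  then show ?case using poly_span.add[OF add.IH[of q]] by (simp add: distrib_right)
qed

lemma poly_span_real_polynomial_function:
  "real_polynomial_function p \<Longrightarrow> poly_span p"
proof (induction rule: real_polynomial_function.induct)
  case (linear f)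
  have lin: "linear f" using linear by (rule bounded_linear.linear)
  define v where "v = (\<Sum>i\<in>Basis. f i *\<^sub>R i)"
  have "f x = x \<bullet> v" for x
  proof -
    have "f x = f (\<Sum>i\<in>Basis. (x \<bullet> i) *\<^sub>R i)" by (simp add: euclidean_representation)
    then show ?thesis using lin by (simp add: v_def linear_sum linear_scale inner_sum_right mult.commute)
  qed
  then have "f = (\<lambda>x. x \<bullet> v)" by auto
  then show ?case using poly_span.hom[OF hom_poly_inner[of v]] by simp
qed (auto intro: poly_span.intros hom_poly.intros poly_span_mult)

text \<open>Being indexed by eigenvalue, the components of two summands add termwise, after the
  shorter family is padded with zeros.\<close>

lemma poly_span_eigen_decomposition:
  assumes "poly_span p"
  shows "\<exists>q K. eigen_family q \<and> (\<forall>k>K. q k = (\<lambda>_. 0)) \<and> (\<forall>x. p x = (\<Sum>k\<le>K. q k x))"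
  using assms
proof (induction rule: poly_span.induct)
  case (hom d p)
  then show ?case using hom_poly_eigen_decomposition by blast
next
  case (add p p')
  obtain q K q' K' where q: "eigen_family q" "\<And>k. k > K \<Longrightarrow> q k = (\<lambda>_. 0)" "\<And>x. p x = (\<Sum>k\<le>K. q k x)"
    and q': "eigen_family q'" "\<And>k. k > K' \<Longrightarrow> q' k = (\<lambda>_. 0)" "\<And>x. p' x = (\<Sum>k\<le>K'. q' k x)"
    using add.IH by blast
  have "(\<Sum>k\<le>K. q k x) = (\<Sum>k\<le>max K K'. q k x)" for x
    using q(2) by (intro sum.mono_neutral_left) auto
  moreover have "(\<Sum>k\<le>K'. q' k x) = (\<Sum>k\<le>max K K'. q' k x)" for x
    using q'(2) by (intro sum.mono_neutral_left) auto
  moreover have "eigen_family (\<lambda>k x. q k x + q' k x)"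
    using q(1) q'(1) ang_laplacian_add[OF open_punctured]
    by (auto simp: eigen_family_def algebra_simps intro!: smooth_on_add)
  ultimately show ?case
    using q q' by (intro exI[of _ "\<lambda>k x. q k x + q' k x"] exI[of _ "max K K'"]) (auto simp: sum.distrib)
qed

section \<open>The spectral inequality\<close>

text \<open>With \<open>v = (ang_laplacian - \<mu>) w\<close> and a polynomial \<open>p\<close> close to \<open>w\<close>, the eigen
  decomposition of \<open>p\<close> yields \<open>Q\<close> with \<open>(ang_laplacian - \<mu>) Q = p\<close> and
  \<open>D \<parallel>Q\<parallel>\<^sup>2 \<le> \<parallel>p\<parallel>\<^sup>2\<close>; now expand \<open>0 \<le> \<parallel>v - D Q\<parallel>\<^sup>2\<close> and use
  \<open>\<langle>v, Q\<rangle> = \<langle>w, p\<rangle>\<close>. No completeness of eigenfunctions beyond Stone-Weierstrass is needed.\<close>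

lemma ang_laplacian_lower_bound:
  fixes w :: "'a::euclidean_space \<Rightarrow> real"
  assumes g: "cutoff g" and N: "DIM('a) \<ge> 2"
    and w: "smooth_on (-{0}) w" "annular w"
    and D: "\<And>k. D \<le> (sphere_eigenvalue DIM('a) k + \<mu>)\<^sup>2"
  shows "D * (LINT x|lborel. w x * w x) \<le> (LINT x|lborel. (ang_laplacian w x
      - \<mu> * w x) * (ang_laplacian w x - \<mu> * w x))"
proof (cases "D \<le> 0")
  case True
  have "0 \<le> (LINT x|lborel. w x * w x)" "0 \<le> (LINT x|lborel. (ang_laplacian w x
      - \<mu> * w x) * (ang_laplacian w x - \<mu> * w x))"
    by (simp_all add: integral_nonneg_AE)
  then show ?thesis using True mult_nonpos_nonneg order_trans by blast
next
  case False
  note S = open_punctured[where 'a='a]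
  let ?c = "sphere_eigenvalue DIM('a)"
  \<comment> \<open>\<open>D\<close> is positive from here on, so the hypothesis on \<open>D\<close>
    keeps every denominator \<open>?c k + \<mu>\<close> away from zero.\<close>
  have c: "?c k + \<mu> \<noteq> 0" for k using D[of k] False by auto
  define v where "v x = ang_laplacian w x - \<mu> * w x" for x
  have v: "smooth_on (-{0}) v" "annular v"
    unfolding v_def[abs_def]
    by (intro smooth_on_diff smooth_on_mult smooth_on_ang_laplacian smooth_on_const S w
        annular_diff annular_mult_right annular_ang_laplacian)+
  have "annular (\<lambda>x. w x * w x + v x * v x)"
    by (intro annular_add annular_mult_right w v)
  from annularE[OF this] obtain \<rho> R where \<rho>: "0 < \<rho>" "\<rho> < R"
    and out: "\<And>x. norm x < \<rho> \<Longrightarrow> w x = 0 \<and> v x = 0" "\<And>x. R < norm x \<Longrightarrow> w x = 0 \<and> v x = 0"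
    by (metis sum_squares_eq_zero_iff)
  have "0 < R" using \<rho> by simp
  from annular_cutoff[OF g \<rho>(1) this] obtain \<psi> :: "'a \<Rightarrow> real" where
    \<psi>: "radial \<psi>" "annular \<psi>" "\<And>x. 0 \<le> \<psi> x" "\<And>x. \<psi> x \<le> 1"
    and \<psi>1: "\<And>x. \<rho> \<le> norm x \<Longrightarrow> norm x \<le> R \<Longrightarrow> \<psi> x = 1" by blast
  obtain R' where R': "\<And>x. R' < norm x \<Longrightarrow> \<psi> x = 0" using annularE[OF \<psi>(2)] by metis
  have \<psi>w: "\<psi> x * w x = w x" and \<psi>v: "\<psi> x * v x = v x" for x
    using out[of x] \<psi>1[of x] by (cases "norm x < \<rho>"; cases "R < norm x"; force)+
  \<comment> \<open>Polynomials are not annular. The weight \<open>\<psi>\<close> makes all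
    integrals finite, is 1 wherever \<open>w\<close> or \<open>v\<close> is nonzero and, being
    radial, keeps \<open>ang_laplacian\<close> symmetric.\<close>
  define ip where "ip f h = (LINT x|lborel. \<psi> x * (f x * h x))" for f h :: "'a \<Rightarrow> real"
  have int: "integrable lborel (\<lambda>x. \<psi> x * (f x * h x))"
    if "smooth_on (-{0}) f" "smooth_on (-{0}) h" for f h
    by (intro integrable_annular annular_mult_left \<psi>(2) smooth_on_mult S that radial_smooth[OF \<psi>(1)])
  have ip_sym: "ip f h = ip h f" for f h by (simp add: ip_def mult.commute)
  have ip_nonneg: "0 \<le> ip f f" for f using \<psi>(3) by (simp add: ip_def integral_nonneg_AE)
  have ip_ang: "ip h (ang_laplacian f) = ip f (ang_laplacian h)"
    if "smooth_on (-{0}) f" "smooth_on (-{0}) h" for f h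
    unfolding ip_def
    using integral_radial_ang_laplacian[OF \<psi>(1) that annular_mult_left[OF \<psi>(2)]]
      integral_radial_ang_laplacian[OF \<psi>(1) that(2,1) annular_mult_left[OF \<psi>(2)]]
      ang_form_commute[of f h] by simp
  have ip_cmult: "ip f (\<lambda>x. s * h x) = s * ip f h" for f h s
    by (simp add: ip_def mult.left_commute)
  have ip_diff_sq: "ip (\<lambda>x. f x - s * h x) (\<lambda>x. f x - s * h x) = ip f f - 2 * s * ip f h + s\<^sup>2 * ip h h"
    if "smooth_on (-{0}) f" "smooth_on (-{0}) h" for f h s
  proof -
    have "ip (\<lambda>x. f x - s * h x) (\<lambda>x. f x - s * h x) = (LINT x|lborel. \<psi> x * (f x * f x)
        - 2 * s * (\<psi> x * (f x * h x)) + s\<^sup>2 * (\<psi> x * (h x * h x)))"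
      unfolding ip_def by (intro Bochner_Integration.integral_cong) (simp_all add: algebra_simps
          power2_eq_square)
    then show ?thesis using int that by (simp add: ip_def)
  qed
  define X where "X = (LINT x|lborel. \<psi> x)"
  have X: "0 \<le> X" unfolding X_def using \<psi>(3) by (simp add: integral_nonneg_AE)
  have \<psi>_int: "integrable lborel \<psi>" by (intro integrable_annular radial_smooth \<psi>)
  \<comment> \<open>Where \<open>\<psi>\<close> is nonzero, \<open>p\<close> will differ from
    \<open>w\<close> by less than \<open>e\<close>, so the squared norm of \<open>w - p\<close> is
    at most \<open>e\<^sup>2 * X\<close>.\<close>
  have key: "D * ip w w \<le> ip v v + D * X * e\<^sup>2" if e: "0 < e" for e
  proof -
    have "continuous_on (cball 0 R') w"
      using smooth_on_imp_continuous_on[OF smooth_on_annular[OF w]] continuous_on_subset by blast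
    then obtain p where p: "real_polynomial_function p" and near: "\<And>x. x \<in> cball 0 R' \<Longrightarrow> \<bar>w x - p x\<bar> < e"
      using Stone_Weierstrass_real_polynomial_function[OF compact_cball _ e] by metis
    obtain q K where q: "eigen_family q" and pq: "\<And>x. p x = (\<Sum>k\<le>K. q k x)"
      using poly_span_eigen_decomposition[OF poly_span_real_polynomial_function[OF p]] by metis
    have q_smooth: "smooth_on (-{0}) (q k)" and q_eig: "x \<noteq> 0 \<Longrightarrow>
        ang_laplacian (q k) x = - ?c k * q k x" for k x
      using q by (auto simp: eigen_family_def)
    have orth: "ip (q k) (q l) = 0" if "k \<noteq> l" for k l
    proof -
      have *: "ip (q l) (ang_laplacian (q k)) = - ?c k * ip (q l) (q k)" for k l
        unfolding ip_cmult[symmetric] unfolding ip_def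
        by (rule lborel_integral_cong_punctured) (simp add: q_eig)
      \<comment> \<open>This is where dimension at least two enters: in dimension one
        \<open>c_0 = c_1\<close>.\<close>
      have "?c k \<noteq> ?c l"
        using sphere_eigenvalue_strict_mono[OF N, of k l] sphere_eigenvalue_strict_mono[OF N, of l k] that
        by (cases "k < l") auto
      moreover have "?c k * ip (q k) (q l) = ?c l * ip (q k) (q l)"
        using ip_ang[OF q_smooth q_smooth, of l k] *[of l k] *[of k l] ip_sym[of "q k" "q l"] by simp
      ultimately show ?thesis by simp
    qed
    have ip_sum: "ip (\<lambda>x. \<Sum>k\<le>K. s k * q k x) (\<lambda>x. \<Sum>k\<le>K. s k * q k x)
        = (\<Sum>k\<le>K. (s k)\<^sup>2 * ip (q k) (q k))" for s
    proof -
      have "ip (\<lambda>x. \<Sum>k\<le>K. s k * q k x) (\<lambda>x. \<Sum>k\<le>K. s k * q k x)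
          = (LINT x|lborel. (\<Sum>k\<le>K. \<Sum>l\<le>K. s k * s l * (\<psi> x * (q k x * q l x))))"
        unfolding ip_def sum_product by (simp add: sum_distrib_left mult_ac)
      also have "\<dots> = (\<Sum>k\<le>K. \<Sum>l\<le>K. s k * s l * ip (q k) (q l))"
        using int[OF q_smooth q_smooth] by (simp add: ip_def)
      also have "\<dots> = (\<Sum>k\<le>K. \<Sum>l\<le>K. if l = k then (s k)\<^sup>2 * ip (q k) (q k) else 0)"
        using orth by (intro sum.cong refl) (auto simp: power2_eq_square)
      finally show ?thesis by simp
    qed
    \<comment> \<open>On \<open>q k\<close> the operator \<open>ang_laplacian - \<mu>\<close> is
      multiplication by \<open>- (?c k + \<mu>)\<close>, so \<open>Q\<close> is a preimage of
      \<open>p\<close>.\<close>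
    define Q where "Q x = (\<Sum>k\<le>K. (- 1 / (?c k + \<mu>)) * q k x)" for x
    have Q: "smooth_on (-{0}) Q" and p_smooth: "smooth_on (-{0}) p"
      unfolding Q_def[abs_def] pq[abs_def]
      by (intro smooth_on_sum smooth_on_mult smooth_on_const S q_smooth)+
    have Q_eq: "p x = ang_laplacian Q x - \<mu> * Q x" if x: "x \<noteq> 0" for x
    proof -
      have "ang_laplacian Q x = (\<Sum>k\<le>K. ang_laplacian (\<lambda>x. (- 1 / (?c k + \<mu>)) * q k x) x)"
        unfolding Q_def[abs_def] using x
        by (intro ang_laplacian_sum[OF S] smooth_on_mult smooth_on_const S q_smooth) auto
      also have "\<dots> = (\<Sum>k\<le>K. (- 1 / (?c k + \<mu>)) * (- ?c k * q k x))"
        using x by (intro sum.cong refl, subst ang_laplacian_cmult[OF S q_smooth]) (auto simp: q_eig)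
      finally have "ang_laplacian Q x - \<mu> * Q x
          = (\<Sum>k\<le>K. (- 1 / (?c k + \<mu>)) * (- ?c k * q k x) - \<mu> * ((- 1 / (?c k + \<mu>)) * q k x))"
        by (simp add: Q_def sum_distrib_left sum_subtractf sum_negf sum.distrib)
      also have "\<dots> = (\<Sum>k\<le>K. q k x)"
      proof (intro sum.cong refl)
        fix k
        have "(- 1 / s) * (- t * y) - \<mu> * ((- 1 / s) * y) = (t + \<mu>) * y / s" for s t y :: real
          by (simp add: algebra_simps add_divide_distrib)
        from this[of "?c k + \<mu>" "?c k" "q k x"] c[of k]
        show "(- 1 / (?c k + \<mu>)) * (- ?c k * q k x) - \<mu> * ((- 1 / (?c k + \<mu>)) * q k x) = q k x"
          by simp
      qed
      finally show ?thesis by (simp add: pq)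
    qed
    have wp: "ip w p = ip v Q"
    proof -
      have "ip w p = (LINT x|lborel. \<psi> x * (w x * ang_laplacian Q x) - \<mu> * (\<psi> x * (w x * Q x)))"
        unfolding ip_def by (rule lborel_integral_cong_punctured) (simp add: Q_eq algebra_simps)
      also have "\<dots> = ip w (ang_laplacian Q) - \<mu> * ip w Q"
        using int[OF w(1) smooth_on_ang_laplacian[OF S Q]] int[OF w(1) Q] by (simp add: ip_def)
      also have "ip w (ang_laplacian Q) = ip Q (ang_laplacian w)" by (rule ip_ang[OF Q w(1)])
      also have "ip Q (ang_laplacian w) - \<mu> * ip w Q
          = (LINT x|lborel. \<psi> x * (Q x * ang_laplacian w x) - \<mu> * (\<psi> x * (w x * Q x)))"
        using int[OF Q smooth_on_ang_laplacian[OF S w(1)]] int[OF w(1) Q] by (simp add: ip_def)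
      also have "\<dots> = ip v Q"
        unfolding ip_def by (intro Bochner_Integration.integral_cong) (simp_all add: v_def algebra_simps)
      finally show ?thesis .
    qed
    have "ip p p = (\<Sum>k\<le>K. ip (q k) (q k))"
      using ip_sum[of "\<lambda>_. 1"] by (simp add: pq[abs_def])
    moreover have "ip Q Q = (\<Sum>k\<le>K. (- 1 / (?c k + \<mu>))\<^sup>2 * ip (q k) (q k))"
      unfolding Q_def[abs_def] by (rule ip_sum)
    moreover have "D * ((- 1 / (?c k + \<mu>))\<^sup>2 * ip (q k) (q k)) \<le> ip (q k) (q k)" for k
    proof -
      have "D * (- 1 / (?c k + \<mu>))\<^sup>2 \<le> 1" using D[of k] c[of k] by (simp add: power_divide)
      from mult_right_mono[OF this ip_nonneg[of "q k"]] show ?thesis by (simp add: mult.assoc)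
    qed
    ultimately have QQ: "D * ip Q Q \<le> ip p p"
      by (simp only: sum_distrib_left) (intro sum_mono)
    \<comment> \<open>With \<open>QQ\<close> and \<open>wp\<close> this becomes
      \<open>2 * D * ip w p - D * ip p p \<le> ip v v\<close>; completing the left-hand side to
      \<open>D * ip w w\<close> costs \<open>D\<close> times the squared norm of
      \<open>w - p\<close>.\<close>
    have "0 \<le> ip v v - 2 * D * ip v Q + D\<^sup>2 * ip Q Q"
      using ip_diff_sq[OF v(1) Q, of D] ip_nonneg[of "\<lambda>x. v x - D * Q x"] by simp
    moreover have "D * (D * ip Q Q) \<le> D * ip p p" using False QQ by (intro mult_left_mono) auto
    moreover have "ip w w - 2 * ip w p + ip p p \<le> e\<^sup>2 * X"
    proof -
      have "ip (\<lambda>x. w x - 1 * p x) (\<lambda>x. w x - 1 * p x) \<le> (LINT x|lborel. e\<^sup>2 * \<psi> x)"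
        unfolding ip_def
      proof (intro integral_mono)
        show "integrable lborel (\<lambda>x. \<psi> x * ((w x - 1 * p x) * (w x - 1 * p x)))"
          by (intro int smooth_on_diff smooth_on_mult smooth_on_const w p_smooth S)
        show "\<psi> x * ((w x - 1 * p x) * (w x - 1 * p x)) \<le> e\<^sup>2 * \<psi> x" for x
        proof (cases "x \<in> cball 0 R'")
          case True
          then have "\<bar>w x - p x\<bar>\<^sup>2 \<le> e\<^sup>2" using near[OF True] by (intro power_mono) auto
          from mult_left_mono[OF this \<psi>(3)[of x]] show ?thesis by (simp add: power2_eq_square mult.commute)
        next
          case False
          then show ?thesis using R'[of x] by simp
        qed
      qed (use \<psi>_int in auto)
      then show ?thesis using ip_diff_sq[OF w(1) p_smooth, of 1] \<psi>_int by (simp add: X_def)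
    qed
    then have "D * (ip w w - 2 * ip w p + ip p p)
        \<le> D * (e\<^sup>2 * X)" using False by (intro mult_left_mono) auto
    ultimately show ?thesis unfolding wp by (simp add: algebra_simps power2_eq_square)
  qed
  have "D * ip w w \<le> ip v v"
  proof (rule field_le_epsilon)
    fix \<epsilon> :: real assume \<epsilon>: "0 < \<epsilon>"
    have pos: "D * X + 1 > 0" using False X by (simp add: add_nonneg_pos)
    then have "D * ip w w \<le> ip v v + D * X * (sqrt (\<epsilon> / (D * X + 1)))\<^sup>2" using \<epsilon> by (intro key) simp
    also have "D * X * (sqrt (\<epsilon> / (D * X + 1)))\<^sup>2 \<le> \<epsilon>" using pos \<epsilon> by (simp add: field_simps)
    finally show "D * ip w w \<le> ip v v + \<epsilon>" by simp
  qed
  moreover have "ip w w = (LINT x|lborel. w x * w x)" "ip v v = (LINT x|lborel. v x * v x)"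
  proof -
    have "\<psi> x * (w x * w x) = w x * w x" "\<psi> x * (v x * v x) = v x * v x" for x
      using \<psi>w[of x] \<psi>v[of x] by auto
    then show "ip w w = (LINT x|lborel. w x * w x)" "ip v v = (LINT x|lborel. v x * v x)"
      by (simp_all only: ip_def)
  qed
  ultimately show ?thesis by (simp add: v_def)
qed

text \<open>With a single coordinate, \<open>x^2 f'' = E (E f) - E f\<close> for the Euler field
  \<open>E\<close>, and \<open>N - 2 = -1\<close>: there is no angular direction.\<close>

lemma ang_laplacian_DIM_1:
  fixes f :: "'a::euclidean_space \<Rightarrow> real"
  assumes "DIM('a) = 1" and f: "smooth_on S f" "open S" "x \<in> S"
  shows "ang_laplacian f x = 0"
proof -
  obtain i :: 'a where i: "Basis = {i}" using assms(1) card_1_singletonE by blast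
  have e: "euler h y = (y \<bullet> i) * partial_deriv i h y" for h :: "'a \<Rightarrow> real" and y
    by (simp add: euler_def i)
  have "partial_deriv i (euler f) x = partial_deriv i f x + (x \<bullet> i) * partial_deriv i (partial_deriv i f) x"
  proof -
    have "i \<in> Basis" unfolding i by (rule singletonI)
    from partial_deriv_euler[OF f(2,1,3) this] show ?thesis by (simp only: e[of "partial_deriv i f"])
  qed
  then have "euler (euler f) x = (x \<bullet> i) * (partial_deriv i f x
      + (x \<bullet> i) * partial_deriv i (partial_deriv i f) x)"
    by (simp add: e[of "euler f"])
  then show ?thesis
    by (simp add: ang_laplacian_def laplacian_def e norm_power2_eq_sum algebra_simps i assms(1))
qed

lemma norm_powr_add: "norm x powr p * (norm x powr q * c) = norm x powr (p + q) * c" for c :: real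
  by (simp add: powr_add)

text \<open>Half of the weight is absorbed into \<open>w'\<close>, through which the angular
  operator passes. In dimension one the angular Laplacian vanishes and only the eigenvalue 0 counts,
  which explains the range of \<open>k\<close>.\<close>

lemma ang_laplacian_lower_bound_weighted:
  fixes w :: "'a::euclidean_space \<Rightarrow> real"
  assumes g: "cutoff g" and w: "smooth_on (-{0}) w" "annular w"
    and D: "\<And>k. k = 0 \<or> 2 \<le> DIM('a) \<Longrightarrow> D \<le> (sphere_eigenvalue DIM('a) k + \<mu>)\<^sup>2"
  shows "D * (LINT x|lborel. norm x powr (- DIM('a)) * (w x)\<^sup>2)
    \<le> (LINT x|lborel. norm x powr (- DIM('a)) * (ang_laplacian w x - \<mu> * w x)\<^sup>2)"
proof (cases "DIM('a) \<ge> 2")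
  case True
  let ?p = "- DIM('a) / 2"
  define w' where "w' x = norm x powr ?p * w x" for x
  have w': "smooth_on (-{0}) w'" "annular w'"
    unfolding w'_def[abs_def]
    by (intro smooth_on_mult smooth_on_norm_powr w annular_mult_right open_punctured)+
  have "(LINT x|lborel. w' x * w' x) = (LINT x|lborel. norm x powr (- DIM('a)) * (w x)\<^sup>2)"
    by (rule lborel_integral_cong_punctured)
      (simp add: w'_def power2_eq_square powr_add[symmetric] mult.left_commute mult.assoc norm_powr_add)
  moreover have "(LINT x|lborel. (ang_laplacian w' x - \<mu> * w' x) * (ang_laplacian w' x - \<mu> * w' x))
    = (LINT x|lborel. norm x powr (- DIM('a)) * (ang_laplacian w x - \<mu> * w x)\<^sup>2)"
  proof (rule lborel_integral_cong_punctured)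
    fix x :: 'a assume x: "x \<noteq> 0"
    have "ang_laplacian w' x - \<mu> * w' x = norm x powr ?p * (ang_laplacian w x - \<mu> * w x)"
      using ang_laplacian_radial_mult[OF radial_norm_powr w(1) x]
          by (simp add: w'_def[abs_def] algebra_simps)
    then show "(ang_laplacian w' x - \<mu> * w' x) * (ang_laplacian w' x - \<mu> * w' x)
        = norm x powr (- DIM('a)) * (ang_laplacian w x - \<mu> * w x)\<^sup>2"
      by (simp add: power2_eq_square mult.left_commute mult.assoc norm_powr_add)
  qed
  ultimately show ?thesis using ang_laplacian_lower_bound[OF g True w' D] True by simp
next
  case False
  then have N: "DIM('a) = 1" using DIM_positive[where 'a='a] by linarith
  have "(LINT x|lborel. norm x powr (- DIM('a)) * (ang_laplacian w x - \<mu> * w x)\<^sup>2)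
      = (LINT x|lborel. \<mu>\<^sup>2 * (norm x powr (- DIM('a)) * (w x)\<^sup>2))"
    by (rule lborel_integral_cong_punctured)
      (simp add: ang_laplacian_DIM_1[OF N w(1) open_punctured] power_mult_distrib)
  also have "\<dots> = \<mu>\<^sup>2 * (LINT x|lborel. norm x powr (- DIM('a)) * (w x)\<^sup>2)" by simp
  finally show ?thesis
    using D[of 0] by (simp add: sphere_eigenvalue_def mult_right_mono integral_nonneg_AE)
qed

lemma annular_power2: "annular f \<Longrightarrow> annular (\<lambda>x. (f x)\<^sup>2)"
  unfolding power2_eq_square by (rule annular_mult_left)

section \<open>The inequality on the punctured space\<close>

text \<open>Brings both integrands to the weight \<open>|x| powr (m - 4)\<close> and exposes the
  scale-invariant operator \<open>|x|^2 laplacian\<close>, which the Euler field and the angular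
  Laplacian express.\<close>

lemma rellich_integrand_eq:
  "rellich_integrand m u x = norm x powr (m - 4) * ((norm x)\<^sup>2 * laplacian u x)\<^sup>2"
proof (cases "x = 0")
  case False
  then have "norm x powr m = norm x powr (m - 4) * (norm x)\<^sup>2 * (norm x)\<^sup>2"
    using powr_add[of "norm x" "m - 4" 4] by (simp add: power2_eq_square eval_nat_numeral)
  then show ?thesis by (simp add: rellich_integrand_def power2_eq_square mult_ac)
qed (simp add: rellich_integrand_def)

lemma hardy_integrand_eq: "hardy_integrand m u x = norm x powr (m - 4) * (euler u x)\<^sup>2"
  by (simp add: hardy_integrand_def inner_grad_eq_euler)

text \<open>Conjugation with \<open>|x| powr (- a)\<close> turns the Euler field \<open>E\<close>
  into \<open>E - a\<close>, and \<open>N - 2 = a + b\<close>, so the radial part becomes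
  \<open>(E - a)^2 + (a + b) (E - a) = E^2 + (b - a) E - a b\<close>. The exponent \<open>a\<close>
  is the one with \<open>m - 4 - 2 a = - N\<close>, the weight of the cylinder.\<close>

lemma
  fixes w :: "'a::euclidean_space \<Rightarrow> real" and m a b :: real
  assumes w: "smooth_on (-{0}) w" and x: "x \<noteq> 0"
    and a: "a = (real DIM('a) + m - 4) / 2" and b: "b = (real DIM('a) - m) / 2"
  shows rellich_integrand_powr_mult: "rellich_integrand m (\<lambda>x. norm x powr (- a) * w x) x =
      norm x powr (- DIM('a)) * (euler (euler w) x + (b - a) * euler w x
          + ang_laplacian w x - a * b * w x)\<^sup>2"
    and hardy_integrand_powr_mult: "hardy_integrand m (\<lambda>x. norm x powr (- a) * w x) x =
      norm x powr (- DIM('a)) * (euler w x - a * w x)\<^sup>2"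
proof -
  note S = open_punctured[where 'a='a]
  define U where "U x = norm x powr (- a) * w x" for x
  have U: "smooth_on (-{0}) U"
    unfolding U_def[abs_def] by (intro smooth_on_mult smooth_on_norm_powr w S)
  have e1: "euler U x = norm x powr (- a) * (euler w x - a * w x)" if "x \<noteq> 0" for x
    using euler_mult[OF S smooth_on_norm_powr w, of x "-a"] that
    by (simp add: U_def[abs_def] euler_norm_powr algebra_simps)
  have sm: "smooth_on (-{0}) (\<lambda>x. a * w x)" by (intro smooth_on_mult smooth_on_const w S)
  have sm2: "smooth_on (-{0}) (\<lambda>x. euler w x - a * w x)" by (intro smooth_on_diff smooth_on_euler w S sm)
  have "euler (euler U) x = euler (\<lambda>x. norm x powr (- a) * (euler w x - a * w x)) x"
    using x e1 by (intro euler_cong[OF S]) auto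
  also have "\<dots> = norm x powr (- a) * (euler (\<lambda>x. euler w x - a * w x) x - a * (euler w x - a * w x))"
    using euler_mult[OF S smooth_on_norm_powr sm2, of x "-a"] x by (simp add: euler_norm_powr algebra_simps)
  also have "euler (\<lambda>x. euler w x - a * w x) x = euler (euler w) x - a * euler w x"
    using euler_diff[OF S smooth_on_euler[OF S w] sm, of x] euler_cmult[OF S w, of x a] x by simp
  finally have e2: "euler (euler U) x = norm x powr (- a) * (euler (euler w) x - 2 * a * euler w x
      + a\<^sup>2 * w x)"
    by (simp add: algebra_simps power2_eq_square)
  have l: "ang_laplacian U x = norm x powr (- a) * ang_laplacian w x"
    unfolding U_def[abs_def] by (rule ang_laplacian_radial_mult[OF radial_norm_powr w x])
  have N: "real DIM('a) - 2 = a + b" by (simp add: a b field_simps)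
  have "(norm x)\<^sup>2 * laplacian U x = ang_laplacian U x + euler (euler U) x + (real DIM('a) - 2) * euler U x"
    by (simp add: ang_laplacian_def)
  also have "\<dots> = norm x powr (- a) * (euler (euler w) x + (b - a) * euler w x
      + ang_laplacian w x - a * b * w x)"
    unfolding l e1[OF x] e2 N by (simp add: algebra_simps power2_eq_square)
  finally have L: "(norm x)\<^sup>2 * laplacian U x
      = norm x powr (- a) * (euler (euler w) x + (b - a) * euler w x + ang_laplacian w x - a * b * w x)" .
  have exp: "norm x powr (m - 4) * (norm x powr (- a))\<^sup>2 = norm x powr (- DIM('a))"
    by (simp add: power2_eq_square flip: powr_add) (simp add: a field_simps)
  have "rellich_integrand m U x = norm x powr (m - 4) * ((norm x)\<^sup>2 * laplacian U x)\<^sup>2"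
    by (rule rellich_integrand_eq)
  also have "\<dots> = norm x powr (m - 4) * (norm x powr (- a))\<^sup>2 * (euler (euler w) x + (b - a) * euler w x
      + ang_laplacian w x - a * b * w x)\<^sup>2"
    unfolding L by (simp add: power_mult_distrib mult.assoc)
  finally show "rellich_integrand m (\<lambda>x. norm x powr (- a) * w x) x =
      norm x powr (- DIM('a)) * (euler (euler w) x + (b - a) * euler w x
          + ang_laplacian w x - a * b * w x)\<^sup>2"
    unfolding exp U_def[abs_def] .
  have "hardy_integrand m U x = norm x powr (m - 4) * (norm x powr (- a))\<^sup>2 * (euler w x - a * w x)\<^sup>2"
    by (simp add: hardy_integrand_eq e1[OF x] power_mult_distrib mult_ac)
  then show "hardy_integrand m (\<lambda>x. norm x powr (- a) * w x) x =
      norm x powr (- DIM('a)) * (euler w x - a * w x)\<^sup>2"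
    unfolding exp U_def[abs_def] .
qed

text \<open>\<open>|x| powr (- N) dx\<close> is the dilation-invariant product measure of the
  cylinder. Null functions are what an integration by parts discards; integrability is included so
  that they can be added.\<close>

definition cyl_null :: "('a::euclidean_space \<Rightarrow> real) \<Rightarrow> bool" where
  "cyl_null f \<longleftrightarrow> integrable lborel (\<lambda>x. norm x powr (- DIM('a)) * f x) \<and>
     (LINT x|lborel. norm x powr (- DIM('a)) * f x) = 0"

lemma cyl_null_add: "cyl_null f \<Longrightarrow> cyl_null h \<Longrightarrow> cyl_null (\<lambda>x. f x + h x)"
  by (simp add: cyl_null_def distrib_left)

lemma cyl_null_cmult: "cyl_null f \<Longrightarrow> cyl_null (\<lambda>x. s * f x)"
  by (simp add: cyl_null_def mult.left_commute[of _ s])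

lemma cyl_integrable:
  fixes f :: "'a::euclidean_space \<Rightarrow> real"
  assumes "smooth_on (-{0}) f" "annular f"
  shows "integrable lborel (\<lambda>x. norm x powr p * f x)"
  using assms by (intro integrable_annular annular_mult_right smooth_on_mult smooth_on_norm_powr
      open_punctured)

text \<open>The integrand is the divergence of \<open>|x| powr (- N) f x\<close>: the weight
  contributes \<open>- N\<close> and the field \<open>x\<close> contributes
  \<open>N\<close>.\<close>

lemma cyl_null_euler:
  fixes f :: "'a::euclidean_space \<Rightarrow> real"
  assumes f: "smooth_on (-{0}) f" "annular f"
  shows "cyl_null (euler f)"
  unfolding cyl_null_def
proof
  show "integrable lborel (\<lambda>x. norm x powr (- DIM('a)) * euler f x)"
    by (intro cyl_integrable smooth_on_euler annular_euler f open_punctured)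
  let ?h = "\<lambda>x. norm x powr (- DIM('a)) * f x"
  have "(LINT x|lborel. norm x powr (- DIM('a)) * euler f x) = (LINT x|lborel. euler ?h x + DIM('a) * ?h x)"
  proof (rule lborel_integral_cong_punctured)
    fix x :: 'a assume x: "x \<noteq> 0"
    then show "norm x powr (- DIM('a)) * euler f x = euler ?h x + DIM('a) * ?h x"
      using euler_mult[OF open_punctured smooth_on_norm_powr f(1), of x "- DIM('a)"]
      by (simp add: euler_norm_powr)
  qed
  also have "\<dots> = 0"
    using f by (intro integral_euler annular_mult_right smooth_on_mult smooth_on_norm_powr open_punctured)
  finally show "(LINT x|lborel. norm x powr (- DIM('a)) * euler f x) = 0" .
qed

lemma cyl_null_ang:
  fixes f h :: "'a::euclidean_space \<Rightarrow> real"
  assumes f: "smooth_on (-{0}) f" and h: "smooth_on (-{0}) h" "annular h"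
  shows "cyl_null (\<lambda>x. h x * ang_laplacian f x + ang_form f h x)"
proof -
  let ?r = "\<lambda>x::'a. norm x powr (- DIM('a))"
  have "annular (ang_form f h)"
    using annular_ang_form[OF h(2), of f] ang_form_commute[of f, abs_def] by simp
  then have int: "integrable lborel (\<lambda>x. ?r x * (h x * ang_laplacian f x))"
      "integrable lborel (\<lambda>x. ?r x * ang_form f h x)"
    by (intro cyl_integrable smooth_on_mult smooth_on_ang_laplacian smooth_on_ang_form f h
        annular_mult_left open_punctured)+
  moreover have "(LINT x|lborel. ?r x * (h x * ang_laplacian f x))
      = - (LINT x|lborel. ?r x * ang_form f h x)"
    by (intro integral_radial_ang_laplacian radial_norm_powr f h annular_mult_right)
  ultimately show ?thesis by (simp add: cyl_null_def distrib_left)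
qed

lemma rellich_hardy_annular:
  fixes U :: "'a::euclidean_space \<Rightarrow> real" and m a b C :: real
  assumes g: "cutoff g" and U: "smooth_on (-{0}) U" "annular U"
    and a: "a = (real DIM('a) + m - 4) / 2" and b: "b = (real DIM('a) - m) / 2"
    and C: "C \<le> b\<^sup>2" "\<And>k. k = 0 \<or> 2 \<le> DIM('a) \<Longrightarrow> C * a\<^sup>2 \<le> (sphere_eigenvalue DIM('a) k + a * b)\<^sup>2"
  shows "C * (LINT x|lborel. hardy_integrand m U x) \<le> (LINT x|lborel. rellich_integrand m U x)"
proof -
  note S = open_punctured[where 'a='a]
  let ?\<rho> = "\<lambda>x::'a. norm x powr (- DIM('a))"
  define w where "w x = norm x powr a * U x" for x
  have w: "smooth_on (-{0}) w" "annular w"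
    unfolding w_def[abs_def]
    by (intro smooth_on_mult smooth_on_norm_powr U annular_mult_right S)+
  have Uw: "U x = norm x powr (- a) * w x" if "x \<noteq> 0" for x
    using that by (simp add: w_def powr_minus)
  define e1 where "e1 = euler w"
  define e2 where "e2 = euler e1"
  define l where "l = ang_laplacian w"
  define L where "L x = e2 x + (b - a) * e1 x + l x - a * b * w x" for x
  have e1: "smooth_on (-{0}) e1" "annular e1" and e2: "smooth_on (-{0}) e2" "annular e2"
    and l: "smooth_on (-{0}) l" "annular l"
    unfolding e2_def e1_def l_def
    by (intro smooth_on_euler annular_euler smooth_on_ang_laplacian annular_ang_laplacian w S)+
  note sm = w e1 e2 l smooth_on_mult smooth_on_add smooth_on_diff smooth_on_const smooth_on_ang_form S
    annular_mult_left annular_mult_right annular_add annular_diff annular_ang_form smooth_on_power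
  define P where "P x = ((e2 x)\<^sup>2 + (a\<^sup>2 + b\<^sup>2 - C) * (e1 x)\<^sup>2 + 2 * ang_form e1 e1 x)
      + ((l x - a * b * w x)\<^sup>2 - C * a\<^sup>2 * (w x)\<^sup>2)" for x
  \<comment> \<open>Each summand disposes of cross terms of the expanded squares. Products with
    \<open>l\<close> are moved to \<open>ang_form\<close>, and products of the form
    \<open>h * euler h\<close> are half the Euler derivative of a square. Two cross terms leave
    something in \<open>P\<close>: \<open>e2 * l\<close> leaves \<open>2 * ang_form e1 e1\<close>,
    and \<open>e2 * w\<close> leaves \<open>2 * a * b * e1\<^sup>2\<close>, which turns
    \<open>(b - a)\<^sup>2\<close> into \<open>a\<^sup>2 + b\<^sup>2\<close>.\<close>
  define Z where "Z x = (b - a) * euler (\<lambda>x. e1 x * e1 x) x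
    + (2 * (e2 x * l x + ang_form w e2 x) + (- 2 * euler (ang_form w e1) x
    + (- 2 * a * b * euler (\<lambda>x. e1 x * w x) x + (2 * (b - a) * (e1 x * l x + ang_form w e1 x)
    + (- (b - a) * euler (ang_form w w) x + (a * C - a * b * (b - a)) * euler (\<lambda>x. w x * w x) x)))))" for x
  have Z: "cyl_null Z"
    unfolding Z_def[abs_def] l_def
    by (intro cyl_null_add cyl_null_cmult cyl_null_euler cyl_null_ang sm)
  have eq: "(L x)\<^sup>2 - C * (e1 x - a * w x)\<^sup>2 = P x + Z x" if x: "x \<noteq> 0" for x
  proof -
    have "x \<in> -{0}" using x by simp
    note this [simp] x [simp]
    have "euler (\<lambda>x. e1 x * e1 x) x = 2 * (e1 x * e2 x)" "euler (\<lambda>x. e1 x * w x) x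
        = e1 x * e1 x + e2 x * w x"
      "euler (\<lambda>x. w x * w x) x = 2 * (e1 x * w x)"
      using euler_mult[OF S e1(1) e1(1), of x] euler_mult[OF S e1(1) w(1), of x] euler_mult[OF S w(1)
          w(1), of x]
      by (simp_all add: e1_def e2_def)
    moreover have "euler (ang_form w e1) x = ang_form e1 e1 x + ang_form w e2 x"
      "euler (ang_form w w) x = 2 * ang_form w e1 x"
      using euler_ang_form[OF S w(1) e1(1), of x] euler_ang_form[OF S w(1) w(1), of x]
          ang_form_commute[of e1 w x]
      by (simp_all add: e1_def e2_def)
    ultimately show ?thesis
      by (simp add: L_def P_def Z_def algebra_simps power2_eq_square)
  qed
  have int: "integrable lborel (\<lambda>x. ?\<rho> x * (L x)\<^sup>2)" "integrable lborel (\<lambda>x. ?\<rho> x * (e1 x - a * w x)\<^sup>2)"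
    "integrable lborel (\<lambda>x. ?\<rho> x * P x)" "integrable lborel (\<lambda>x. ?\<rho> x * ((l x - a * b * w x)\<^sup>2))"
    "integrable lborel (\<lambda>x. ?\<rho> x * (w x)\<^sup>2)"
    "integrable lborel (\<lambda>x. ?\<rho> x * ((e2 x)\<^sup>2 + (a\<^sup>2 + b\<^sup>2 - C) * (e1 x)\<^sup>2 + 2 * ang_form e1 e1 x))"
  proof -
    note cl = smooth_on_mult smooth_on_add smooth_on_diff smooth_on_const smooth_on_ang_form
      smooth_on_power w e1 e2 l S annular_mult_right annular_add annular_diff annular_ang_form
          annular_power2
    have "smooth_on (-{0}) L" "annular L" unfolding L_def[abs_def] by (intro cl)+
    then show "integrable lborel (\<lambda>x. ?\<rho> x * (L x)\<^sup>2)" by (intro cyl_integrable cl)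
    have "smooth_on (-{0}) P" "annular P" unfolding P_def[abs_def] by (intro cl)+
    then show "integrable lborel (\<lambda>x. ?\<rho> x * P x)" by (intro cyl_integrable)
  qed (intro cyl_integrable smooth_on_mult smooth_on_add smooth_on_diff smooth_on_const smooth_on_ang_form
      smooth_on_power w e1 e2 l S annular_mult_right annular_add annular_diff annular_ang_form
          annular_power2)+
  have "(LINT x|lborel. ?\<rho> x * (L x)\<^sup>2) - C * (LINT x|lborel. ?\<rho> x * (e1 x - a * w x)\<^sup>2)
      = (LINT x|lborel. ?\<rho> x * (L x)\<^sup>2 - C * (?\<rho> x * (e1 x - a * w x)\<^sup>2))"
    using int by simp
  also have "\<dots> = (LINT x|lborel. ?\<rho> x * P x + ?\<rho> x * Z x)"
  proof (rule lborel_integral_cong_punctured)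
    fix x :: 'a assume "x \<noteq> 0"
    from arg_cong[OF eq[OF this], of "\<lambda>t. ?\<rho> x * t"]
    show "?\<rho> x * (L x)\<^sup>2 - C * (?\<rho> x * (e1 x - a * w x)\<^sup>2) = ?\<rho> x * P x + ?\<rho> x * Z x"
      by (simp add: algebra_simps)
  qed
  also have "\<dots> = (LINT x|lborel. ?\<rho> x * P x)"
    using int(3) Z by (simp add: cyl_null_def)
  also have "\<dots> = (LINT x|lborel. ?\<rho> x * ((e2 x)\<^sup>2 + (a\<^sup>2 + b\<^sup>2 - C) * (e1 x)\<^sup>2 + 2 * ang_form e1 e1 x)
      + (?\<rho> x * (l x - a * b * w x)\<^sup>2 - C * a\<^sup>2 * (?\<rho> x * (w x)\<^sup>2)))"
    by (intro Bochner_Integration.integral_cong) (simp_all add: P_def algebra_simps)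
  also have "\<dots> = (LINT x|lborel. ?\<rho> x * ((e2 x)\<^sup>2 + (a\<^sup>2 + b\<^sup>2 - C) * (e1 x)\<^sup>2 + 2 * ang_form e1 e1 x))
      + ((LINT x|lborel. ?\<rho> x * (l x - a * b * w x)\<^sup>2) - C * a\<^sup>2 * (LINT x|lborel. ?\<rho> x * (w x)\<^sup>2))"
    using int by simp
  also have "\<dots> \<ge> 0"
  proof (intro add_nonneg_nonneg)
    have Cab: "0 \<le> a\<^sup>2 + b\<^sup>2 - C" using C(1) zero_le_power2[of a] by linarith
    show "0 \<le> (LINT x|lborel. ?\<rho> x * ((e2 x)\<^sup>2 + (a\<^sup>2 + b\<^sup>2 - C) * (e1 x)\<^sup>2 + 2 * ang_form e1 e1 x))"
      using Cab ang_form_nonneg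
      by (intro integral_nonneg_AE always_eventually allI mult_nonneg_nonneg add_nonneg_nonneg) auto
    \<comment> \<open>The spectral inequality with \<open>\<mu> = a * b\<close> and
      \<open>D = C * a\<^sup>2\<close>.\<close>
    show "0 \<le> (LINT x|lborel. ?\<rho> x * (l x - a * b * w x)\<^sup>2) - C * a\<^sup>2 * (LINT x|lborel. ?\<rho> x * (w x)\<^sup>2)"
      using ang_laplacian_lower_bound_weighted[OF g w C(2)] by (simp add: l_def)
  qed
  finally have "C * (LINT x|lborel. ?\<rho> x * (e1 x - a * w x)\<^sup>2) \<le> (LINT x|lborel. ?\<rho> x * (L x)\<^sup>2)" by simp
  moreover have cong: "hardy_integrand m U x = hardy_integrand m (\<lambda>x. norm x powr (- a) * w x) x"
    "rellich_integrand m U x = rellich_integrand m (\<lambda>x. norm x powr (- a) * w x) x" if "x \<noteq> 0" for x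
    using that euler_cong[OF S _ Uw, of x] laplacian_cong[OF S _ Uw, of x]
    by (simp_all add: hardy_integrand_def rellich_integrand_def inner_grad_eq_euler)
  moreover have "(LINT x|lborel. hardy_integrand m U x) = (LINT x|lborel. ?\<rho> x * (e1 x - a * w x)\<^sup>2)"
    by (rule lborel_integral_cong_punctured)
      (simp add: cong hardy_integrand_powr_mult[OF w(1) _ a b] e1_def)
  moreover have "(LINT x|lborel. rellich_integrand m U x) = (LINT x|lborel. ?\<rho> x * (L x)\<^sup>2)"
    by (rule lborel_integral_cong_punctured)
      (simp add: cong rellich_integrand_powr_mult[OF w(1) _ a b] e1_def e2_def L_def l_def)
  ultimately show ?thesis by simp
qed

section \<open>Polar coordinates for radial integrands\<close>

context
  fixes q :: "'a::euclidean_space \<Rightarrow> real" and B :: real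
  assumes q_meas [measurable]: "q \<in> borel_measurable borel"
    and q_nonneg: "\<And>x. 0 \<le> q x" and q_bound: "\<And>x. q x \<le> B"
    and q_hom: "\<And>c x. 0 < c \<Longrightarrow> q (c *\<^sub>R x) = q x"
begin

text \<open>The integral of \<open>q\<close> over the unit sphere, written as a cone integral
  because \<open>q\<close> is homogeneous of degree 0.\<close>

definition polar_const :: real where
  "polar_const = real DIM('a) * (LINT x|lborel. indicator {..1} (norm x) * q x)"

lemma polar_integrable: "integrable lborel (\<lambda>x. indicator {..r} (norm x) * q x)"
proof (rule Bochner_Integration.integrable_bound)
  show "integrable lborel (\<lambda>x::'a. indicator (cball 0 r) x *\<^sub>R B)"
    by (intro borel_integrable_compact) auto
  show "AE x in lborel. norm (indicator {..r} (norm x) * q x) \<le> norm (indicator (cball 0 r) x *\<^sub>R B)"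
    using q_nonneg q_bound order_trans[OF q_nonneg q_bound] by (auto simp: indicator_def)
qed simp

lemma polar_const_nonneg: "0 \<le> polar_const"
  unfolding polar_const_def using q_nonneg by (auto intro!: integral_nonneg_AE)

lemma nn_integral_polar_cball:
  assumes "0 < r"
  shows "(\<integral>\<^sup>+x. ennreal (indicator {..r} (norm x) * q x) \<partial>lborel)
      = ennreal (r ^ DIM('a) * polar_const / DIM('a))"
proof -
  have "(\<integral>\<^sup>+x. ennreal (indicator {..r} (norm x) * q x) \<partial>lborel) =
      (\<integral>\<^sup>+x. ennreal (indicator {..r} (norm x) * q x) \<partial>density (distr lborel borel (\<lambda>x. 0
          + r *\<^sub>R x)) (\<lambda>_. \<bar>r\<bar>^DIM('a)))"
    using lborel_affine[of r "0::'a"] assms by simp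
  also have "\<dots> = (\<integral>\<^sup>+x. ennreal (r ^ DIM('a)) * ennreal (indicator {..r} (norm (r *\<^sub>R x)) * q (r *\<^sub>R x))
      \<partial>lborel)"
    using assms by (subst nn_integral_density, measurable) (subst nn_integral_distr, auto)
  also have "\<dots> = (\<integral>\<^sup>+x. ennreal (r ^ DIM('a)) * ennreal (indicator {..1} (norm x) * q x) \<partial>lborel)"
    using assms by (intro nn_integral_cong) (simp add: q_hom indicator_def)
  also have "\<dots> = ennreal (r ^ DIM('a)) * (\<integral>\<^sup>+x. ennreal (indicator {..1} (norm x) * q x) \<partial>lborel)"
    by (rule nn_integral_cmult) measurable
  also have "(\<integral>\<^sup>+x. ennreal (indicator {..1} (norm x) * q x) \<partial>lborel)
      = ennreal (LINT x|lborel. indicator {..1} (norm x) * q x)"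
    using q_nonneg by (intro nn_integral_eq_integral polar_integrable) auto
  also have "ennreal (r ^ DIM('a)) * \<dots> = ennreal (r ^ DIM('a) * polar_const / DIM('a))"
    using assms by (simp add: polar_const_def ennreal_mult'[symmetric])
  finally show ?thesis .
qed

text \<open>For \<open>r > 0\<close> both measures give \<open>{..r}\<close> the mass
  \<open>r ^ N * polar_const / N\<close>: the left one by scaling to the unit ball, the right one by
  integrating \<open>r ^ (N - 1)\<close>. Half-lines are stable under intersection and generate the
  Borel sets.\<close>

lemma distr_polar:
  "distr (density lborel q) borel norm =
    density lborel (\<lambda>r. ennreal (polar_const * (indicator {0..} r * r ^ (DIM('a) - 1))))"
proof -
  have eq: "emeasure (distr (density lborel q) borel norm) {..r}
      = ennreal (if r \<le> 0 then 0 else r ^ DIM('a) * polar_const / DIM('a))" for r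
  proof -
    have "emeasure (distr (density lborel q) borel norm) {..r}
        = (\<integral>\<^sup>+x. ennreal (q x) * indicator (norm -` {..r}) x \<partial>lborel)"
    proof -
      have "norm -` {..r} \<in> sets (borel :: 'a measure)"
        using measurable_sets[of norm "borel :: 'a measure" borel "{..r}"] by simp
      then show ?thesis by (subst emeasure_distr) (auto simp: emeasure_density)
    qed
    also have "\<dots> = (\<integral>\<^sup>+x. ennreal (indicator {..r} (norm x) * q x) \<partial>lborel)"
      by (intro nn_integral_cong) (auto simp: indicator_def)
    also have "\<dots> = ennreal (if r \<le> 0 then 0 else r ^ DIM('a) * polar_const / DIM('a))"
    proof (cases "r \<le> 0")
      case True
      have "(\<integral>\<^sup>+x. ennreal (indicator {..r} (norm x) * q x) \<partial>lborel) = (\<integral>\<^sup>+(x::'a). 0 \<partial>lborel)"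
      proof (intro nn_integral_cong_AE AE_punctured)
        fix x :: 'a assume "x \<noteq> 0"
        then have "\<not> norm x \<le> r" using True by (metis norm_le_zero_iff order_trans)
        then show "ennreal (indicator {..r} (norm x) * q x) = 0" by simp
      qed
      then show ?thesis using True by simp
    qed (use nn_integral_polar_cball[of r] in auto)
    finally show ?thesis .
  qed
  show ?thesis
  proof (rule measure_eqI_generator_eq[where E = "range atMost" and \<Omega> = UNIV and A = "\<lambda>n. {..real n}"])
  show "Int_stable (range (atMost :: real \<Rightarrow> real set))"
    by (auto simp: Int_stable_def intro!: image_eqI)
  fix X assume "X \<in> range (atMost :: real \<Rightarrow> real set)"
  then obtain r where X: "X = {..r}" by auto
  have "emeasure (density lborel (\<lambda>r. ennreal (polar_const * (indicator {0..} r * r ^ (DIM('a)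
      - 1))))) {..r} =
     (\<integral>\<^sup>+t. ennreal (polar_const * t ^ (DIM('a) - 1)) * indicator {0..r} t \<partial>lborel)"
    by (subst emeasure_density) (auto intro!: nn_integral_cong simp: indicator_def)
  also have "\<dots> = ennreal (if r \<le> 0 then 0 else r ^ DIM('a) * polar_const / DIM('a))"
  proof (cases "0 \<le> r")
    case True
    have "(\<integral>\<^sup>+t. ennreal (polar_const * t ^ (DIM('a) - 1)) * indicator {0..r} t \<partial>lborel)
       = ennreal (r ^ DIM('a) * polar_const / DIM('a) - 0 ^ DIM('a) * polar_const / DIM('a))"
      using True polar_const_nonneg
      by (intro nn_integral_FTC_Icc) (auto intro!: derivative_eq_intros)
    then show ?thesis using True by (auto simp: zero_power)
  next
    case False
    then show ?thesis by simp
  qed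
  finally show "emeasure (distr (density lborel q) borel norm) X =
    emeasure (density lborel (\<lambda>r. ennreal (polar_const * (indicator {0..} r * r ^ (DIM('a) - 1))))) X"
    unfolding X eq by simp
next
  show "emeasure (distr (density lborel q) borel norm) {..real n} \<noteq> \<infinity>" for n
    unfolding eq by simp
  show "(\<Union>n. {..real n}) = UNIV"
    using real_arch_simple by auto
qed (auto simp: borel_eq_atMost)
qed

lemma
  fixes F :: "real \<Rightarrow> real"
  assumes [measurable]: "F \<in> borel_measurable borel"
  shows integrable_polar: "integrable lborel (\<lambda>x. q x * F (norm x)) \<longleftrightarrow>
      integrable lborel (\<lambda>r. polar_const * (indicator {0..} r * r ^ (DIM('a) - 1)) * F r)" (is ?thesis1)
    and integral_polar: "(LINT x|lborel. q x * F (norm x)) =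
      (LINT r|lborel. polar_const * (indicator {0..} r * r ^ (DIM('a) - 1)) * F r)" (is ?thesis2)
proof -
  have nn: "0 \<le> polar_const * (indicator {0..} r * r ^ (DIM('a) - 1))" for r :: real
    using polar_const_nonneg by (auto simp: indicator_def)
  have "integrable lborel (\<lambda>x. q x * F (norm x)) \<longleftrightarrow> integrable (distr (density lborel q) borel norm) F"
    using q_nonneg by (subst integrable_distr_eq) (auto simp: integrable_density)
  also have "\<dots> \<longleftrightarrow> integrable lborel (\<lambda>r. polar_const * (indicator {0..} r * r ^ (DIM('a) - 1)) * F r)"
    unfolding distr_polar using nn by (subst integrable_density) auto
  finally show ?thesis1 .
  have "(LINT x|lborel. q x * F (norm x)) = (LINT r|distr (density lborel q) borel norm. F r)"
    using q_nonneg by (subst integral_distr) (auto simp: integral_density)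
  also have "\<dots> = (LINT r|lborel. polar_const * (indicator {0..} r * r ^ (DIM('a) - 1)) * F r)"
    unfolding distr_polar using nn by (subst integral_density) auto
  finally show ?thesis2 .
qed

end

section \<open>Integrability of powers of the norm\<close>

lemma has_bochner_integral_powr_from_0:
  assumes "e > -1" "c \<ge> 0"
  shows "has_bochner_integral lborel (\<lambda>r::real. indicator {0..c} r * r powr e) (c powr (e + 1) / (e + 1))"
proof (rule has_bochner_integral_nn_integral)
  show "(\<integral>\<^sup>+r. ennreal (indicator {0..c} r * r powr e) \<partial>lborel) = ennreal (c powr (e + 1) / (e + 1))"
    by (intro nn_integral_has_integral_lebesgue has_integral_powr_from_0 assms) auto
qed (use assms in auto)

lemma integrable_powr_to_inf:
  assumes "e < -1" "c > 0"
  shows "integrable lborel (\<lambda>r::real. indicator {c..} r * r powr e)"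
proof -
  have "(\<integral>\<^sup>+r. ennreal (indicator {c..} r * r powr e) \<partial>lborel) = ennreal (- (c powr (e + 1)) / (e + 1))"
    by (intro nn_integral_has_integral_lebesgue has_integral_powr_to_inf assms) auto
  then show ?thesis
    by (intro integrableI_nonneg) auto
qed

lemma powr_pred_mult: "r > 0 \<Longrightarrow> Suc 0 \<le> n \<Longrightarrow> r ^ (n - 1) * r powr p = r powr (real n + p - 1)"
  by (simp add: powr_realpow[symmetric] powr_add[symmetric] of_nat_diff algebra_simps)

lemma integrable_norm_powr_ball:
  assumes "p > - real DIM('a)" "R \<ge> 0"
  shows "integrable lborel (\<lambda>x::'a::euclidean_space. indicator (cball 0 R) x * norm x powr p)"
proof -
  have "integrable lborel (\<lambda>x::'a. 1 * (indicator {0..R} (norm x) * norm x powr p))"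
  proof (subst integrable_polar[where q = "\<lambda>_::'a. 1" and B = 1])
    let ?k = "polar_const (\<lambda>_::'a. 1)"
    have "integrable lborel (\<lambda>r. ?k * (indicator {0..R} r * r powr (real DIM('a) + p - 1)))"
      using has_bochner_integral_powr_from_0[of "real DIM('a) + p - 1" R] assms
      by (auto simp: has_bochner_integral_iff)
    also have "?this \<longleftrightarrow> integrable lborel (\<lambda>r. ?k * (indicator {0..} r * r ^ (DIM('a)
        - 1)) * (indicator {0..R} r * r powr p))"
      by (intro integrable_cong_AE AE_punctured)
        (auto simp: indicator_def DIM_positive Suc_leI powr_pred_mult[OF _ DIM_ge_Suc0, symmetric])
    finally show "integrable lborel (\<lambda>r. ?k * (indicator {0..} r * r ^ (DIM('a)
        - 1)) * (indicator {0..R} r * r powr p))" .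
  qed auto
  then show ?thesis by (simp add: indicator_def)
qed

lemma integrable_norm_powr_outside:
  assumes "p < - real DIM('a)" "R > 0"
  shows "integrable lborel (\<lambda>x::'a::euclidean_space. indicator (- cball 0 R) x * norm x powr p)"
proof (rule Bochner_Integration.integrable_bound)
  show "integrable lborel (\<lambda>x::'a. 1 * (indicator {R..} (norm x) * norm x powr p))"
  proof (subst integrable_polar[where q = "\<lambda>_::'a. 1" and B = 1])
    let ?k = "polar_const (\<lambda>_::'a. 1)"
    have "integrable lborel (\<lambda>r. ?k * (indicator {R..} r * r powr (real DIM('a) + p - 1)))"
      using integrable_powr_to_inf[of "real DIM('a) + p - 1" R] assms by auto
    also have "?this \<longleftrightarrow> integrable lborel (\<lambda>r. ?k * (indicator {0..} r * r ^ (DIM('a)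
        - 1)) * (indicator {R..} r * r powr p))"
      using assms by (intro integrable_cong_AE AE_punctured)
        (auto simp: indicator_def powr_pred_mult[OF _ DIM_ge_Suc0, symmetric])
    finally show "integrable lborel (\<lambda>r. ?k * (indicator {0..} r * r ^ (DIM('a)
        - 1)) * (indicator {R..} r * r powr p))" .
  qed auto
qed (auto simp: indicator_def)

section \<open>From annular functions to test functions\<close>

lemma euler_real: "euler h (t::real) = t * partial_deriv 1 h t"
  by (simp add: euler_def)

text \<open>The Euler field commutes with dilations, so no factor \<open>c\<close> appears. This is
  why bounds on cutoffs can be uniform in the scale.\<close>

lemma euler_scaled_norm:
  fixes x :: "'a::euclidean_space"
  assumes h: "smooth_on {0<..} h" and c: "0 < c" and x: "x \<noteq> 0"
  shows "euler (\<lambda>x. h (c * norm x)) x = euler h (c * norm x)"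
proof -
  have sm: "smooth_on (-{0}) (norm :: 'a \<Rightarrow> real)" by (rule radial_smooth[OF radial_norm])
  have "euler (\<lambda>x. norm x) x = norm x" using euler_norm_powr[OF x, of 1] by simp
  then have "euler (\<lambda>x. c * norm x) x = c * norm x"
    using euler_cmult[OF open_punctured sm, of x c] x by simp
  moreover have "smooth_on (-{0}) (\<lambda>x::'a. c * norm x)"
    by (intro smooth_on_mult smooth_on_const open_punctured sm)
  ultimately show ?thesis
    using euler_compose[OF _ h open_greaterThan _ x, of "\<lambda>x. c * norm x"] c x by (simp add: euler_real)
qed

lemma bounded_if_supported_1_2:
  fixes k :: "real \<Rightarrow> real"
  assumes "continuous_on {0<..} k" "\<And>r. 0 < r \<Longrightarrow> r < 1 \<Longrightarrow> k r = 0" "\<And>r. 2 < r \<Longrightarrow> k r = 0"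
  shows "\<exists>M. \<forall>r>0. \<bar>k r\<bar> \<le> M"
proof -
  have "compact (k ` {1..2})"
    by (intro compact_continuous_image continuous_on_subset[OF assms(1)]) auto
  then obtain M where "\<forall>y \<in> k ` {1..2}. norm y \<le> M"
    using compact_imp_bounded bounded_iff by metis
  then have M: "\<And>r. 1 \<le> r \<Longrightarrow> r \<le> 2 \<Longrightarrow> \<bar>k r\<bar> \<le> M" by auto
  have "\<bar>k r\<bar> \<le> max M 0" if "0 < r" for r
    using M[of r] assms(2,3)[of r] that by (cases "r < 1"; cases "2 < r") auto
  then show ?thesis by blast
qed

lemma cutoff_euler_eq_0:
  assumes g: "cutoff g" and r: "r \<in> {0<..<1} \<union> {2<..}"
  shows "euler g r = 0" "euler (euler g) r = 0"
proof -
  have z: "euler g r = 0" if r: "r \<in> {0<..<1} \<union> {2<..}" for r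
  proof (cases "r \<in> {2<..}")
    case True
    then show ?thesis
      using euler_cong[of "{2<..}" r g "\<lambda>_. 0"] cutoff_eq(2)[OF g] by (simp add: euler_def)
  next
    case False
    then show ?thesis
      using r euler_cong[of "{0<..<1}" r g "\<lambda>_. 1"] cutoff_eq(1)[OF g] by (simp add: euler_def)
  qed
  show "euler g r = 0" using z r .
  have "euler (euler g) r = euler (\<lambda>_. 0) r"
    using r z by (intro euler_cong[of "{0<..<1} \<union> {2<..}"]) auto
  then show "euler (euler g) r = 0" by (simp add: euler_def[of "\<lambda>_. 0"])
qed

lemma cutoff_euler_bound:
  assumes g: "cutoff g"
  obtains M where "\<And>r. 0 < r \<Longrightarrow> \<bar>euler g r\<bar> \<le> M" "\<And>r. 0 < r \<Longrightarrow> \<bar>euler (euler g) r\<bar> \<le> M" "0 \<le> M"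
proof -
  note sg = smooth_on_cutoff[OF g] smooth_on_euler[OF open_greaterThan smooth_on_cutoff[OF g]]
  obtain M1 where M1: "\<forall>r>0. \<bar>euler g r\<bar> \<le> M1"
    using bounded_if_supported_1_2[of "euler g"] smooth_on_imp_continuous_on[OF sg(2)]
      cutoff_euler_eq_0(1)[OF g] by auto
  obtain M2 where M2: "\<forall>r>0. \<bar>euler (euler g) r\<bar> \<le> M2"
    using bounded_if_supported_1_2[of "euler (euler g)"]
      smooth_on_imp_continuous_on[OF smooth_on_euler[OF open_greaterThan sg(2)]]
      cutoff_euler_eq_0(2)[OF g] by auto
  have "0 \<le> max M1 M2" using M1[rule_format, of 1] by auto
  then show thesis using M1 M2 by (intro that[of "max M1 M2"]) (auto simp: le_max_iff_disj)
qed

text \<open>Vanishes for \<open>|x| \<le> 1 / s\<close> and for \<open>|x| \<ge> 2 / t\<close>, and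
  is 1 for \<open>2 / s \<le> |x| \<le> 1 / t\<close>. There are two scales because \<open>s\<close>
  is sent to infinity and \<open>t\<close> to 0.\<close>

definition ann_cut :: "(real \<Rightarrow> real) \<Rightarrow> real \<Rightarrow> real \<Rightarrow> 'a::euclidean_space \<Rightarrow> real" where
  "ann_cut g s t x = (1 - g (s * norm x)) * g (t * norm x)"

lemma radial_ann_cut: "cutoff g \<Longrightarrow> 0 < s \<Longrightarrow> 0 < t \<Longrightarrow> radial (ann_cut g s t)"
  unfolding ann_cut_def[abs_def] by (intro radial_mult radial_one_minus radial_cutoff)

lemma annular_ann_cut:
  assumes g: "cutoff g" and st: "0 < s" "0 < t"
  shows "annular (ann_cut g s t)"
proof -
  have "ann_cut g s t x = 0" if "norm x < 1 / s \<or> 2 / t < norm x" for x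
    using that st cutoff_eq(1)[OF g, of "s * norm x"] cutoff_eq(2)[OF g, of "t * norm x"]
    by (auto simp: ann_cut_def field_simps)
  then show ?thesis using st unfolding annular_def by (intro exI[of _ "1 / s"]) auto
qed

text \<open>Scale invariance of the Euler field makes \<open>M\<close> independent of
  \<open>s\<close> and \<open>t\<close>. On a radial function \<open>|x|^2 laplacian\<close> acts as
  \<open>E^2 + (N - 2) E\<close>, so the Laplacian is controlled by the same two
  derivatives.\<close>

lemma ann_cut_bounds:
  assumes g: "cutoff g"
  obtains M where "1 \<le> M"
    "\<And>s t x. 0 < s \<Longrightarrow> 0 < t \<Longrightarrow> (x::'a::euclidean_space) \<noteq> 0 \<Longrightarrow> \<bar>ann_cut g s t x\<bar> \<le> 1"
    "\<And>s t x. 0 < s \<Longrightarrow> 0 < t \<Longrightarrow> (x::'a) \<noteq> 0 \<Longrightarrow> \<bar>euler (ann_cut g s t) x\<bar> \<le> M"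
    "\<And>s t x. 0 < s \<Longrightarrow> 0 < t \<Longrightarrow> (x::'a) \<noteq> 0 \<Longrightarrow> \<bar>(norm x)\<^sup>2 * laplacian (ann_cut g s t) x\<bar> \<le> M"
proof -
  obtain M where M: "\<And>r. 0 < r \<Longrightarrow> \<bar>euler g r\<bar> \<le> M" "\<And>r. 0 < r \<Longrightarrow> \<bar>euler (euler g) r\<bar> \<le> M" "0 \<le> M"
    using cutoff_euler_bound[OF g] by blast
  \<comment> \<open>The first bracket bounds the second Euler derivative of the product,
    \<open>2 * M\<close> the first one, \<open>N + 2\<close> bounds \<open>|N - 2|\<close>, and the
    final 1 ensures \<open>1 \<le> M'\<close>.\<close>
  define M' where "M' = (2 * M + 2 * M\<^sup>2) + (real DIM('a) + 2) * (2 * M) + 1"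
  note S = open_punctured[where 'a='a]
  have *: "\<bar>ann_cut g s t x\<bar> \<le> 1 \<and> \<bar>euler (ann_cut g s t) x\<bar> \<le> M'
      \<and> \<bar>(norm x)\<^sup>2 * laplacian (ann_cut g s t) x\<bar> \<le> M'"
    if st: "0 < s" "0 < t" and x: "x \<noteq> 0" for s t and x :: 'a
  proof -
    define A where "A x = 1 - g (s * norm x)" for x :: 'a
    define B where "B x = g (t * norm x)" for x :: 'a
    have AB: "smooth_on (-{0}) A" "smooth_on (-{0}) B"
      unfolding A_def[abs_def] B_def[abs_def]
      by (intro radial_smooth radial_one_minus radial_cutoff g st)+
    have eA: "euler A y = - euler g (s * norm y)" if "y \<noteq> 0" for y
      using euler_diff[OF S smooth_on_const[OF S, of 1] radial_smooth[OF radial_cutoff[OF g st(1)]], of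
          y] that
        euler_scaled_norm[OF smooth_on_cutoff[OF g] st(1) that]
            by (simp add: A_def[abs_def] euler_def[of "\<lambda>_. 1"])
    have eB: "euler B y = euler g (t * norm y)" if "y \<noteq> 0" for y
      using euler_scaled_norm[OF smooth_on_cutoff[OF g] st(2) that] by (simp add: B_def[abs_def])
    have eg: "smooth_on {0<..} (euler g)" by (intro smooth_on_euler smooth_on_cutoff g open_greaterThan)
    have eeB: "euler (euler B) x = euler (euler g) (t * norm x)"
    proof -
      have "euler (euler B) x = euler (\<lambda>x. euler g (t * norm x)) x"
        using eB x by (intro euler_cong[OF S]) auto
      then show ?thesis using euler_scaled_norm[OF eg st(2) x] by simp
    qed
    have egs: "smooth_on {0<..} (\<lambda>r. euler g (s * r))"
      by (rule smooth_on_compose[OF open_greaterThan open_greaterThan eg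
          smooth_on_cmult_real[OF open_greaterThan]]) (use st in auto)
    have eeA: "euler (euler A) x = - euler (euler g) (s * norm x)"
    proof -
      have "euler (euler A) x = euler (\<lambda>x. -1 * euler g (s * norm x)) x"
        using eA x by (intro euler_cong[OF S]) auto
      also have "\<dots> = -1 * euler (\<lambda>x. euler g (s * norm x)) x"
        using x by (intro euler_cmult[OF S] radial_smooth radial_compose[OF radial_norm egs]) auto
      finally show ?thesis using euler_scaled_norm[OF eg st(1) x] by simp
    qed
    have pos: "0 < s * norm x" "0 < t * norm x" using st x by auto
    have bA: "\<bar>A x\<bar> \<le> 1" "\<bar>B x\<bar> \<le> 1" "\<bar>euler A x\<bar> \<le> M" "\<bar>euler B x\<bar> \<le> M"
      "\<bar>euler (euler A) x\<bar> \<le> M" "\<bar>euler (euler B) x\<bar> \<le> M"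
      using M(1,2)[OF pos(1)] M(1,2)[OF pos(2)] eA[OF x] eB[OF x] eeA eeB
        cutoff_eq(3,4)[OF g, of "s * norm x"] cutoff_eq(3,4)[OF g, of "t * norm x"] pos
      by (auto simp: A_def B_def)
    have eq: "ann_cut g s t = (\<lambda>x. A x * B x)" by (auto simp: ann_cut_def A_def B_def)
    have G0: "\<bar>ann_cut g s t x\<bar> \<le> 1" using bA by (simp add: eq abs_mult mult_le_one)
    have "\<bar>euler (ann_cut g s t) x\<bar> \<le> \<bar>A x * euler B x\<bar> + \<bar>euler A x * B x\<bar>"
      using euler_mult[OF S AB, of x] x abs_triangle_ineq by (simp add: eq)
    also have "\<dots> \<le> 1 * M + M * 1"
      unfolding abs_mult using bA M(3) by (intro add_mono mult_mono) auto
    finally have G1: "\<bar>euler (ann_cut g s t) x\<bar> \<le> 2 * M" by simp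
    have "\<bar>euler (euler (ann_cut g s t)) x\<bar> \<le> \<bar>A x * euler (euler B) x\<bar> + \<bar>2 * (euler A x * euler B x)\<bar>
        + \<bar>euler (euler A) x * B x\<bar>"
      using euler_euler_mult[OF S AB, of x] x by (simp add: eq)
    also have "\<dots> \<le> 1 * M + 2 * (M * M) + M * 1"
      unfolding abs_mult abs_numeral using bA M(3) by (intro add_mono mult_mono mult_left_mono) auto
    finally have G2: "\<bar>euler (euler (ann_cut g s t)) x\<bar> \<le> 2 * M + 2 * M\<^sup>2" by (simp add: power2_eq_square)
    have "(norm x)\<^sup>2 * laplacian (ann_cut g s t) x
      = euler (euler (ann_cut g s t)) x + (real DIM('a) - 2) * euler (ann_cut g s t) x"
      using ang_laplacian_radial[OF radial_ann_cut[OF g st] x] by (simp add: ang_laplacian_def)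
    also have "\<bar>\<dots>\<bar> \<le> \<bar>euler (euler (ann_cut g s t)) x\<bar> + \<bar>(real DIM('a) - 2) * euler (ann_cut g s t) x\<bar>"
      by (rule abs_triangle_ineq)
    also have "\<dots> \<le> (2 * M + 2 * M\<^sup>2) + (real DIM('a) + 2) * (2 * M)"
      unfolding abs_mult using G1 G2 by (intro add_mono mult_mono) auto
    finally have G3: "\<bar>(norm x)\<^sup>2 * laplacian (ann_cut g s t) x\<bar> \<le> M'" by (simp add: M'_def)
    have "2 * M \<le> M'" using M(3) mult_nonneg_nonneg[of "real DIM('a) + 1" "2 * M"]
      by (simp add: M'_def algebra_simps)
    then show ?thesis using G0 G1 G3 by auto
  qed
  have "1 \<le> M'" using M(3) by (simp add: M'_def)
  then show thesis using * by (intro that[of M']) auto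
qed

section \<open>Test functions near the origin and their approximation by annular functions\<close>

lemma test_functionD:
  assumes "u \<in> test_functions"
  shows "smooth_on UNIV u" "bounded_support u"
proof -
  show "smooth_on UNIV u" using assms by (simp add: test_functions_def)
  have "bounded {x. u x \<noteq> 0}"
    using assms by (intro bounded_subset[OF compact_imp_bounded closure_subset]) (simp add:
        test_functions_def)
  then obtain R where "\<And>x. u x \<noteq> 0 \<Longrightarrow> norm x \<le> R" unfolding bounded_iff by auto
  then show "bounded_support u" unfolding bounded_support_def by (metis not_le)
qed

text \<open>The Euler derivative, \<open>|x|^2 laplacian u\<close> and \<open>u - u 0\<close> are
  all of order \<open>|x|\<close>. Squared and weighted by \<open>|x| powr (m - 4)\<close> this is
  \<open>|x| powr (m - 2)\<close>, integrable at the origin precisely for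
  \<open>m > 2 - N\<close>.\<close>

lemma test_function_bounds:
  fixes u :: "'a::euclidean_space \<Rightarrow> real"
  assumes "u \<in> test_functions"
  obtains K R where "0 < R" "0 \<le> K" "\<And>x. \<bar>euler u x\<bar> \<le> K * norm x" "\<And>x. \<bar>(norm x)\<^sup>2 * laplacian u x\<bar>
      \<le> K * norm x"
    "\<And>x. \<bar>u x\<bar> \<le> K" "\<And>x. \<bar>u x - u 0\<bar> \<le> K * norm x"
    "\<And>x. R < norm x \<Longrightarrow> u x = 0 \<and> euler u x = 0 \<and> laplacian u x = 0"
proof -
  note u = test_functionD[OF assms]
  have cont: "smooth_on UNIV f \<Longrightarrow> continuous_on UNIV f" for f :: "'a \<Rightarrow> real"
    by (rule smooth_on_imp_continuous_on)
  obtain K0 where K0: "\<And>x. \<bar>u x\<bar> \<le> K0" using bounded_support_bounded[OF cont[OF u(1)] u(2)] by blast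
  have "\<forall>i\<in>Basis. \<exists>P. \<forall>x. \<bar>partial_deriv i u x\<bar> \<le> P"
    using bounded_support_bounded[OF cont[OF smooth_on_partial_deriv[OF open_UNIV u(1)]]
        bounded_support_partial_deriv[OF u(2)]]
    by metis
  then obtain P where P: "\<And>i x. i \<in> Basis \<Longrightarrow> \<bar>partial_deriv i u x\<bar> \<le> P i" by metis
  obtain R0 where R0: "\<And>x. R0 < norm x \<Longrightarrow> u x = 0" using u(2) unfolding bounded_support_def by blast
  define R where "R = max R0 1"
  have R: "0 < R" "\<And>x. R < norm x \<Longrightarrow> u x = 0" using R0 by (auto simp: R_def)
  have R': "u x = 0 \<and> euler u x = 0 \<and> laplacian u x = 0" if x: "R < norm x" for x
  proof -
    have O: "open {y. R < norm (y::'a)}" "x \<in> {y. R < norm (y::'a)}" using x open_norm_greater by auto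
    have "euler u x = euler (\<lambda>_. 0) x" using R(2) by (intro euler_cong[OF O]) auto
    moreover have "laplacian u x = laplacian (\<lambda>_. 0) x" using R(2) by (intro laplacian_cong[OF O]) auto
    ultimately show ?thesis using R(2)[OF x] by (simp add: euler_def laplacian_def partial_deriv_def[of
        _ "\<lambda>_. 0", abs_def])
  qed
  have "bounded_support (laplacian u)" using R' unfolding bounded_support_def by blast
  then obtain L where L: "\<And>x. \<bar>laplacian u x\<bar> \<le> L" "0 \<le> L"
    using bounded_support_bounded[OF cont[OF smooth_on_laplacian[OF open_UNIV u(1)]]] by blast
  define Q where "Q = (\<Sum>i\<in>Basis. P i)"
  have lin: "\<bar>\<Sum>i\<in>Basis. (x \<bullet> i) * partial_deriv i u y\<bar> \<le> Q * norm x" for x y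
  proof -
    have "\<bar>\<Sum>i\<in>Basis. (x \<bullet> i) * partial_deriv i u y\<bar> \<le> (\<Sum>i\<in>Basis. \<bar>(x \<bullet> i) * partial_deriv i u y\<bar>)"
      by (rule sum_abs)
    also have "\<dots> \<le> (\<Sum>i\<in>Basis. norm x * P i)"
      unfolding abs_mult using P Basis_le_norm by (intro sum_mono mult_mono) auto
    finally show ?thesis by (simp add: Q_def sum_distrib_left mult.commute sum_distrib_right)
  qed
  have E: "\<bar>euler u x\<bar> \<le> Q * norm x" for x using lin[of x x] by (simp add: euler_def)
  have D: "\<bar>u x - u 0\<bar> \<le> Q * norm x" for x
  proof -
    have "\<exists>z. 0 < z \<and> z < 1 \<and> u (0 + 1 *\<^sub>R x) - u (0 + 0 *\<^sub>R x) = (1 - 0) * partial_deriv x u (0 + z *\<^sub>R x)"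
      by (intro MVT2 has_field_derivative_along_line[OF u(1)]) auto
    then obtain z where "u x - u 0 = frechet_derivative u (at (z *\<^sub>R x)) x"
        by (auto simp: partial_deriv_def)
    then show ?thesis using lin[of x "z *\<^sub>R x"] frechet_derivative_eq_sum[OF u(1), of "z *\<^sub>R x" x] by simp
  qed
  have Lap: "\<bar>(norm x)\<^sup>2 * laplacian u x\<bar> \<le> (R * L) * norm x" for x
  proof (cases "R < norm x")
    case False
    then have "norm x * \<bar>laplacian u x\<bar> \<le> R * L" using L R(1) by (intro mult_mono) auto
    from mult_right_mono[OF this norm_ge_zero[of x]] show ?thesis
      by (simp add: abs_mult power2_eq_square mult_ac)
  qed (use R'[of x] L R(1) in auto)
  define K where "K = max K0 (max Q (R * L))"
  have K: "K0 \<le> K" "Q \<le> K" "R * L \<le> K" by (auto simp: K_def)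
  have up: "y \<le> K * norm x" if "y \<le> Q' * norm x" "Q' \<le> K" for y Q' and x :: 'a
    using that mult_right_mono[OF that(2) norm_ge_zero[of x]] by simp
  show thesis
  proof (rule that[OF R(1)])
    show "0 \<le> K" using K(1) K0[of 0] by (auto intro: order_trans[OF abs_ge_zero])
    show "\<bar>u x\<bar> \<le> K" for x using K0[of x] K(1) by simp
  qed (use R' up[OF E K(2)] up[OF D K(2)] up[OF Lap K(3)] in auto)
qed

lemma integrable_powr_bound:
  fixes F :: "'a::euclidean_space \<Rightarrow> real"
  assumes "F \<in> borel_measurable borel" "0 < R" "p > - real DIM('a)" "q < - real DIM('a)"
    and "\<And>x. x \<noteq> 0 \<Longrightarrow> norm x \<le> R \<Longrightarrow> \<bar>F x\<bar> \<le> K * norm x powr p"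
    and "\<And>x. x \<noteq> 0 \<Longrightarrow> R < norm x \<Longrightarrow> \<bar>F x\<bar> \<le> K * norm x powr q"
  shows "integrable lborel F"
proof (rule Bochner_Integration.integrable_bound)
  show "integrable lborel (\<lambda>x::'a. K * (indicator (cball 0 R) x * norm x powr p)
      + K * (indicator (- cball 0 R) x * norm x powr q))"
    using assms by (intro Bochner_Integration.integrable_add integrable_mult_right
        integrable_norm_powr_ball integrable_norm_powr_outside) auto
  show "AE x in lborel. norm (F x) \<le> norm (K * (indicator (cball 0 R) x * norm x powr p)
      + K * (indicator (- cball 0 R) x * norm x powr q))"
    using assms(5,6) by (intro AE_punctured) (force simp: indicator_def)
qed (use assms in auto)

lemma laplacian_radial_mult:
  fixes x :: "'a::euclidean_space"
  assumes r: "radial r" and f: "smooth_on (-{0}) f" and x: "x \<noteq> 0"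
  shows "(norm x)\<^sup>2 * laplacian (\<lambda>x. r x * f x) x =
    r x * ((norm x)\<^sup>2 * laplacian f x) + 2 * (euler r x * euler f x) + ((norm x)\<^sup>2 * laplacian r x) * f x"
proof -
  have "(norm x)\<^sup>2 * (\<Sum>i\<in>Basis. partial_deriv i r x * partial_deriv i f x) = euler r x * euler f x"
    using ang_form_radial[OF r x, of f] by (simp add: ang_form_def)
  then show ?thesis
    using laplacian_mult[OF open_punctured radial_smooth[OF r] f, of x] x by (simp add: algebra_simps)
qed

lemma borel_measurable_smooth: "smooth_on UNIV f \<Longrightarrow> f \<in> borel_measurable borel"
  by (intro borel_measurable_continuous_onI smooth_on_imp_continuous_on)

lemma
  assumes "smooth_on UNIV u"
  shows borel_measurable_rellich: "rellich_integrand m u \<in> borel_measurable borel"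
    and borel_measurable_hardy: "hardy_integrand m u \<in> borel_measurable borel"
  using borel_measurable_smooth[OF smooth_on_laplacian[OF open_UNIV assms]]
    borel_measurable_smooth[OF smooth_on_euler[OF open_UNIV assms]]
  unfolding rellich_integrand_eq[abs_def] hardy_integrand_eq[abs_def] by measurable

text \<open>The annular inequality is applied to cut-off functions and the cutoffs recede. Their
  Euler derivatives stay bounded without becoming uniformly small, so dominated convergence asks for
  \<open>|x| powr (m - 4) * (v x)\<^sup>2\<close> to be integrable, where \<open>v\<close> is the
  function that is cut off.\<close>

lemma rellich_hardy_test_function:
  fixes u :: "'a::euclidean_space \<Rightarrow> real" and m a b C :: real
  assumes g: "cutoff g" and u: "u \<in> test_functions" and m: "m > 2 - real DIM('a)"
    and a: "a = (real DIM('a) + m - 4) / 2" "a \<noteq> 0" and b: "b = (real DIM('a) - m) / 2"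
    and C: "C \<le> b\<^sup>2" "\<And>k. k = 0 \<or> 2 \<le> DIM('a) \<Longrightarrow> C * a\<^sup>2 \<le> (sphere_eigenvalue DIM('a) k + a * b)\<^sup>2"
  shows "C * (LINT x|lborel. hardy_integrand m u x) \<le> (LINT x|lborel. rellich_integrand m u x)"
proof -
  note S = open_punctured[where 'a='a]
  note us = test_functionD(1)[OF u]
  obtain K R where R: "0 < R" and K: "0 \<le> K"
    and Eu: "\<And>x. \<bar>euler u x\<bar> \<le> K * norm x" and Lu: "\<And>x. \<bar>(norm x)\<^sup>2 * laplacian u x\<bar> \<le> K * norm x"
    and u_le: "\<And>x. \<bar>u x\<bar> \<le> K" and u_diff: "\<And>x. \<bar>u x - u 0\<bar> \<le> K * norm x"
    and out: "\<And>x. R < norm x \<Longrightarrow> u x = 0 \<and> euler u x = 0 \<and> laplacian u x = 0"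
    by (rule test_function_bounds[OF u], rule that)
  obtain M where M: "1 \<le> M"
    and G0: "\<And>s t x. 0 < s \<Longrightarrow> 0 < t \<Longrightarrow> (x::'a) \<noteq> 0 \<Longrightarrow> \<bar>ann_cut g s t x\<bar> \<le> 1"
    and G1: "\<And>s t x. 0 < s \<Longrightarrow> 0 < t \<Longrightarrow> (x::'a) \<noteq> 0 \<Longrightarrow> \<bar>euler (ann_cut g s t) x\<bar> \<le> M"
    and G2: "\<And>s t x. 0 < s \<Longrightarrow> 0 < t \<Longrightarrow> (x::'a) \<noteq> 0 \<Longrightarrow> \<bar>(norm x)\<^sup>2 * laplacian (ann_cut g s t) x\<bar> \<le> M"
    by (rule ann_cut_bounds[OF g, where 'a='a], rule that)
  \<comment> \<open>For \<open>a > 0\<close> the weight is integrable at the origin, and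
    \<open>u\<close> has bounded support. For \<open>a < 0\<close> it is integrable at infinity, and
    subtracting \<open>u 0\<close> makes \<open>v\<close> of order \<open>|x|\<close> at the origin
    without changing the derivatives.\<close>
  define \<kappa> where "\<kappa> = (if a < 0 then u 0 else 0)"
  define v where "v x = u x - \<kappa>" for x
  have pv: "partial_deriv i v = partial_deriv i u" for i
    using partial_deriv_diff[OF us smooth_on_const[OF open_UNIV] open_UNIV, of _ i \<kappa>]
        by (auto simp: v_def[abs_def])
  have Ev: "euler v = euler u" and Lv: "laplacian v = laplacian u"
    by (auto simp: euler_def[abs_def] laplacian_def[abs_def] pv)
  have vs: "smooth_on UNIV v" unfolding v_def[abs_def]
      by (intro smooth_on_diff us smooth_on_const open_UNIV)
  then have vs': "smooth_on (-{0}) v" by (rule smooth_on_subset) auto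
  define G :: "nat \<Rightarrow> 'a \<Rightarrow> real" where "G n = ann_cut g (real (Suc n)) (1 / real (Suc n))" for n
  have G: "radial (G n :: 'a \<Rightarrow> real)" "annular (G n :: 'a \<Rightarrow> real)" for n
    unfolding G_def by (intro radial_ann_cut annular_ann_cut g; simp)+
  define U where "U n x = G n x * v x" for n x
  have U: "smooth_on (-{0}) (U n)" "annular (U n)" for n
    unfolding U_def[abs_def] by (intro smooth_on_mult radial_smooth G vs' S annular_mult_left)+
  have U': "smooth_on UNIV (U n)" for n by (rule smooth_on_annular[OF U])
  \<comment> \<open>Three terms of the product rule for \<open>G n * v\<close>, squared with the
    factor 3 of \<open>(p + q + r)\<^sup>2 \<le> 3 * (p\<^sup>2 + q\<^sup>2 + r\<^sup>2)\<close>;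
    the 4 is the square of the 2 in the mixed term. The same function dominates the Hardy
    integrand.\<close>
  define dom where "dom x = norm x powr (m - 4) * (3 * (((norm x)\<^sup>2 * laplacian u x)\<^sup>2
      + 4 * M\<^sup>2 * (euler u x)\<^sup>2 + M\<^sup>2 * (v x)\<^sup>2))" for x
  have dom_int: "integrable lborel dom"
  proof -
    have [measurable]: "euler u \<in> borel_measurable borel" "laplacian u \<in> borel_measurable borel"
        "v \<in> borel_measurable borel"
      "u \<in> borel_measurable borel"
      using borel_measurable_smooth vs us smooth_on_euler[OF open_UNIV us] smooth_on_laplacian[OF
          open_UNIV us] by blast+
    have sq: "norm x powr (m - 4) * y\<^sup>2 \<le> K\<^sup>2 * norm x powr (m - 2)" if "\<bar>y\<bar>
        \<le> K * norm x" "x \<noteq> 0" for x :: 'a and y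
    proof -
      have "y\<^sup>2 \<le> (K * norm x)\<^sup>2" using that(1) by (metis abs_ge_zero power2_abs power_mono)
      then have "norm x powr (m - 4) * y\<^sup>2 \<le> norm x powr (m - 4) * (K * norm x)\<^sup>2"
          by (intro mult_left_mono) auto
      also have "\<dots> = K\<^sup>2 * ((norm x)\<^sup>2 * norm x powr ((m - 2) - 2))" by (simp add: power_mult_distrib)
      also have "\<dots> = K\<^sup>2 * norm x powr (m - 2)" using norm_powr_minus_2[OF that(2), of "m - 2"] by simp
      finally show ?thesis .
    qed
    have 1: "integrable lborel (\<lambda>x. norm x powr (m - 4) * ((norm x)\<^sup>2 * laplacian u x)\<^sup>2)"
      by (rule integrable_powr_bound[where R = R and p = "m - 2" and q = "- real DIM('a) - 1" and K
          = "K\<^sup>2"])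
        (use R m sq[OF Lu] out in \<open>auto simp: abs_mult\<close>)
    have 2: "integrable lborel (\<lambda>x. norm x powr (m - 4) * (euler u x)\<^sup>2)"
      by (rule integrable_powr_bound[where R = R and p = "m - 2" and q = "- real DIM('a) - 1" and K
          = "K\<^sup>2"])
        (use R m sq[OF Eu] out in \<open>auto simp: abs_mult\<close>)
    have 3: "integrable lborel (\<lambda>x. norm x powr (m - 4) * (v x)\<^sup>2)"
    proof (cases "a < 0")
      case True
      then have v: "v x = u x - u 0" for x by (simp add: v_def \<kappa>_def)
      have far: "norm x powr (m - 4) * (v x)\<^sup>2 \<le> K\<^sup>2 * norm x powr (m - 4)" if "R < norm x" for x
        using out[OF that] u_le[of 0] power_mono[OF u_le[of 0] abs_ge_zero, of 2]
        by (simp add: v mult.commute mult_right_mono)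
      show ?thesis
        by (rule integrable_powr_bound[where R = R and p = "m - 2" and q = "m - 4" and K = "K\<^sup>2"])
          (use R m sq[OF u_diff] far True a in \<open>auto simp: abs_mult v\<close>)
    next
      case False
      then have v: "v x = u x" for x by (simp add: v_def \<kappa>_def)
      have near: "norm x powr (m - 4) * (u x)\<^sup>2 \<le> K\<^sup>2 * norm x powr (m - 4)" for x
        using power_mono[OF u_le[of x] abs_ge_zero, of 2] by (simp add: mult.commute mult_right_mono)
      show ?thesis unfolding v
        by (rule integrable_powr_bound[where R = R and p = "m - 4" and q = "- real DIM('a) - 1" and K
            = "K\<^sup>2"])
          (use R m near out False a v in \<open>auto simp: abs_mult\<close>)
    qed
    have "dom = (\<lambda>x. 3 * (norm x powr (m - 4) * ((norm x)\<^sup>2 * laplacian u x)\<^sup>2)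
      + 12 * M\<^sup>2 * (norm x powr (m - 4) * (euler u x)\<^sup>2) + 3 * M\<^sup>2 * (norm x powr (m - 4) * (v x)\<^sup>2))"
      by (auto simp: dom_def algebra_simps)
    then show ?thesis using 1 2 3 by simp
  qed
  have bounds: "\<bar>rellich_integrand m (U n) x\<bar> \<le> dom x
      \<and> \<bar>hardy_integrand m (U n) x\<bar> \<le> dom x" if x: "x \<noteq> 0" for n x
  proof -
    have g0: "\<bar>G n x\<bar> \<le> 1" and g1: "\<bar>euler (G n) x\<bar> \<le> M" and g2: "\<bar>(norm x)\<^sup>2 * laplacian (G n) x\<bar> \<le> M"
      unfolding G_def using x by (intro G0 G1 G2; simp)+
    define P where "P = (norm x)\<^sup>2 * laplacian u x"
    have sq3: "(p + q + r)\<^sup>2 \<le> 3 * (p\<^sup>2 + q\<^sup>2 + r\<^sup>2)" for p q r :: real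
      using sum_squares_ge_zero[of "p - q" "q - r"] zero_le_power2[of "p - r"]
      by (simp add: power2_eq_square algebra_simps)
    have le: "(s * y)\<^sup>2 \<le> T\<^sup>2 * y\<^sup>2" if "\<bar>s\<bar> \<le> T" for s y T :: real
      using that power_mono[OF that abs_ge_zero, of 2] by (simp add: power_mult_distrib mult_right_mono)
    have "((norm x)\<^sup>2 * laplacian (U n) x)\<^sup>2 = (G n x * P + 2 * euler (G n) x * euler u x
        + ((norm x)\<^sup>2 * laplacian (G n) x) * v x)\<^sup>2"
      using laplacian_radial_mult[OF G(1) vs' x] by (simp add: U_def[abs_def] Ev Lv P_def mult.assoc)
    also have "\<dots> \<le> 3 * ((G n x * P)\<^sup>2 + (2 * euler (G n) x * euler u x)\<^sup>2
        + (((norm x)\<^sup>2 * laplacian (G n) x) * v x)\<^sup>2)"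
      by (rule sq3)
    also have "\<dots> \<le> 3 * (1\<^sup>2 * P\<^sup>2 + (2 * M)\<^sup>2 * (euler u x)\<^sup>2 + M\<^sup>2 * (v x)\<^sup>2)"
      using g0 g1 g2 by (intro mult_left_mono add_mono le) auto
    finally have r: "((norm x)\<^sup>2 * laplacian (U n) x)\<^sup>2
        \<le> 3 * (P\<^sup>2 + 4 * M\<^sup>2 * (euler u x)\<^sup>2 + M\<^sup>2 * (v x)\<^sup>2)"
      by (simp add: power_mult_distrib)
    have "(euler (U n) x)\<^sup>2 = (G n x * euler u x + euler (G n) x * v x + 0)\<^sup>2"
      using euler_mult[OF S radial_smooth[OF G(1)] vs', of x n] x by (simp add: U_def[abs_def] Ev)
    also have "\<dots> \<le> 3 * ((G n x * euler u x)\<^sup>2 + (euler (G n) x * v x)\<^sup>2 + 0\<^sup>2)" by (rule sq3)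
    also have "\<dots> \<le> 3 * (1\<^sup>2 * (euler u x)\<^sup>2 + M\<^sup>2 * (v x)\<^sup>2 + 0\<^sup>2)"
      using g0 g1 by (intro mult_left_mono add_mono le) auto
    also have "\<dots> \<le> 3 * (P\<^sup>2 + 4 * M\<^sup>2 * (euler u x)\<^sup>2 + M\<^sup>2 * (v x)\<^sup>2)"
    proof -
      have "1 \<le> 4 * M\<^sup>2" using one_le_power[OF M, of 2] by linarith
      from mult_right_mono[OF this zero_le_power2[of "euler u x"]] show ?thesis
        by simp (use zero_le_power2[of P] in linarith)
    qed
    finally have h: "(euler (U n) x)\<^sup>2 \<le> 3 * (P\<^sup>2 + 4 * M\<^sup>2 * (euler u x)\<^sup>2 + M\<^sup>2 * (v x)\<^sup>2)" .
    show ?thesis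
      using mult_left_mono[OF r, of "norm x powr (m - 4)"] mult_left_mono[OF h, of "norm x powr (m - 4)"]
      by (simp add: rellich_integrand_eq hardy_integrand_eq dom_def P_def abs_mult)
  qed
  have lim: "eventually (\<lambda>n. rellich_integrand m (U n) x = rellich_integrand m u x
      \<and> hardy_integrand m (U n) x = hardy_integrand m u x) sequentially" if x: "x \<noteq> 0" for x
  proof -
    obtain n0 :: nat where n0: "max (2 / norm x) (norm x) < real n0" using reals_Archimedean2 by blast
    have "rellich_integrand m (U n) x = rellich_integrand m u x
        \<and> hardy_integrand m (U n) x = hardy_integrand m u x"
      if "n \<ge> n0" for n
    proof -
      \<comment> \<open>On this open shell both factors of \<open>G n\<close> are 1, so the
        integrands of \<open>U n\<close> and \<open>u\<close> agree at \<open>x\<close> from some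
        \<open>n\<close> on.\<close>
      let ?O = "{y. 2 / real (Suc n) < norm y} \<inter> {y::'a. norm y < real (Suc n)}"
      have "2 / norm x < real (Suc n)" "norm x < real (Suc n)" using n0 that by auto
      then have "x \<in> ?O" using x by (auto simp: field_simps)
      moreover have "open ?O" by (intro open_Int open_norm_less open_norm_greater)
      moreover have "U n y = v y" if "y \<in> ?O" for y
        using that cutoff_eq(1)[OF g, of "norm y / real (Suc n)"] cutoff_eq(2)[OF g, of
            "real (Suc n) * norm y"]
        by (auto simp: U_def G_def ann_cut_def field_simps)
      ultimately have "laplacian (U n) x = laplacian v x" "euler (U n) x = euler v x"
        using laplacian_cong[of ?O x "U n" v] euler_cong[of ?O x "U n" v] by blast+
      then show ?thesis by (simp add: rellich_integrand_eq hardy_integrand_eq Ev Lv)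
    qed
    then show ?thesis unfolding eventually_sequentially by blast
  qed
  have "(\<lambda>n. LINT x|lborel. rellich_integrand m (U n) x) \<longlonglongrightarrow> (LINT x|lborel. rellich_integrand m u x)"
  proof (rule integral_dominated_convergence[OF _ _ dom_int])
    show "AE x in lborel. (\<lambda>n. rellich_integrand m (U n) x) \<longlonglongrightarrow> rellich_integrand m u x"
      by (intro AE_punctured tendsto_eventually, drule lim, erule eventually_mono, simp)
    show "AE x in lborel. norm (rellich_integrand m (U n) x) \<le> dom x" for n
      using bounds by (intro AE_punctured) auto
  qed (use borel_measurable_rellich[OF us] borel_measurable_rellich[OF U'] in auto)
  moreover have "(\<lambda>n. LINT x|lborel. hardy_integrand m (U n) x) \<longlonglongrightarrow> (LINT x|lborel. hardy_integrand m u x)"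
  proof (rule integral_dominated_convergence[OF _ _ dom_int])
    show "AE x in lborel. (\<lambda>n. hardy_integrand m (U n) x) \<longlonglongrightarrow> hardy_integrand m u x"
      by (intro AE_punctured tendsto_eventually, drule lim, erule eventually_mono, simp)
    show "AE x in lborel. norm (hardy_integrand m (U n) x) \<le> dom x" for n
      using bounds by (intro AE_punctured) auto
  qed (use borel_measurable_hardy[OF us] borel_measurable_hardy[OF U'] in auto)
  ultimately show ?thesis
    using rellich_hardy_annular[OF g U a(1) b C]
    by (intro LIMSEQ_le[OF tendsto_mult_left[of _ _ _ C]]) auto
qed

text \<open>At \<open>m = 4 - N\<close> neither \<open>u\<close> nor \<open>u - u 0\<close> can be cut off at both ends; there the inequality is
  the limit of the inequalities for larger \<open>m\<close>.\<close>

lemma rellich_hardy_limit: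
  fixes u :: "'a::euclidean_space \<Rightarrow> real" and m :: real
  assumes u: "u \<in> test_functions" and m: "m > 2 - real DIM('a)"
    and C: "C \<longlonglongrightarrow> C0"
    and ineq: "\<And>n. C n * (LINT x|lborel. hardy_integrand (m + 1 / real (Suc n)) u x)
      \<le> (LINT x|lborel. rellich_integrand (m + 1 / real (Suc n)) u x)"
  shows "C0 * (LINT x|lborel. hardy_integrand m u x) \<le> (LINT x|lborel. rellich_integrand m u x)"
proof -
  note us = test_functionD(1)[OF u]
  obtain K R where R: "0 < R" and K: "0 \<le> K"
    and Eu: "\<And>x. \<bar>euler u x\<bar> \<le> K * norm x" and Lu: "\<And>x. \<bar>(norm x)\<^sup>2 * laplacian u x\<bar> \<le> K * norm x"
    and out: "\<And>x. R < norm x \<Longrightarrow> u x = 0 \<and> euler u x = 0 \<and> laplacian u x = 0"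
    by (rule test_function_bounds[OF u], rule that)
  \<comment> \<open>The exponents \<open>m - 2 + 1 / (n + 1)\<close> lie between
    \<open>m - 2\<close> and \<open>m - 1\<close>; the first power dominates inside the unit ball,
    the second outside.\<close>
  define dom where "dom x = K\<^sup>2 * (indicator (cball 0 R) x * norm x powr (m - 2))
      + K\<^sup>2 * (indicator (cball 0 R) x * norm x powr (m - 1))" for x :: 'a
  have dom_int: "integrable lborel dom"
    unfolding dom_def[abs_def] using m R
    by (intro Bochner_Integration.integrable_add integrable_mult_right integrable_norm_powr_ball) auto
  have main: "norm x powr (m + 1 / real (Suc n) - 4) * y\<^sup>2 \<le> dom x"
    if y: "\<bar>y\<bar> \<le> K * norm x" "R < norm x \<Longrightarrow> y = 0" and x: "x \<noteq> 0" for x :: 'a and y n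
  proof (cases "R < norm x")
    case True
    then show ?thesis using y(2) by (simp add: dom_def indicator_def)
  next
    case False
    have p: "norm x powr (m - 2 + 1 / real (Suc n)) \<le> norm x powr (m - 2) + norm x powr (m - 1)"
    proof (cases "norm x \<le> 1")
      case True
      then have "norm x powr (m - 2 + 1 / real (Suc n))
          \<le> norm x powr (m - 2)" using x by (intro powr_mono') auto
      then show ?thesis using powr_ge_zero[of "norm x" "m - 1"] by linarith
    next
      case False
      then have "norm x powr (m - 2 + 1 / real (Suc n)) \<le> norm x powr (m - 1)" by (intro powr_mono) auto
      then show ?thesis using powr_ge_zero[of "norm x" "m - 2"] by linarith
    qed
    have "y\<^sup>2 \<le> (K * norm x)\<^sup>2" using y(1) by (metis abs_ge_zero power2_abs power_mono)
    then have "norm x powr (m + 1 / real (Suc n) - 4) * y\<^sup>2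
        \<le> norm x powr (m + 1 / real (Suc n) - 4) * (K * norm x)\<^sup>2"
      by (intro mult_left_mono) auto
    also have "\<dots> = K\<^sup>2 * ((norm x)\<^sup>2 * norm x powr ((m - 2 + 1 / real (Suc n)) - 2))"
      by (simp add: power_mult_distrib algebra_simps)
    also have "\<dots> = K\<^sup>2 * norm x powr (m - 2 + 1 / real (Suc n))" by (simp only: norm_powr_minus_2[OF x])
    also have "\<dots> \<le> K\<^sup>2 * (norm x powr (m - 2) + norm x powr (m - 1))"
      using p by (intro mult_left_mono) auto
    finally show ?thesis using False by (simp add: dom_def indicator_def distrib_left)
  qed
  have mlim: "(\<lambda>n. m + 1 / real (Suc n)) \<longlonglongrightarrow> m"
    using tendsto_add[OF tendsto_const LIMSEQ_Suc[OF lim_const_over_n[of 1]], of m] by simp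
  have plim: "(\<lambda>n. norm x powr (m + 1 / real (Suc n) - 4) * y)
      \<longlonglongrightarrow> norm x powr (m - 4) * y" if "x \<noteq> 0" for x :: 'a and y :: real
    using that by (intro tendsto_intros mlim) auto
  have "(\<lambda>n. LINT x|lborel. rellich_integrand (m + 1 / real (Suc n)) u x)
      \<longlonglongrightarrow> (LINT x|lborel. rellich_integrand m u x)"
  proof (rule integral_dominated_convergence[OF _ _ dom_int])
    show "AE x in lborel. (\<lambda>n. rellich_integrand (m + 1 / real (Suc n)) u x) \<longlonglongrightarrow> rellich_integrand m u x"
      unfolding rellich_integrand_eq by (intro AE_punctured plim)
    show "AE x in lborel. norm (rellich_integrand (m + 1 / real (Suc n)) u x) \<le> dom x" for n
      unfolding rellich_integrand_eq using main[OF Lu] out by (intro AE_punctured) (auto simp: abs_mult)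
  qed (use borel_measurable_rellich[OF us] in auto)
  moreover have "(\<lambda>n. LINT x|lborel. hardy_integrand (m + 1 / real (Suc n)) u x)
      \<longlonglongrightarrow> (LINT x|lborel. hardy_integrand m u x)"
  proof (rule integral_dominated_convergence[OF _ _ dom_int])
    show "AE x in lborel. (\<lambda>n. hardy_integrand (m + 1 / real (Suc n)) u x) \<longlonglongrightarrow> hardy_integrand m u x"
      unfolding hardy_integrand_eq by (intro AE_punctured plim)
    show "AE x in lborel. norm (hardy_integrand (m + 1 / real (Suc n)) u x) \<le> dom x" for n
      unfolding hardy_integrand_eq using main[OF Eu] out by (intro AE_punctured) (auto simp: abs_mult)
  qed (use borel_measurable_hardy[OF us] in auto)
  ultimately show ?thesis
    using ineq by (intro LIMSEQ_le[OF tendsto_mult[OF C]]) auto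
qed

section \<open>Spherical eigenfunctions\<close>

text \<open>An eigenfunction of the sphere, extended to be constant along rays. The eigenvalue is a
  free real number, so that given spherical harmonics, rescaled harmonic polynomials and, in every
  dimension, the constant function are treated alike.\<close>

definition sph_eigen :: "real \<Rightarrow> ('a::euclidean_space \<Rightarrow> real) \<Rightarrow> bool" where
  "sph_eigen c Y \<longleftrightarrow> smooth_on (-{0}) Y \<and> (\<forall>x s. x \<noteq> 0 \<longrightarrow> 0 < s \<longrightarrow> Y (s *\<^sub>R x) = Y x) \<and>
     (\<forall>x. x \<noteq> 0 \<longrightarrow> ang_laplacian Y x = - c * Y x) \<and> (\<exists>x. x \<noteq> 0 \<and> Y x \<noteq> 0)"

lemma sph_eigen_const: "sph_eigen 0 (\<lambda>x::'a::euclidean_space. 1)"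
proof -
  obtain i :: 'a where "i \<in> Basis" using nonempty_Basis by blast
  then have "i \<noteq> 0" by auto
  then show ?thesis
    using ang_laplacian_const[OF open_UNIV, of 1] smooth_on_const[OF open_punctured]
    by (auto simp: sph_eigen_def)
qed

lemma euler_homogeneous_0:
  fixes Y :: "'a::euclidean_space \<Rightarrow> real"
  assumes Y: "smooth_on (-{0}) Y" and hom: "\<And>s x. x \<noteq> 0 \<Longrightarrow> 0 < s \<Longrightarrow> Y (s *\<^sub>R x) = Y x" and x: "x \<noteq> 0"
  shows "euler Y x = 0"
proof -
  have 0: "((\<lambda>s. Y (x + s *\<^sub>R x)) has_field_derivative partial_deriv x Y (x + 0 *\<^sub>R x)) (at 0)"
    using x by (intro has_field_derivative_along_line[OF Y]) auto
  have *: "Y x = Y (x + s *\<^sub>R x)" if "s \<in> {-1<..}" for s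
  proof -
    have "Y ((1 + s) *\<^sub>R x) = Y x" using that x by (intro hom) auto
    then show ?thesis by (simp add: algebra_simps)
  qed
  have "((\<lambda>s. Y (x + s *\<^sub>R x)) has_derivative (\<lambda>_. 0)) (at 0)"
    by (rule has_derivative_transform_within_open[of "\<lambda>s. Y x" "\<lambda>_. 0" 0 UNIV "{-1<..}" "\<lambda>s. Y (x
        + s *\<^sub>R x)"])
      (use * in auto)
  then have "((\<lambda>s. Y (x + s *\<^sub>R x)) has_field_derivative 0) (at 0)"
    by (simp add: has_field_derivative_def lambda_zero)
  then have "partial_deriv x Y x = 0" using 0 DERIV_unique by fastforce
  then show ?thesis
    using frechet_derivative_eq_sum[OF Y open_punctured, of x x] x
        by (simp add: partial_deriv_def euler_def)
qed

lemma partial_deriv_scale: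
  fixes f :: "'a::euclidean_space \<Rightarrow> real"
  assumes f: "smooth_on S f" "open S" "c *\<^sub>R x \<in> S"
  shows "partial_deriv i (\<lambda>x. f (c *\<^sub>R x)) x = c * partial_deriv i f (c *\<^sub>R x)"
proof -
  have "((\<lambda>x. c *\<^sub>R x) has_derivative (\<lambda>v. c *\<^sub>R v)) (at x)"
    by (auto intro!: derivative_eq_intros)
  from has_derivative_compose[OF this smooth_on_has_derivative[OF f]]
  have "partial_deriv i (\<lambda>x. f (c *\<^sub>R x)) x = frechet_derivative f (at (c *\<^sub>R x)) (c *\<^sub>R i)"
    by (rule partial_deriv_eqI)
  then show ?thesis
    using has_derivative_linear[OF smooth_on_has_derivative[OF f]]
        by (simp add: linear_scale partial_deriv_def)
qed

lemma laplacian_homogeneous_0: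
  fixes Y :: "'a::euclidean_space \<Rightarrow> real"
  assumes Y: "smooth_on (-{0}) Y" and hom: "\<And>s x. x \<noteq> 0 \<Longrightarrow> 0 < s \<Longrightarrow> Y (s *\<^sub>R x) = Y x"
    and x: "x \<noteq> 0" and s: "0 < s"
  shows "laplacian Y x = s\<^sup>2 * laplacian Y (s *\<^sub>R x)"
proof -
  note S = open_punctured[where 'a='a]
  have "partial_deriv i (partial_deriv i Y) x
      = s\<^sup>2 * partial_deriv i (partial_deriv i Y) (s *\<^sub>R x)" if i: "i \<in> Basis" for i
  proof -
    have 1: "partial_deriv i Y y = s * partial_deriv i Y (s *\<^sub>R y)" if "y \<in> -{0}" for y
    proof -
      have "partial_deriv i Y y = partial_deriv i (\<lambda>x. Y (s *\<^sub>R x)) y"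
        using that hom[OF _ s] by (intro partial_deriv_cong[OF S]) auto
      also have "\<dots> = s * partial_deriv i Y (s *\<^sub>R y)"
        using that s by (intro partial_deriv_scale[OF Y S]) auto
      finally show ?thesis .
    qed
    define D where "D = partial_deriv i Y"
    have D: "smooth_on (-{0}) D" unfolding D_def by (intro smooth_on_partial_deriv S Y i)
    \<comment> \<open>First-order homogeneity identifies \<open>D (s *\<^sub>R y)\<close> with
      \<open>D y / s\<close>, whose smoothness is known.\<close>
    have "smooth_on (-{0}) (\<lambda>y. D y / s)" by (intro smooth_on_divide_const S D)
    then have sm: "smooth_on (-{0}) (\<lambda>y. D (s *\<^sub>R y))"
    proof (rule smooth_on_cong[OF _ S])
      fix y :: 'a assume "y \<in> -{0}"
      from 1[OF this] have "D y = s * D (s *\<^sub>R y)" by (simp only: D_def)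
      then show "D y / s = D (s *\<^sub>R y)" using s by (metis less_irrefl nonzero_mult_div_cancel_left)
    qed
    have "partial_deriv i D x = partial_deriv i (\<lambda>y. s * D (s *\<^sub>R y)) x"
      using 1 x by (intro partial_deriv_cong[OF S]) (auto simp: D_def)
    also have "\<dots> = s * partial_deriv i (\<lambda>y. D (s *\<^sub>R y)) x"
      using x by (intro partial_deriv_cmult[OF sm S]) auto
    also have "partial_deriv i (\<lambda>y. D (s *\<^sub>R y)) x = s * partial_deriv i D (s *\<^sub>R x)"
      using x s by (intro partial_deriv_scale[OF D S]) auto
    finally show ?thesis by (simp add: D_def power2_eq_square)
  qed
  then show ?thesis by (simp add: laplacian_def sum_distrib_left)
qed

text \<open>\<open>spherical_harmonic\<close> gives the eigenvalue equation on the unit sphere only.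
  The Laplacian of the extension is homogeneous of degree -2, for which the factor
  \<open>(norm x)\<^sup>2\<close> in \<open>ang_laplacian\<close> compensates, and both Euler terms
  vanish.\<close>

lemma sph_eigen_radial_extension:
  fixes \<phi> :: "'a::euclidean_space \<Rightarrow> real"
  assumes "spherical_harmonic k \<phi>"
  shows "sph_eigen (sphere_eigenvalue DIM('a) k) (radial_extension \<phi>)"
proof -
  note S = open_punctured[where 'a='a]
  let ?Y = "radial_extension \<phi>"
  have Y: "smooth_on (-{0}) ?Y" and eig: "\<And>x. x \<in> sphere 0 1 \<Longrightarrow>
      - laplacian ?Y x = sphere_eigenvalue DIM('a) k * \<phi> x"
    using assms by (auto simp: spherical_harmonic_def sphere_laplacian_def)
  obtain x0 where x0: "x0 \<in> sphere 0 1" "\<phi> x0 \<noteq> 0" using assms by (auto simp: spherical_harmonic_def)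
  have hom: "?Y (s *\<^sub>R x) = ?Y x" if "x \<noteq> 0" "0 < s" for s and x :: 'a
  proof -
    have "inverse (s * norm x) * s = inverse (norm x)" using that by (simp add: field_simps)
    then show ?thesis unfolding radial_extension_def norm_scaleR scaleR_scaleR using that
        by (simp only: abs_of_pos)
  qed
  have "ang_laplacian ?Y x = - sphere_eigenvalue DIM('a) k * ?Y x" if x: "x \<noteq> 0" for x
  proof -
    have e1: "euler ?Y y = 0" if "y \<noteq> 0" for y using euler_homogeneous_0[OF Y hom that] by blast
    have "euler (euler ?Y) x = euler (\<lambda>_. 0) x" using e1 x by (intro euler_cong[OF S]) auto
    then have e2: "euler (euler ?Y) x = 0" by (simp add: euler_def[of "\<lambda>_. 0"])
    have "laplacian ?Y x = (1 / norm x)\<^sup>2 * laplacian ?Y ((1 / norm x) *\<^sub>R x)"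
      using x by (intro laplacian_homogeneous_0[OF Y hom]) auto
    moreover have "- laplacian ?Y ((1 / norm x) *\<^sub>R x)
        = sphere_eigenvalue DIM('a) k * \<phi> ((1 / norm x) *\<^sub>R x)"
      using x by (intro eig) auto
    ultimately have "(norm x)\<^sup>2 * laplacian ?Y x = - sphere_eigenvalue DIM('a) k * ?Y x"
    proof -
      have "(norm x)\<^sup>2 * (1 / norm x)\<^sup>2 = 1" using x by (simp add: power_divide)
      then have "(norm x)\<^sup>2 * laplacian ?Y x = laplacian ?Y ((1 / norm x) *\<^sub>R x)"
        unfolding \<open>laplacian ?Y x = _\<close> mult.assoc[symmetric] by simp
      also have "\<dots> = - sphere_eigenvalue DIM('a) k * \<phi> ((1 / norm x) *\<^sub>R x)"
        using \<open>- laplacian ?Y _ = _\<close> by simp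
      finally show ?thesis by (simp add: radial_extension_def divide_inverse)
    qed
    then show ?thesis by (simp add: ang_laplacian_def e1[OF x] e2)
  qed
  moreover have "?Y x0 \<noteq> 0" "x0 \<noteq> 0" using x0 by (auto simp: radial_extension_def)
  ultimately show ?thesis using Y hom by (auto simp: sph_eigen_def)
qed

text \<open>\<open>Re ((x\<^sub>1 + i x\<^sub>2)^d)\<close> is a homogeneous harmonic polynomial of degree \<open>d\<close>.\<close>

lemma sph_eigen_exists:
  assumes "DIM('a::euclidean_space) \<ge> 2"
  shows "\<exists>Y :: 'a \<Rightarrow> real. sph_eigen (sphere_eigenvalue DIM('a) d) Y"
proof -
  obtain B :: "'a set" where B: "B \<subseteq> Basis" "card B = 2"
    using obtain_subset_with_card_n[OF assms] by metis
  obtain i j :: 'a where ij: "i \<in> Basis" "j \<in> Basis" "i \<noteq> j"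
    using B by (metis card_2_iff insert_subset)
  define z where "z x = Complex (x \<bullet> i) (x \<bullet> j)" for x :: 'a
  have z_eq: "z x = of_real (x \<bullet> i) + \<i> * of_real (x \<bullet> j)" for x
    by (simp add: z_def complex_eq_iff)
  have z_deriv: "(z has_derivative z) (at x)" for x
    unfolding z_eq[abs_def] by (auto intro!: derivative_eq_intros)
  have z_scale: "z (s *\<^sub>R x) = of_real s * z x" for s x
    by (simp add: z_def complex_eq_iff)
  have z_sum: "z (\<Sum>k\<in>Basis. f k *\<^sub>R k) = (\<Sum>k\<in>Basis. of_real (f k) * z k)" for f :: "'a \<Rightarrow> real"
    by (simp add: z_eq inner_sum_left algebra_simps sum.distrib sum_distrib_left)
  \<comment> \<open>The complex linear form \<open>z\<close> is isotropic, as \<open>i\<close> and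
    \<open>j\<close> are orthonormal. The Laplacian of a power of \<open>z\<close> contains this sum
    as a factor.\<close>
  have zz: "(\<Sum>k\<in>Basis. z k * z k) = 0"
  proof -
    have "z k * z k = of_real ((i \<bullet> k) * (i \<bullet> k) - (j \<bullet> k) * (j \<bullet> k))
        + 2 * \<i> * of_real ((i \<bullet> k) * (j \<bullet> k))" for k
      by (simp add: z_def complex_eq_iff inner_commute)
    then have "(\<Sum>k\<in>Basis. z k * z k) = of_real ((\<Sum>k\<in>Basis. (i \<bullet> k) * (i \<bullet> k))
        - (\<Sum>k\<in>Basis. (j \<bullet> k) * (j \<bullet> k)))
        + 2 * \<i> * of_real (\<Sum>k\<in>Basis. (i \<bullet> k) * (j \<bullet> k))"
      by (simp only: sum.distrib sum_distrib_left[symmetric] sum_subtractf of_real_sum[symmetric])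
    also have "\<dots> = of_real (i \<bullet> i - j \<bullet> j) + 2 * \<i> * of_real (i \<bullet> j)"
      by (simp only: euclidean_inner[symmetric])
    finally show ?thesis using ij by (simp add: inner_Basis)
  qed
  \<comment> \<open>The complex coefficient \<open>c\<close> closes the family under
    differentiation. At \<open>e = 0\<close> the truncated exponent \<open>e - 1\<close> is
    harmless, since the coefficient \<open>of_nat e\<close> is 0.\<close>
  define P where "P c e x = Re (c * z x ^ e)" for c e x
  have P_deriv: "(P c e has_derivative (\<lambda>v. P (c * of_nat e * z v) (e - 1) x)) (at x)" for c e x
    unfolding P_def by (auto intro!: derivative_eq_intros z_deriv simp: mult_ac)
  have P_smooth: "smooth_on UNIV (P c e)" for c e
    unfolding smooth_on_def
  proof
    fix k show "Ck_on k UNIV (P c e)"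
    proof (induction k arbitrary: c e)
      case 0
      have "continuous_on UNIV (P c e)"
        using has_derivative_continuous[OF P_deriv] by (simp add: continuous_on_eq_continuous_at)
      then show ?case by simp
    next
      case (Suc k)
      then show ?case by (intro Ck_on_SucI[OF open_UNIV P_deriv]) auto
    qed
  qed
  have P_partial: "partial_deriv k (P c e) = P (c * of_nat e * z k) (e - 1)" for k c e
    using partial_deriv_eqI[OF P_deriv] by blast
  define Q where "Q = P 1 d"
  have Q_smooth: "smooth_on UNIV Q" by (simp add: Q_def P_smooth)
  then have Q_smooth': "smooth_on (-{0}) Q" by (rule smooth_on_subset) auto
  have Q_lap: "laplacian Q x = 0" for x
  proof -
    have "laplacian Q x = (\<Sum>k\<in>Basis. Re (of_nat d * of_nat (d - 1) * z x ^ (d - 1 - 1) * (z k * z k)))"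
      unfolding laplacian_def Q_def P_partial unfolding P_def
      by (intro sum.cong refl arg_cong[where f = Re]) (simp add: mult_ac)
    also have "\<dots> = Re (of_nat d * of_nat (d - 1) * z x ^ (d - 1 - 1) * (\<Sum>k\<in>Basis. z k * z k))"
      by (simp only: Re_sum[symmetric] sum_distrib_left[symmetric])
    finally show ?thesis by (simp add: zz)
  qed
  have Q_euler: "euler Q x = real d * Q x" for x
  proof -
    have "euler Q x = (\<Sum>k\<in>Basis. Re (of_nat d * z x ^ (d - 1) * (of_real (x \<bullet> k) * z k)))"
      unfolding euler_def Q_def P_partial unfolding P_def
      by (intro sum.cong refl) (simp add: algebra_simps)
    also have "\<dots> = Re (of_nat d * z x ^ (d - 1) * (\<Sum>k\<in>Basis. of_real (x \<bullet> k) * z k))"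
      by (simp only: Re_sum[symmetric] sum_distrib_left[symmetric])
    also have "(\<Sum>k\<in>Basis. of_real (x \<bullet> k) * z k) = z x"
      by (simp only: z_sum[symmetric] euclidean_representation)
    also have "Re (of_nat d * z x ^ (d - 1) * z x) = real d * Q x"
      by (cases d) (simp_all add: Q_def P_def algebra_simps)
    finally show ?thesis .
  qed
  have "euler Q = (\<lambda>x. real d * Q x)" using Q_euler by auto
  then have "euler (euler Q) x = real d * (real d * Q x)" for x
    using euler_cmult[OF open_UNIV Q_smooth, of x "real d"] Q_euler[of x] by simp
  then have Q_ang: "ang_laplacian Q x = - sphere_eigenvalue DIM('a) d * Q x" for x
    by (simp add: ang_laplacian_def Q_lap Q_euler sphere_eigenvalue_def algebra_simps)
  \<comment> \<open>The power of the norm makes the function homogeneous of degree 0 and, being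
    radial, preserves the eigenvalue.\<close>
  define Y where "Y x = norm x powr (- real d) * Q x" for x
  have "smooth_on (-{0}) Y"
    unfolding Y_def[abs_def] by (intro smooth_on_mult smooth_on_norm_powr Q_smooth' open_punctured)
  moreover have "Y (s *\<^sub>R x) = Y x" if "x \<noteq> 0" "0 < s" for s x
  proof -
    have "Q (s *\<^sub>R x) = s ^ d * Q x"
      by (simp add: Q_def P_def z_scale power_mult_distrib flip: of_real_power)
    moreover have "norm (s *\<^sub>R x) powr (- real d) = norm x powr (- real d) / s ^ d"
      using that by (simp add: powr_mult powr_minus powr_realpow divide_inverse)
    ultimately show ?thesis using that by (simp add: Y_def)
  qed
  moreover have "ang_laplacian Y x = - sphere_eigenvalue DIM('a) d * Y x" if "x \<noteq> 0" for x
    using ang_laplacian_radial_mult[OF radial_norm_powr Q_smooth' that] by (simp add: Y_def[abs_def] Q_ang)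
  moreover have "Y i \<noteq> 0" "i \<noteq> 0"
    using ij by (auto simp: Y_def Q_def P_def z_def inner_Basis one_complex.code[symmetric]
        inner_not_same_Basis)
  ultimately show ?thesis by (auto simp: sph_eigen_def)
qed

text \<open>A vanishing integral would make the open set of points of \<open>S\<close> with
  \<open>F x \<noteq> 0\<close> null, but it contains \<open>x0\<close>. Continuity is asked on
  \<open>S\<close> only, because the integrands may jump at the origin.\<close>

lemma integral_pos_if_continuous:
  fixes F :: "'a::euclidean_space \<Rightarrow> real"
  assumes "integrable lborel F" "\<And>x. 0 \<le> F x" "continuous_on S F" "open S" "x0 \<in> S" "F x0 \<noteq> 0"
  shows "0 < (LINT x|lborel. F x)"
proof (rule ccontr)
  assume "\<not> 0 < (LINT x|lborel. F x)"
  moreover have "0 \<le> (LINT x|lborel. F x)" using assms(2) by (simp add: integral_nonneg_AE)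
  ultimately have "(LINT x|lborel. F x) = 0" by linarith
  then have "AE x in lborel. F x = 0"
    using integral_nonneg_eq_0_iff_AE[OF assms(1)] assms(2) by auto
  define W where "W = S \<inter> F -` (-{0})"
  have W: "open W" unfolding W_def by (rule continuous_open_preimage[OF assms(3,4)]) auto
  have "AE x in lborel. x \<notin> W" using \<open>AE x in lborel. F x = 0\<close> by (auto simp: W_def elim!: eventually_mono)
  then have "W \<in> null_sets lborel" using W AE_iff_null_sets[of W lborel] by auto
  then have "negligible W" using negligible_iff_null_sets null_sets_completionI by blast
  moreover have "x0 \<in> W" using assms(5,6) by (simp add: W_def)
  ultimately show False using W open_not_negligible by blast
qed

section \<open>Integrals of products of radial and angular functions\<close>

text \<open>With \<open>r = exp t\<close> the integral on the right is that of
  \<open>p\<^sup>2\<close> along the axis of the cylinder. A factor \<open>\<kappa>\<close> common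
  to both integrands cancels in quotients.\<close>

definition reduces_to :: "real \<Rightarrow> ('a::euclidean_space \<Rightarrow> real) \<Rightarrow> (real \<Rightarrow> real) \<Rightarrow> bool" where
  "reduces_to \<kappa> F p \<longleftrightarrow>
     (integrable lborel F \<longleftrightarrow> integrable lborel (\<lambda>r. indicator {0<..} r * ((p r)\<^sup>2 / r))) \<and>
     (LINT x|lborel. F x) = \<kappa> * (LINT r|lborel. indicator {0<..} r * ((p r)\<^sup>2 / r))"

text \<open>\<open>\<kappa>\<close> is the integral of \<open>Y\<^sup>2\<close> over the unit
  sphere, hence positive and the same for all profiles \<open>f\<close>; the weight leaves
  \<open>r ^ (N - 1) * r powr (- N) = 1 / r\<close>.\<close>

lemma integrals_radial_times_angular:
  fixes Y :: "'a::euclidean_space \<Rightarrow> real"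
  assumes Y: "sph_eigen c Y"
  shows "\<exists>\<kappa>>0. \<forall>f. continuous_on {0<..} f \<longrightarrow>
    reduces_to \<kappa> (\<lambda>x. norm x powr (- DIM('a)) * (f (norm x) * Y x)\<^sup>2) f"
proof -
  have Ys: "smooth_on (-{0}) Y" and hom: "\<And>s x. x \<noteq> 0 \<Longrightarrow> 0 < s \<Longrightarrow> Y (s *\<^sub>R x) = Y x"
    using Y by (auto simp: sph_eigen_def)
  obtain x0 where x0: "x0 \<noteq> 0" "Y x0 \<noteq> 0" using Y by (auto simp: sph_eigen_def)
  have Yc: "continuous_on (-{0}) Y" by (rule smooth_on_imp_continuous_on[OF Ys])
  define q where "q x = indicator (-{0}) x *\<^sub>R (Y x)\<^sup>2" for x
  have q_meas [measurable]: "q \<in> borel_measurable borel"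
    unfolding q_def[abs_def] by (intro borel_measurable_continuous_on_indicator continuous_intros Yc) auto
  have "compact (Y ` sphere 0 1)"
    by (intro compact_continuous_image continuous_on_subset[OF Yc]) auto
  then obtain B where "\<forall>y\<in>Y ` sphere 0 1. norm y \<le> B" using compact_imp_bounded bounded_iff by metis
  then have B: "\<And>x. norm x = 1 \<Longrightarrow> \<bar>Y x\<bar> \<le> B" by auto
  have q_bound: "q x \<le> B\<^sup>2" for x
  proof (cases "x = 0")
    case False
    then have "Y x = Y ((1 / norm x) *\<^sub>R x)" by (intro hom[symmetric]) auto
    then have "\<bar>Y x\<bar> \<le> B" using B[of "(1 / norm x) *\<^sub>R x"] False by simp
    then show ?thesis using power_mono[of "\<bar>Y x\<bar>" B 2] by (simp add: q_def indicator_def)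
  qed (simp add: q_def)
  have q: "q \<in> borel_measurable borel" "\<And>x. 0 \<le> q x" "\<And>x. q x \<le> B\<^sup>2" "\<And>s x. 0 < s \<Longrightarrow> q (s *\<^sub>R x) = q x"
  proof -
    show "q (s *\<^sub>R x) = q x" if "0 < s" for s x
      using that hom[of x s] by (cases "x = 0") (simp_all add: q_def indicator_def)
  qed (use q_meas q_bound in \<open>auto simp: q_def indicator_def\<close>)
  define \<kappa> where "\<kappa> = polar_const q"
  have "0 < (LINT x|lborel. indicator {..1} (norm x) * q x)"
  proof (rule integral_pos_if_continuous[where S = "ball 0 1 - {0}" and ?x0.0
      = "(1 / (2 * norm x0)) *\<^sub>R x0"])
    show "integrable lborel (\<lambda>x. indicator {..1} (norm x) * q x)" by (rule polar_integrable[OF q])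
    have "continuous_on (ball 0 1 - {0}) (\<lambda>x. (Y x)\<^sup>2)"
      by (intro continuous_intros continuous_on_subset[OF Yc]) auto
    then show "continuous_on (ball 0 1 - {0}) (\<lambda>x. indicator {..1} (norm x) * q x)"
      by (rule continuous_on_eq) (auto simp: q_def indicator_def)
  qed (use x0 hom[of x0 "1 / (2 * norm x0)"] q(2) in \<open>auto simp: q_def indicator_def\<close>)
  then have \<kappa>: "0 < \<kappa>" by (simp add: \<kappa>_def polar_const_def[OF q])
  have main: "reduces_to \<kappa> (\<lambda>x. norm x powr (- DIM('a)) * (f (norm x) * Y x)\<^sup>2) f"
      if f: "continuous_on {0<..} f" for f
  proof -
    define F where "F r = indicator {0<..} r *\<^sub>R (r powr (- DIM('a)) * (f r)\<^sup>2)" for r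
    have F: "F \<in> borel_measurable borel"
      unfolding F_def[abs_def] by (intro borel_measurable_continuous_on_indicator continuous_intros f) auto
    have eq1: "norm x powr (- DIM('a)) * (f (norm x) * Y x)\<^sup>2 = q x * F (norm x)" for x
      by (auto simp: q_def F_def indicator_def power_mult_distrib)
    have eq2: "\<kappa> * (indicator {0..} r * r ^ (DIM('a) - 1)) * F r
        = \<kappa> * (indicator {0<..} r * ((f r)\<^sup>2 / r))" for r
    proof (cases "r > 0")
      case True
      have "r ^ (DIM('a) - 1) * r powr (- DIM('a)) = r powr (-1)"
        using powr_pred_mult[OF True DIM_ge_Suc0[where 'a='a], of "- DIM('a)"] by simp
      also have "\<dots> = 1 / r" using True by (simp add: powr_minus divide_inverse)
      finally have *: "r ^ (DIM('a) - 1) * r powr (- DIM('a)) = 1 / r" .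
      have "\<kappa> * (indicator {0..} r * r ^ (DIM('a) - 1)) * F r
          = \<kappa> * ((r ^ (DIM('a) - 1) * r powr (- DIM('a))) * (f r)\<^sup>2)"
        using True by (simp add: F_def)
      then show ?thesis unfolding * using True by simp
    qed (simp add: F_def)
    have "integrable lborel (\<lambda>x. norm x powr (- DIM('a)) * (f (norm x) * Y x)\<^sup>2)
      \<longleftrightarrow> integrable lborel (\<lambda>r. \<kappa> * (indicator {0<..} r * ((f r)\<^sup>2 / r)))"
      unfolding eq1 by (rule integrable_polar[OF q F, folded \<kappa>_def, unfolded eq2])
    moreover have "(LINT x|lborel. norm x powr (- DIM('a)) * (f (norm x) * Y x)\<^sup>2)
      = (LINT r|lborel. \<kappa> * (indicator {0<..} r * ((f r)\<^sup>2 / r)))"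
      unfolding eq1 by (rule integral_polar[OF q F, folded \<kappa>_def, unfolded eq2])
    moreover have "integrable lborel (\<lambda>r. \<kappa> * G r) \<longleftrightarrow> integrable lborel G"
      "(LINT r|lborel. \<kappa> * G r) = \<kappa> * (LINT r|lborel. G r)" for G :: "real \<Rightarrow> real"
      using \<kappa> by auto
    ultimately show ?thesis unfolding reduces_to_def by (simp only:)
  qed
  show ?thesis using \<kappa> main by blast
qed

lemma euler_radial_times_angular:
  fixes Y :: "'a::euclidean_space \<Rightarrow> real"
  assumes f: "smooth_on {0<..} f" and Y: "sph_eigen c Y" and x: "x \<noteq> 0"
  shows "euler (\<lambda>x. f (norm x) * Y x) x = euler f (norm x) * Y x"
proof -
  have Ys: "smooth_on (-{0}) Y" and hom: "\<And>s x. x \<noteq> 0 \<Longrightarrow> 0 < s \<Longrightarrow> Y (s *\<^sub>R x) = Y x"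
    using Y by (auto simp: sph_eigen_def)
  have "radial (\<lambda>x::'a. f (norm x))" by (rule radial_compose[OF radial_norm f]) auto
  then show ?thesis
    using euler_mult[OF open_punctured radial_smooth Ys, of "\<lambda>x. f (norm x)" x] x
      euler_homogeneous_0[OF Ys hom x] euler_scaled_norm[OF f _ x, of 1] by simp
qed

lemma integrands_radial_times_angular:
  fixes Y :: "'a::euclidean_space \<Rightarrow> real" and m a b :: real
  assumes f: "smooth_on {0<..} f" and Y: "sph_eigen c Y" and x: "x \<noteq> 0"
    and a: "a = (real DIM('a) + m - 4) / 2" and b: "b = (real DIM('a) - m) / 2"
  shows "rellich_integrand m (\<lambda>x. norm x powr (- a) * (f (norm x) * Y x)) x = norm x powr (- DIM('a)) *
      ((euler (euler f) (norm x) + (b - a) * euler f (norm x) - (c + a * b) * f (norm x)) * Y x)\<^sup>2"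
    and "hardy_integrand m (\<lambda>x. norm x powr (- a) * (f (norm x) * Y x)) x = norm x powr (- DIM('a)) *
      ((euler f (norm x) - a * f (norm x)) * Y x)\<^sup>2"
proof -
  note S = open_punctured[where 'a='a]
  have Ys: "smooth_on (-{0}) Y" using Y by (auto simp: sph_eigen_def)
  have rad: "radial (\<lambda>x::'a. f (norm x))" by (rule radial_compose[OF radial_norm f]) auto
  let ?w = "\<lambda>x. f (norm x) * Y x"
  have w: "smooth_on (-{0}) ?w" by (intro smooth_on_mult S radial_smooth rad Ys)
  have e1: "euler ?w y = euler f (norm y) * Y y" if "y \<noteq> 0" for y
    by (rule euler_radial_times_angular[OF f Y that])
  have "euler (euler ?w) x = euler (\<lambda>y. euler f (norm y) * Y y) x"
    using e1 x by (intro euler_cong[OF S]) auto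
  also have "\<dots> = euler (euler f) (norm x) * Y x"
    by (rule euler_radial_times_angular[OF smooth_on_euler[OF open_greaterThan f] Y x])
  finally have e2: "euler (euler ?w) x = euler (euler f) (norm x) * Y x" .
  have l: "ang_laplacian ?w x = - c * f (norm x) * Y x"
    using ang_laplacian_radial_mult[OF rad Ys x] Y x by (simp add: sph_eigen_def)
  show "rellich_integrand m (\<lambda>x. norm x powr (- a) * ?w x) x = norm x powr (- DIM('a)) *
      ((euler (euler f) (norm x) + (b - a) * euler f (norm x) - (c + a * b) * f (norm x)) * Y x)\<^sup>2"
    unfolding rellich_integrand_powr_mult[OF w x a b] e1[OF x] e2 l by (simp add: algebra_simps)
  show "hardy_integrand m (\<lambda>x. norm x powr (- a) * ?w x) x = norm x powr (- DIM('a)) *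
      ((euler f (norm x) - a * f (norm x)) * Y x)\<^sup>2"
    unfolding hardy_integrand_powr_mult[OF w x a b] e1[OF x] by (simp add: algebra_simps)
qed

text \<open>\<open>U\<close> is prescribed off the origin only, since the value of
  \<open>x /\<^sub>R norm x\<close> at the origin is a convention. Both integrals come with the same
  \<open>\<kappa>\<close>.\<close>

lemma integrals_sph_eigen:
  fixes Y :: "'a::euclidean_space \<Rightarrow> real" and m a b :: real
  assumes Y: "sph_eigen c Y"
    and a: "a = (real DIM('a) + m - 4) / 2" and b: "b = (real DIM('a) - m) / 2"
  obtains \<kappa> where "0 < \<kappa>"
    "\<forall>f U. smooth_on {0<..} f \<longrightarrow> (\<forall>x. x \<noteq> 0 \<longrightarrow> U x = norm x powr (- a) * (f (norm x) * Y x)) \<longrightarrow>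
      reduces_to \<kappa> (rellich_integrand m U)
        (\<lambda>r. euler (euler f) r + (b - a) * euler f r - (c + a * b) * f r)"
    "\<forall>f U. smooth_on {0<..} f \<longrightarrow> (\<forall>x. x \<noteq> 0 \<longrightarrow> U x = norm x powr (- a) * (f (norm x) * Y x)) \<longrightarrow>
      reduces_to \<kappa> (hardy_integrand m U) (\<lambda>r. euler f r - a * f r)"
proof -
  obtain \<kappa> where \<kappa>: "0 < \<kappa>" and red: "\<And>f. continuous_on {0<..} f \<Longrightarrow>
    reduces_to \<kappa> (\<lambda>x. norm x powr (- DIM('a)) * (f (norm x) * Y x)\<^sup>2) f"
    using integrals_radial_times_angular[OF Y] by blast
  have int_cong: "integrable lborel F \<longleftrightarrow> integrable lborel G"
    if eq: "\<And>x. x \<noteq> 0 \<Longrightarrow> F x = G x" for F G :: "'a \<Rightarrow> real"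
  proof -
    have *: "integrable lborel G" if F: "integrable lborel F" and eq: "\<And>x. x \<noteq> 0 \<Longrightarrow>
        F x = G x" for F G :: "'a \<Rightarrow> real"
    proof -
      have "F \<in> borel_measurable borel" using borel_measurable_integrable[OF F] by simp
      with borel_measurable_cong_punctured[OF this eq] AE_punctured[of "\<lambda>x. F x = G x", OF eq]
      show ?thesis by (intro integrable_cong_AE[THEN iffD1, OF _ _ _ F]) auto
    qed
    show ?thesis using *[of F G] *[of G F] eq by auto
  qed
  show thesis
  proof (rule that[OF \<kappa>]; intro allI impI)
    fix f U assume f: "smooth_on {0<..} f" and "\<forall>x. x \<noteq> 0 \<longrightarrow> U x = norm x powr (- a) * (f (norm x) * Y x)"
    then have U: "\<And>x. x \<noteq> 0 \<Longrightarrow> U x = norm x powr (- a) * (f (norm x) * Y x)" by blast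
    have sm: "smooth_on {0<..} (\<lambda>r. euler (euler f) r + (b - a) * euler f r - (c + a * b) * f r)"
      "smooth_on {0<..} (\<lambda>r. euler f r - a * f r)"
      by (intro smooth_on_add smooth_on_diff smooth_on_mult smooth_on_const smooth_on_euler f
          open_greaterThan)+
    have cong: "rellich_integrand m U x = rellich_integrand m (\<lambda>x. norm x powr (- a) * (f (norm x) * Y
        x)) x"
      "hardy_integrand m U x = hardy_integrand m (\<lambda>x. norm x powr (- a) * (f (norm x) * Y x)) x"
          if "x \<noteq> 0" for x
      using that euler_cong[OF open_punctured _ U, of x] laplacian_cong[OF open_punctured _ U, of x]
      by (simp_all add: hardy_integrand_eq rellich_integrand_eq)
    have R: "rellich_integrand m U x = norm x powr (- DIM('a)) *
      ((euler (euler f) (norm x) + (b - a) * euler f (norm x) - (c + a * b) * f (norm x)) * Y x)\<^sup>2"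
          if "x \<noteq> 0" for x
      using cong(1)[OF that] integrands_radial_times_angular(1)[OF f Y that a b] by simp
    have H: "hardy_integrand m U x = norm x powr (- DIM('a)) *
      ((euler f (norm x) - a * f (norm x)) * Y x)\<^sup>2" if "x \<noteq> 0" for x
      using cong(2)[OF that] integrands_radial_times_angular(2)[OF f Y that a b] by simp
    show "reduces_to \<kappa> (rellich_integrand m U)
        (\<lambda>r. euler (euler f) r + (b - a) * euler f r - (c + a * b) * f r)"
    proof -
      note red' = red[OF smooth_on_imp_continuous_on[OF sm(1)], unfolded reduces_to_def]
      show ?thesis unfolding reduces_to_def
        by (intro conjI trans[OF int_cong[OF R] red'[THEN conjunct1]]
            trans[OF lborel_integral_cong_punctured[OF R] red'[THEN conjunct2]])
    qed
    show "reduces_to \<kappa> (hardy_integrand m U) (\<lambda>r. euler f r - a * f r)"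
    proof -
      note red' = red[OF smooth_on_imp_continuous_on[OF sm(2)], unfolded reduces_to_def]
      show ?thesis unfolding reduces_to_def
        by (intro conjI trans[OF int_cong[OF H] red'[THEN conjunct1]]
            trans[OF lborel_integral_cong_punctured[OF H] red'[THEN conjunct2]])
    qed
  qed
qed

section \<open>The approximating family\<close>

lemma smooth_on_powr_real: "smooth_on {0<..} (\<lambda>r::real. r powr p)"
  by (rule smooth_on_cong[OF smooth_on_subset[OF smooth_on_norm_powr]]) (auto simp: interior_open[OF
      open_punctured])

lemma euler_powr_real:
  assumes "0 < (r::real)"
  shows "euler (\<lambda>r. r powr p) r = p * r powr p"
proof -
  have "euler (\<lambda>r. r powr p) r = euler (\<lambda>r. norm r powr p) r"
    using assms by (intro euler_cong[of "{0<..}"]) auto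
  then show ?thesis using euler_norm_powr[of r p] assms by simp
qed

text \<open>Conjugation with \<open>r powr \<epsilon>\<close> turns the Euler field \<open>E\<close>
  into \<open>E + \<epsilon>\<close>; the brackets are \<open>(E + \<epsilon>) g\<close> and
  \<open>(E + \<epsilon>)\<^sup>2 g\<close>.\<close>

lemma euler_powr_mult_cutoff:
  assumes g: "cutoff g" and r: "0 < r"
  shows "euler (\<lambda>r. r powr \<epsilon> * g r) r = r powr \<epsilon> * (\<epsilon> * g r + euler g r)"
    and "euler (euler (\<lambda>r. r powr \<epsilon> * g r)) r
        = r powr \<epsilon> * (\<epsilon>\<^sup>2 * g r + 2 * \<epsilon> * euler g r + euler (euler g) r)"
proof -
  note sg = smooth_on_cutoff[OF g]
  have r': "r \<in> {0<..}" using r by simp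
  show "euler (\<lambda>r. r powr \<epsilon> * g r) r = r powr \<epsilon> * (\<epsilon> * g r + euler g r)"
    using euler_mult[OF open_greaterThan smooth_on_powr_real sg r', of \<epsilon>] r
    by (simp add: euler_powr_real algebra_simps)
  have "euler (euler (\<lambda>r. r powr \<epsilon>)) r = euler (\<lambda>r. \<epsilon> * r powr \<epsilon>) r"
    using r by (intro euler_cong[of "{0<..}"]) (auto simp: euler_powr_real)
  also have "\<dots> = \<epsilon> * (\<epsilon> * r powr \<epsilon>)"
    using euler_cmult[OF open_greaterThan smooth_on_powr_real r', of \<epsilon> \<epsilon>] r by (simp add: euler_powr_real)
  finally show "euler (euler (\<lambda>r. r powr \<epsilon> * g r)) r
      = r powr \<epsilon> * (\<epsilon>\<^sup>2 * g r + 2 * \<epsilon> * euler g r + euler (euler g) r)"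
    using euler_euler_mult[OF open_greaterThan smooth_on_powr_real sg r', of \<epsilon>] r
    by (simp add: euler_powr_real algebra_simps power2_eq_square)
qed

text \<open>The interval \<open>(0, 1)\<close> contributes
  \<open>k\<^sup>2 / (2 * \<epsilon>)\<close>; the rest, over \<open>[1, 2]\<close>, is nonnegative
  and bounded. After multiplication by \<open>2 * \<epsilon>\<close> only \<open>k\<^sup>2\<close>
  survives as \<open>\<epsilon>\<close> tends to 0.\<close>

lemma powr_weighted_integral:
  fixes \<phi> :: "real \<Rightarrow> real"
  assumes \<phi>: "continuous_on {0<..} \<phi>" and k: "\<And>r. 0 < r \<Longrightarrow> r < 1 \<Longrightarrow> \<phi> r = k"
    and z: "\<And>r. 2 < r \<Longrightarrow> \<phi> r = 0" and \<epsilon>: "0 < \<epsilon>"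
  defines "J \<equiv> (LINT r|lborel. indicator {0<..} r * ((r powr \<epsilon> * \<phi> r)\<^sup>2 / r))"
  shows "integrable lborel (\<lambda>r. indicator {0<..} r * ((r powr \<epsilon> * \<phi> r)\<^sup>2 / r))"
    and "k\<^sup>2 \<le> 2 * \<epsilon> * J"
    and "(\<And>r. 0 < r \<Longrightarrow> \<bar>\<phi> r\<bar> \<le> T) \<Longrightarrow> \<epsilon> \<le> 1 / 2 \<Longrightarrow> 2 * \<epsilon> * J \<le> k\<^sup>2 + 2 * \<epsilon> * T\<^sup>2"
proof -
  let ?F = "\<lambda>r. indicator {0<..} r * ((r powr \<epsilon> * \<phi> r)\<^sup>2 / r)"
  let ?A = "\<lambda>r::real. indicator {0..1} r * r powr (2 * \<epsilon> - 1)"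
  let ?B = "\<lambda>r. indicator {1..2} r *\<^sub>R (r powr (2 * \<epsilon> - 1) * (\<phi> r)\<^sup>2)"
  have A: "has_bochner_integral lborel ?A (1 / (2 * \<epsilon>))"
    using has_bochner_integral_powr_from_0[of "2 * \<epsilon> - 1" 1] \<epsilon> by simp
  have B: "integrable lborel ?B"
    by (intro borel_integrable_compact continuous_intros continuous_on_subset[OF \<phi>]) auto
  have eq: "?F r = k\<^sup>2 * ?A r + ?B r" if "r \<noteq> 0" "r \<noteq> 1" for r
  proof (cases "0 < r")
    case True
    have "(r powr \<epsilon> * \<phi> r)\<^sup>2 / r = (r powr \<epsilon> * r powr \<epsilon> * r powr (-1)) * (\<phi> r)\<^sup>2"
      using True by (simp add: power_mult_distrib power2_eq_square powr_minus divide_inverse mult_ac)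
    also have "r powr \<epsilon> * r powr \<epsilon> * r powr (-1) = r powr (\<epsilon> + \<epsilon> + -1)"
      by (simp only: powr_add)
    also have "\<epsilon> + \<epsilon> + -1 = 2 * \<epsilon> - 1" by simp
    finally show ?thesis
      using True that k[of r] z[of r] by (auto simp: indicator_def)
  qed (use that in \<open>auto simp: indicator_def\<close>)
  have ae: "AE r in lborel. ?F r = k\<^sup>2 * ?A r + ?B r"
    using AE_lborel_singleton[of "0::real"] AE_lborel_singleton[of "1::real"] by eventually_elim (rule eq)
  have meas: "?F \<in> borel_measurable lborel"
  proof -
    have "(\<lambda>r. indicator {0<..} r *\<^sub>R ((r powr \<epsilon> * \<phi> r)\<^sup>2 / r)) \<in> borel_measurable borel"
      by (intro borel_measurable_continuous_on_indicator continuous_intros \<phi>) auto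
    then show ?thesis by simp
  qed
  have int: "integrable lborel (\<lambda>r. k\<^sup>2 * ?A r + ?B r)"
    using A B by (auto simp: has_bochner_integral_iff)
  then show "integrable lborel ?F"
    by (rule integrable_cong_AE[THEN iffD2, OF meas borel_measurable_integrable[OF int] ae])
  have "J = (LINT r|lborel. k\<^sup>2 * ?A r + ?B r)"
    unfolding J_def by (rule integral_cong_AE[OF meas borel_measurable_integrable[OF int] ae])
  also have "\<dots> = k\<^sup>2 / (2 * \<epsilon>) + (LINT r|lborel. ?B r)"
    using A B by (auto simp: has_bochner_integral_iff)
  finally have J: "2 * \<epsilon> * J = k\<^sup>2 + 2 * \<epsilon> * (LINT r|lborel. ?B r)" using \<epsilon> by (simp add: field_simps)
  have "0 \<le> (LINT r|lborel. ?B r)" by (intro integral_nonneg_AE) auto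
  then show "k\<^sup>2 \<le> 2 * \<epsilon> * J" using J \<epsilon> by simp
  assume T: "\<And>r. 0 < r \<Longrightarrow> \<bar>\<phi> r\<bar> \<le> T" and \<epsilon>2: "\<epsilon> \<le> 1 / 2"
  have "(LINT r|lborel. ?B r) \<le> (LINT r|lborel. indicator {1..2::real} r *\<^sub>R T\<^sup>2)"
  proof (rule integral_mono[OF B])
    show "integrable lborel (\<lambda>r::real. indicator {1..2} r *\<^sub>R T\<^sup>2)" by (intro borel_integrable_compact) auto
    show "?B r \<le> indicator {1..2} r *\<^sub>R T\<^sup>2" for r
    proof (cases "r \<in> {1..2}")
      case True
      \<comment> \<open>The exponent is nonpositive because \<open>\<epsilon> \<le> 1 / 2\<close>,
        and \<open>r \<ge> 1\<close>.\<close>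
      have "r powr (2 * \<epsilon> - 1) \<le> r powr 0" using True \<epsilon>2 by (intro powr_mono) auto
      then have "r powr (2 * \<epsilon> - 1) \<le> 1" using True by simp
      moreover have "(\<phi> r)\<^sup>2 \<le> T\<^sup>2" using T[of r] True power_mono[of "\<bar>\<phi> r\<bar>" T 2] by auto
      ultimately have "r powr (2 * \<epsilon> - 1) * (\<phi> r)\<^sup>2 \<le> 1 * T\<^sup>2" by (intro mult_mono) auto
      then show ?thesis using True by simp
    qed simp
  qed
  also have "\<dots> = T\<^sup>2" by simp
  finally show "2 * \<epsilon> * J \<le> k\<^sup>2 + 2 * \<epsilon> * T\<^sup>2" using J \<epsilon> by (simp add: mult_left_mono)
qed

text \<open>\<open>g\<close> drops from 1 to 0 between 1 and 2. This serves the one value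
  \<open>\<epsilon> = a\<close>, at which the coefficient \<open>\<epsilon> - a\<close> in the Hardy
  integral vanishes and positivity has to come from the derivative of \<open>g\<close>.\<close>

lemma cutoff_euler_nonzero:
  assumes g: "cutoff g"
  obtains z where "0 < z" "euler g z \<noteq> 0"
proof -
  have "\<exists>z. 1 < z \<and> z < 2 \<and> g 2 - g 1 = (2 - 1) * partial_deriv 1 g z"
    by (intro MVT2 DERIV_partial_deriv[OF smooth_on_cutoff[OF g] open_greaterThan]) auto
  then obtain z where z: "1 < z" "g 2 - g 1 = partial_deriv 1 g z" by auto
  have "g 1 = 1" "g 2 = 0" using cutoff_eq(1)[OF g, of 1] cutoff_eq(2)[OF g, of 2] by auto
  then show thesis using z by (intro that[of z]) (auto simp: euler_real)
qed

text \<open>Multiplied by \<open>2 * \<epsilon>\<close>, both integrals converge: the shell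
  \<open>1 \<le> |x| \<le> 2\<close> drops out and the unit ball leaves, up to the common
  \<open>\<kappa>\<close>, \<open>(c + a * b)\<^sup>2\<close> and \<open>a\<^sup>2\<close>, the
  squared actions of the two operators on a constant profile. As \<open>a \<noteq> 0\<close>, the
  quotient converges too.\<close>

lemma approximated_by_sph_eigen:
  fixes Y :: "'a::euclidean_space \<Rightarrow> real" and m a b :: real
  assumes Y: "sph_eigen c Y" and g: "cutoff g"
    and a: "a = (real DIM('a) + m - 4) / 2" "a \<noteq> 0" and b: "b = (real DIM('a) - m) / 2"
    and u: "\<And>\<epsilon> x. x \<noteq> 0 \<Longrightarrow> u \<epsilon> x = norm x powr (- a + \<epsilon>) * g (norm x) * Y x"
  shows "approximated_by m ((c + a * b)\<^sup>2 / a\<^sup>2) u"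
proof -
  note sg = smooth_on_cutoff[OF g] smooth_on_euler[OF open_greaterThan smooth_on_cutoff[OF g]]
    smooth_on_euler[OF open_greaterThan smooth_on_euler[OF open_greaterThan smooth_on_cutoff[OF g]]]
  note cg = sg[THEN smooth_on_imp_continuous_on]
  define f where "f \<epsilon> r = r powr \<epsilon> * g r" for \<epsilon> r
  have f: "smooth_on {0<..} (f \<epsilon>)" for \<epsilon>
    unfolding f_def[abs_def] by (intro smooth_on_mult smooth_on_powr_real sg open_greaterThan)
  have U: "u \<epsilon> x = norm x powr (- a) * (f \<epsilon> (norm x) * Y x)" if "x \<noteq> 0" for \<epsilon> x
    unfolding u[OF that] f_def powr_add by (simp only: mult.assoc)
  obtain \<kappa> where \<kappa>: "0 < \<kappa>" and R0: "\<forall>f U. smooth_on {0<..} f \<longrightarrow> (\<forall>x. x \<noteq> 0 \<longrightarrow>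
      U x = norm x powr (- a) * (f (norm x) * Y x)) \<longrightarrow>
      reduces_to \<kappa> (rellich_integrand m U)
        (\<lambda>r. euler (euler f) r + (b - a) * euler f r - (c + a * b) * f r)"
    and H0: "\<forall>f U. smooth_on {0<..} f \<longrightarrow> (\<forall>x. x \<noteq> 0 \<longrightarrow> U x = norm x powr (- a) * (f (norm x) * Y x)) \<longrightarrow>
      reduces_to \<kappa> (hardy_integrand m U) (\<lambda>r. euler f r - a * f r)"
    by (rule integrals_sph_eigen[OF Y a(1) b], rule that)
  note R = R0[rule_format, unfolded reduces_to_def] and H = H0[rule_format, unfolded reduces_to_def]
  \<comment> \<open>\<open>K \<epsilon>\<close> and \<open>\<epsilon> - a\<close> are the factors by
    which the two operators multiply \<open>r powr \<epsilon>\<close>; the remaining terms of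
    \<open>\<phi>1\<close> and \<open>\<phi>2\<close> contain derivatives of \<open>g\<close> and
    live on \<open>[1, 2]\<close>.\<close>
  define K where "K \<epsilon> = \<epsilon>\<^sup>2 + (b - a) * \<epsilon> - (c + a * b)" for \<epsilon>
  define \<phi>1 where "\<phi>1 \<epsilon> r = K \<epsilon> * g r + (2 * \<epsilon> + b - a) * euler g r + euler (euler g) r" for \<epsilon> r
  define \<phi>2 where "\<phi>2 \<epsilon> r = (\<epsilon> - a) * g r + euler g r" for \<epsilon> r
  define J1 where "J1 \<epsilon> = (LINT r|lborel. indicator {0<..} r * ((r powr \<epsilon> * \<phi>1 \<epsilon> r)\<^sup>2 / r))" for \<epsilon>
  define J2 where "J2 \<epsilon> = (LINT r|lborel. indicator {0<..} r * ((r powr \<epsilon> * \<phi>2 \<epsilon> r)\<^sup>2 / r))" for \<epsilon>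
  have eq1: "indicator {0<..} r * ((euler (euler (f \<epsilon>)) r + (b - a) * euler (f \<epsilon>) r - (c
      + a * b) * f \<epsilon> r)\<^sup>2 / r)
      = indicator {0<..} r * ((r powr \<epsilon> * \<phi>1 \<epsilon> r)\<^sup>2 / r)" for \<epsilon> r
  proof (cases "0 < r")
    case True
    have "euler (euler (f \<epsilon>)) r + (b - a) * euler (f \<epsilon>) r - (c + a * b) * f \<epsilon> r = r powr \<epsilon> * \<phi>1 \<epsilon> r"
      unfolding f_def[abs_def] euler_powr_mult_cutoff[OF g True] \<phi>1_def K_def by (simp add: algebra_simps)
    then show ?thesis by simp
  qed simp
  have eq2: "indicator {0<..} r * ((euler (f \<epsilon>) r - a * f \<epsilon> r)\<^sup>2 / r)
      = indicator {0<..} r * ((r powr \<epsilon> * \<phi>2 \<epsilon> r)\<^sup>2 / r)" for \<epsilon> r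
  proof (cases "0 < r")
    case True
    have "euler (f \<epsilon>) r - a * f \<epsilon> r = r powr \<epsilon> * \<phi>2 \<epsilon> r"
      unfolding f_def[abs_def] euler_powr_mult_cutoff[OF g True] \<phi>2_def by (simp add: algebra_simps)
    then show ?thesis by simp
  qed simp
  have c1: "continuous_on {0<..} (\<phi>1 \<epsilon>)" and c2: "continuous_on {0<..} (\<phi>2 \<epsilon>)" for \<epsilon>
    unfolding \<phi>1_def[abs_def] \<phi>2_def[abs_def] by (intro continuous_intros cg)+
  have k1: "\<phi>1 \<epsilon> r = K \<epsilon>" and k2: "\<phi>2 \<epsilon> r = \<epsilon> - a" if "0 < r" "r < 1" for \<epsilon> r
    using that cutoff_eq(1)[OF g, of r] cutoff_euler_eq_0[OF g, of r] by (auto simp: \<phi>1_def \<phi>2_def)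
  have z1: "\<phi>1 \<epsilon> r = 0" and z2: "\<phi>2 \<epsilon> r = 0" if "2 < r" for \<epsilon> r
    using that cutoff_eq(2)[OF g, of r] cutoff_euler_eq_0[OF g, of r] by (auto simp: \<phi>1_def \<phi>2_def)
  obtain M where M: "\<And>r. 0 < r \<Longrightarrow> \<bar>euler g r\<bar> \<le> M" "\<And>r. 0 < r \<Longrightarrow> \<bar>euler (euler g) r\<bar> \<le> M" "0 \<le> M"
    by (rule cutoff_euler_bound[OF g], rule that)
  define T1 where "T1 = (1 + \<bar>b - a\<bar> + \<bar>c + a * b\<bar>) + (1 + \<bar>b - a\<bar>) * M + M"
  define T2 where "T2 = (1 + \<bar>a\<bar>) + M"
  have T: "\<bar>\<phi>1 \<epsilon> r\<bar> \<le> T1" "\<bar>\<phi>2 \<epsilon> r\<bar> \<le> T2" if \<epsilon>: "0 < \<epsilon>" "\<epsilon> \<le> 1 / 2" and r: "0 < r" for \<epsilon> r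
  proof -
    have g1: "\<bar>g r\<bar> \<le> 1" using cutoff_eq(3,4)[OF g, of r] r by auto
    have "\<epsilon>\<^sup>2 \<le> 1" using \<epsilon> by (simp add: power_le_one)
    moreover have "\<bar>(b - a) * \<epsilon>\<bar> \<le> \<bar>b - a\<bar> * 1" unfolding abs_mult using \<epsilon> by (intro mult_left_mono) auto
    moreover have "\<bar>y + p - q\<bar> \<le> 1 + B + \<bar>q\<bar>" if "0 \<le> y" "y \<le> 1" "\<bar>p\<bar> \<le> B * 1" for y p q B :: real
      using that by linarith
    ultimately have K1: "\<bar>K \<epsilon>\<bar> \<le> 1 + \<bar>b - a\<bar> + \<bar>c + a * b\<bar>" unfolding K_def using zero_le_power2[of \<epsilon>]
        by blast
    have "\<bar>\<phi>1 \<epsilon> r\<bar> \<le> \<bar>K \<epsilon> * g r\<bar> + \<bar>(2 * \<epsilon> + b - a) * euler g r\<bar> + \<bar>euler (euler g) r\<bar>"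
      unfolding \<phi>1_def by linarith
    also have "\<dots> \<le> (1 + \<bar>b - a\<bar> + \<bar>c + a * b\<bar>) * 1 + (1 + \<bar>b - a\<bar>) * M + M"
      unfolding abs_mult using \<epsilon> M r g1 K1 by (intro add_mono mult_mono) auto
    finally show "\<bar>\<phi>1 \<epsilon> r\<bar> \<le> T1" by (simp add: T1_def)
    have "\<bar>\<phi>2 \<epsilon> r\<bar> \<le> \<bar>(\<epsilon> - a) * g r\<bar> + \<bar>euler g r\<bar>" unfolding \<phi>2_def by linarith
    also have "\<dots> \<le> (1 + \<bar>a\<bar>) * 1 + M"
      unfolding abs_mult using \<epsilon> M r g1 by (intro add_mono mult_mono) auto
    finally show "\<bar>\<phi>2 \<epsilon> r\<bar> \<le> T2" by (simp add: T2_def)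
  qed
  have W1: "integrable lborel (\<lambda>r. indicator {0<..} r * ((r powr \<epsilon> * \<phi>1 \<epsilon> r)\<^sup>2 / r))"
    "(K \<epsilon>)\<^sup>2 \<le> 2 * \<epsilon> * J1 \<epsilon>" "\<epsilon> \<le> 1 / 2 \<Longrightarrow> 2 * \<epsilon> * J1 \<epsilon> \<le> (K \<epsilon>)\<^sup>2 + 2 * \<epsilon> * T1\<^sup>2" if "0 < \<epsilon>" for \<epsilon>
    unfolding J1_def by (rule powr_weighted_integral; use c1 k1 z1 T that in auto)+
  have W2: "integrable lborel (\<lambda>r. indicator {0<..} r * ((r powr \<epsilon> * \<phi>2 \<epsilon> r)\<^sup>2 / r))"
    "(\<epsilon> - a)\<^sup>2 \<le> 2 * \<epsilon> * J2 \<epsilon>" "\<epsilon> \<le> 1 / 2 \<Longrightarrow> 2 * \<epsilon> * J2 \<epsilon> \<le> (\<epsilon> - a)\<^sup>2 + 2 * \<epsilon> * T2\<^sup>2" if "0 < \<epsilon>" for \<epsilon>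
    unfolding J2_def by (rule powr_weighted_integral; use c2 k2 z2 T that in auto)+
  have R': "integrable lborel (rellich_integrand m (u \<epsilon>))" "(LINT x|lborel. rellich_integrand m (u \<epsilon>) x)
      = \<kappa> * J1 \<epsilon>" if "0 < \<epsilon>" for \<epsilon>
    using R[OF f U, unfolded eq1] W1(1)[OF that] unfolding J1_def by auto
  have H': "integrable lborel (hardy_integrand m (u \<epsilon>))" "(LINT x|lborel. hardy_integrand m (u \<epsilon>) x)
      = \<kappa> * J2 \<epsilon>" if "0 < \<epsilon>" for \<epsilon>
    using H[OF f U, unfolded eq2] W2(1)[OF that] unfolding J2_def by auto
  have J2_pos: "0 < J2 \<epsilon>" if \<epsilon>: "0 < \<epsilon>" for \<epsilon>
  proof (cases "\<epsilon> = a")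
    case False
    then have "0 < (\<epsilon> - a)\<^sup>2" by simp
    then have "0 < 2 * \<epsilon> * J2 \<epsilon>" using W2(2)[OF \<epsilon>] by (rule less_le_trans)
    then show ?thesis using \<epsilon> by (simp add: zero_less_mult_iff)
  next
    case True
    obtain z where z: "0 < z" "euler g z \<noteq> 0" by (rule cutoff_euler_nonzero[OF g], rule that)
    show ?thesis unfolding J2_def
    proof (rule integral_pos_if_continuous[where S = "{0<..}" and ?x0.0 = z])
      show "integrable lborel (\<lambda>r. indicator {0<..} r * ((r powr \<epsilon> * \<phi>2 \<epsilon> r)\<^sup>2 / r))"
        by (rule W2(1)[OF \<epsilon>])
      have "continuous_on {0<..} (\<lambda>r. (r powr \<epsilon> * \<phi>2 \<epsilon> r)\<^sup>2 / r)"
        by (intro continuous_intros c2) auto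
      then show "continuous_on {0<..} (\<lambda>r. indicator {0<..} r * ((r powr \<epsilon> * \<phi>2 \<epsilon> r)\<^sup>2 / r))"
        by (rule continuous_on_eq) simp
    qed (use z True in \<open>auto simp: indicator_def \<phi>2_def\<close>)
  qed
  have ev: "eventually (\<lambda>\<epsilon>. 0 < \<epsilon> \<and> \<epsilon> \<le> 1 / 2) (at_right (0::real))"
    using eventually_at_right_real[of 0 "1/2"] by (auto elim: eventually_mono)
  have lim1: "((\<lambda>\<epsilon>. 2 * \<epsilon> * J1 \<epsilon>) \<longlongrightarrow> (c + a * b)\<^sup>2) (at_right 0)"
  proof (rule tendsto_sandwich)
    show "eventually (\<lambda>\<epsilon>. (K \<epsilon>)\<^sup>2 \<le> 2 * \<epsilon> * J1 \<epsilon>) (at_right 0)"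
      using ev by eventually_elim (rule W1(2), auto)
    show "eventually (\<lambda>\<epsilon>. 2 * \<epsilon> * J1 \<epsilon> \<le> (K \<epsilon>)\<^sup>2 + 2 * \<epsilon> * T1\<^sup>2) (at_right 0)"
      using ev by eventually_elim (rule W1(3), auto)
    show "((\<lambda>\<epsilon>. (K \<epsilon>)\<^sup>2) \<longlongrightarrow> (c + a * b)\<^sup>2) (at_right 0)" "((\<lambda>\<epsilon>. (K \<epsilon>)\<^sup>2 + 2 * \<epsilon> * T1\<^sup>2) \<longlongrightarrow> (c
        + a * b)\<^sup>2) (at_right 0)"
      unfolding K_def by (auto intro!: tendsto_eq_intros simp: power2_eq_square algebra_simps)
  qed
  have lim2: "((\<lambda>\<epsilon>. 2 * \<epsilon> * J2 \<epsilon>) \<longlongrightarrow> a\<^sup>2) (at_right 0)"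
  proof (rule tendsto_sandwich)
    show "eventually (\<lambda>\<epsilon>. (\<epsilon> - a)\<^sup>2 \<le> 2 * \<epsilon> * J2 \<epsilon>) (at_right 0)"
      using ev by eventually_elim (rule W2(2), auto)
    show "eventually (\<lambda>\<epsilon>. 2 * \<epsilon> * J2 \<epsilon> \<le> (\<epsilon> - a)\<^sup>2 + 2 * \<epsilon> * T2\<^sup>2) (at_right 0)"
      using ev by eventually_elim (rule W2(3), auto)
    show "((\<lambda>\<epsilon>. (\<epsilon> - a)\<^sup>2) \<longlongrightarrow> a\<^sup>2) (at_right 0)" "((\<lambda>\<epsilon>. (\<epsilon> - a)\<^sup>2 + 2 * \<epsilon> * T2\<^sup>2) \<longlongrightarrow> a\<^sup>2) (at_right 0)"
      by (auto intro!: tendsto_eq_intros)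
  qed
  have "((\<lambda>\<epsilon>. (2 * \<epsilon> * J1 \<epsilon>) / (2 * \<epsilon> * J2 \<epsilon>)) \<longlongrightarrow> (c + a * b)\<^sup>2 / a\<^sup>2) (at_right 0)"
    using a(2) by (intro tendsto_divide lim1 lim2) auto
  moreover have "eventually (\<lambda>\<epsilon>. (2 * \<epsilon> * J1 \<epsilon>) / (2 * \<epsilon> * J2 \<epsilon>) =
      (LINT x|lborel. rellich_integrand m (u \<epsilon>) x) / (LINT x|lborel. hardy_integrand m (u \<epsilon>) x))
          (at_right 0)"
    using ev by eventually_elim (use \<kappa> in \<open>simp add: R'(2) H'(2)\<close>)
  ultimately have "((\<lambda>\<epsilon>. (LINT x|lborel. rellich_integrand m (u \<epsilon>) x) / (LINT x|lborel. hardy_integrand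
      m (u \<epsilon>) x))
      \<longlongrightarrow> (c + a * b)\<^sup>2 / a\<^sup>2) (at_right 0)"
    by (rule Lim_transform_eventually)
  then show ?thesis
    using R'(1) H' J2_pos \<kappa> by (force simp: approximated_by_def)
qed

section \<open>Optimality\<close>

text \<open>\<open>g\<close> is 1 on \<open>[0, 1]\<close>, which hides the kink of the absolute
  value at 0.\<close>

lemma smooth_on_cutoff_abs:
  assumes g: "cutoff g"
  shows "smooth_on UNIV (\<lambda>t::real. g \<bar>t\<bar>)"
proof -
  have "smooth_on (-{0}) (\<lambda>t::real. g \<bar>t\<bar>)"
    using radial_smooth[OF radial_cutoff[OF g, of 1, where 'a=real]] by simp
  moreover have "smooth_on {-1<..<1} (\<lambda>t::real. g \<bar>t\<bar>)"
    by (rule smooth_on_cong[OF smooth_on_const[of _ 1]]) (auto simp: cutoff_eq(1)[OF g])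
  ultimately have "smooth_on (-{0} \<union> {-1<..<1}) (\<lambda>t::real. g \<bar>t\<bar>)"
    by (intro smooth_on_Un) auto
  moreover have "-{0} \<union> {-1<..<1} = (UNIV :: real set)" by auto
  ultimately show ?thesis by (simp only:)
qed

lemma smooth_on_ln: "smooth_on {0<..} (\<lambda>r::real. ln r)"
proof (rule smooth_on_SucI)
  show "((\<lambda>r. ln r) has_derivative (\<lambda>v. v * r powr (-1))) (at r)" if "r \<in> {0<..}" for r :: real
    using that by (auto intro!: derivative_eq_intros simp: powr_minus divide_inverse)
  show "smooth_on {0<..} (\<lambda>r::real. i * r powr (-1))" for i
    by (intro smooth_on_mult smooth_on_const smooth_on_powr_real open_greaterThan)
qed simp

lemma smooth_on_log_profile:
  assumes "smooth_on UNIV k" shows "smooth_on {0<..} (\<lambda>r::real. k (s * ln r))"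
  by (rule smooth_on_compose[OF open_greaterThan open_UNIV assms])
    (auto intro!: smooth_on_mult smooth_on_ln)

lemma euler_log_profile:
  assumes k: "smooth_on UNIV k" and r: "0 < (r::real)"
  shows "euler (\<lambda>r. k (s * ln r)) r = s * partial_deriv 1 k (s * ln r)"
proof -
  have sm: "smooth_on {0<..} (\<lambda>r::real. s * ln r)"
    by (intro smooth_on_mult smooth_on_const smooth_on_ln open_greaterThan)
  have "partial_deriv 1 (\<lambda>r. k (s * ln r)) r = partial_deriv 1 k (s * ln r) * partial_deriv 1 (\<lambda>r. s *
      ln r) r"
    using r by (intro partial_deriv_compose[OF sm open_greaterThan] DERIV_partial_deriv[OF k]) auto
  also have "partial_deriv 1 (\<lambda>r. s * ln r) r = s / r"
    using r by (intro partial_deriv_eqI[where f'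
        = "\<lambda>v. s * (v / r)", THEN trans]) (auto intro!: derivative_eq_intros simp: divide_inverse)
  finally show ?thesis using r by (simp add: euler_real)
qed

text \<open>The substitution \<open>t = s * ln r\<close> maps \<open>dr / r\<close> to
  \<open>dt / s\<close>; the support of \<open>\<Psi>\<close> confines \<open>r\<close> to the
  interval from \<open>exp (- 2 / s)\<close> to \<open>exp (2 / s)\<close>.\<close>

lemma integral_log_profile:
  fixes \<Psi> :: "real \<Rightarrow> real"
  assumes \<Psi>: "continuous_on UNIV \<Psi>" and supp: "\<And>t. 2 < \<bar>t\<bar> \<Longrightarrow> \<Psi> t = 0" and s: "0 < s"
  shows "(LINT r|lborel. indicator {0<..} r * (\<Psi> (s * ln r) / r)) = (LINT t|lborel. \<Psi> t) / s"
proof -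
  let ?e = "\<lambda>t. exp (t / s)"
  let ?f = "\<lambda>r. \<Psi> (s * ln r) / r"
  have pos: "0 < r" if "?e (-2) \<le> r" for r using that exp_gt_zero[of "-2 / s"] by linarith
  have "continuous_on {?e (-2)..?e 2} ?f"
    by (intro continuous_intros continuous_on_compose2[OF \<Psi>]) (auto dest: pos)
  then have int: "set_integrable lborel {?e (-2)..?e 2} ?f" by (rule borel_integrable_atLeastAtMost')
  have "(LINT r|lborel. ?f r * indicator {?e (-2)..?e 2} r)
      = (LINT t|lborel. ?f (?e t) * (?e t / s) * indicator {-2..2} t)"
    using s int by (intro integral_substitution(2)[where g = ?e and g' = "\<lambda>t. ?e t / s" and f = ?f])
      (auto intro!: derivative_eq_intros continuous_intros)
  also have "\<dots> = (LINT t|lborel. \<Psi> t / s)"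
  proof (intro Bochner_Integration.integral_cong refl)
    fix t
    show "?f (?e t) * (?e t / s) * indicator {-2..2} t = \<Psi> t / s"
      using s supp[of t] by (cases "2 < \<bar>t\<bar>") (auto simp: indicator_def)
  qed
  also have "\<dots> = (LINT t|lborel. \<Psi> t) / s" by simp
  also have "(LINT r|lborel. ?f r * indicator {?e (-2)..?e 2} r)
      = (LINT r|lborel. indicator {0<..} r * ?f r)"
  proof (intro Bochner_Integration.integral_cong refl)
    fix r :: real
    show "?f r * indicator {?e (-2)..?e 2} r = indicator {0<..} r * ?f r"
    proof (cases "0 < r \<and> r \<notin> {?e (-2)..?e 2}")
      case True
      then have "ln r < -2 / s \<or> 2 / s < ln r"
        using ln_less_cancel_iff[of r "?e (-2)"] ln_less_cancel_iff[of "?e 2" r] by (auto simp: not_le)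
      then have "2 < \<bar>s * ln r\<bar>" using s by (auto simp: field_simps abs_if)
      then show ?thesis using supp by simp
    next
      case False
      show ?thesis
      proof (cases "0 < r")
        case True
        then show ?thesis using False by (auto simp: indicator_def)
      next
        case False
        then have "\<not> ?e (-2) \<le> r" using pos by blast
        then show ?thesis using False by (simp add: indicator_def)
      qed
    qed
  qed
  finally show ?thesis .
qed

text \<open>For a profile in \<open>s * ln r\<close> each Euler derivative costs a factor
  \<open>s\<close>, here \<open>1 / (n + 1)\<close>. In the slow limit the term without such a
  factor survives; \<open>s \<le> 1\<close> provides the dominating function.\<close>

lemma integral_square_limit:
  fixes p q r :: "real \<Rightarrow> real"
  assumes "continuous_on UNIV p" "continuous_on UNIV q" "continuous_on UNIV r"
    and "bounded_support p" "bounded_support q" "bounded_support r"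
  shows "(\<lambda>n. LINT t|lborel. ((1 / real (Suc n))\<^sup>2 * p t + (1 / real (Suc n)) * q t + r t)\<^sup>2)
    \<longlonglongrightarrow> (LINT t|lborel. (r t)\<^sup>2)"
proof (rule integral_dominated_convergence[where w = "\<lambda>t. (\<bar>p t\<bar> + \<bar>q t\<bar> + \<bar>r t\<bar>)\<^sup>2"])
  have [measurable]: "p \<in> borel_measurable borel" "q \<in> borel_measurable borel" "r \<in> borel_measurable borel"
    using assms by (auto intro: borel_measurable_continuous_onI)
  show "integrable lborel (\<lambda>t. (\<bar>p t\<bar> + \<bar>q t\<bar> + \<bar>r t\<bar>)\<^sup>2)"
  proof (intro integrable_continuous_bounded_support continuous_intros assms)
    obtain P Q R where "\<And>t. P < norm t \<Longrightarrow> p t = 0" "\<And>t. Q < norm t \<Longrightarrow> q t = 0" "\<And>t. R < norm t \<Longrightarrow> r t = 0"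
      using assms(4-6) unfolding bounded_support_def by blast
    then show "bounded_support (\<lambda>t. (\<bar>p t\<bar> + \<bar>q t\<bar> + \<bar>r t\<bar>)\<^sup>2)"
      unfolding bounded_support_def by (intro exI[of _ "max P (max Q R)"]) auto
  qed
  show "(\<lambda>t. (r t)\<^sup>2) \<in> borel_measurable lborel"
    "(\<lambda>t. ((1 / real (Suc n))\<^sup>2 * p t + (1 / real (Suc n)) * q t + r t)\<^sup>2) \<in> borel_measurable lborel" for n
    by measurable
  show "AE t in lborel. (\<lambda>n. ((1 / real (Suc n))\<^sup>2 * p t + (1 / real (Suc n)) * q t + r t)\<^sup>2) \<longlonglongrightarrow> (r t)\<^sup>2"
  proof (intro AE_I2)
    fix t
    have "(\<lambda>n. ((1 / real (Suc n))\<^sup>2 * p t + (1 / real (Suc n)) * q t + r t)\<^sup>2)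
        \<longlonglongrightarrow> (0\<^sup>2 * p t + 0 * q t + r t)\<^sup>2"
      by (intro tendsto_intros LIMSEQ_Suc[OF lim_const_over_n])
    then show "(\<lambda>n. ((1 / real (Suc n))\<^sup>2 * p t + (1 / real (Suc n)) * q t + r t)\<^sup>2) \<longlonglongrightarrow> (r t)\<^sup>2" by simp
  qed
  show "AE t in lborel. norm (((1 / real (Suc n))\<^sup>2 * p t + (1 / real (Suc n)) * q t + r t)\<^sup>2)
      \<le> (\<bar>p t\<bar> + \<bar>q t\<bar> + \<bar>r t\<bar>)\<^sup>2" for n
  proof (intro AE_I2)
    fix t
    define s where "s = 1 / real (Suc n)"
    have s: "0 \<le> s" "s \<le> 1" "s\<^sup>2 \<le> 1" by (auto simp: s_def power_le_one)
    have "\<bar>s\<^sup>2 * p t + s * q t + r t\<bar> \<le> \<bar>s\<^sup>2 * p t\<bar> + \<bar>s * q t\<bar> + \<bar>r t\<bar>" by linarith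
    also have "\<dots> \<le> 1 * \<bar>p t\<bar> + 1 * \<bar>q t\<bar> + \<bar>r t\<bar>"
      unfolding abs_mult using s by (intro add_mono mult_right_mono) auto
    finally have "\<bar>s\<^sup>2 * p t + s * q t + r t\<bar>\<^sup>2 \<le> (\<bar>p t\<bar> + \<bar>q t\<bar> + \<bar>r t\<bar>)\<^sup>2" by (intro power_mono) auto
    then show "norm (((1 / real (Suc n))\<^sup>2 * p t + (1 / real (Suc n)) * q t + r t)\<^sup>2)
        \<le> (\<bar>p t\<bar> + \<bar>q t\<bar> + \<bar>r t\<bar>)\<^sup>2"
      by (simp add: s_def)
  qed
qed

text \<open>Slowly varying functions of \<open>ln |x|\<close> times \<open>|x| powr (-a)\<close> are test functions that detect the
  constant, also for \<open>a = 0\<close>, where the family \<open>|x| powr \<epsilon> * g |x|\<close> does not.\<close>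

lemma admissible_constant_upper_bound:
  fixes Y :: "'a::euclidean_space \<Rightarrow> real" and m a b C :: real
  assumes adm: "admissible_constant TYPE('a) m C" and Y: "sph_eigen c Y" and g: "cutoff g"
    and a: "a = (real DIM('a) + m - 4) / 2" and b: "b = (real DIM('a) - m) / 2"
  shows "C * a\<^sup>2 \<le> (c + a * b)\<^sup>2" "a = 0 \<Longrightarrow> c = 0 \<Longrightarrow> C \<le> b\<^sup>2"
proof -
  define h where "h t = g \<bar>t\<bar>" for t :: real
  define h1 where "h1 = partial_deriv 1 h"
  define h2 where "h2 = partial_deriv 1 h1"
  have h: "smooth_on UNIV h" unfolding h_def[abs_def] by (rule smooth_on_cutoff_abs[OF g])
  have h1: "smooth_on UNIV h1" unfolding h1_def by (intro smooth_on_partial_deriv h open_UNIV) auto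
  have h2: "smooth_on UNIV h2" unfolding h2_def by (intro smooth_on_partial_deriv h1 open_UNIV) auto
  note hc = h[THEN smooth_on_imp_continuous_on] h1[THEN smooth_on_imp_continuous_on] h2[THEN
      smooth_on_imp_continuous_on]
  have h_0: "h t = 0" if "2 < \<bar>t\<bar>" for t using that cutoff_eq(2)[OF g] by (simp add: h_def)
  have h1_0: "h1 t = 0" if "2 < \<bar>t\<bar>" for t
    using partial_deriv_eq_0_if_locally_0[OF open_norm_greater[of 2], of t h 1] that h_0
        by (simp add: h1_def)
  have h2_0: "h2 t = 0" if "2 < \<bar>t\<bar>" for t
    using partial_deriv_eq_0_if_locally_0[OF open_norm_greater[of 2], of t h1 1] that h1_0
        by (simp add: h2_def)
  have bs: "bounded_support (\<lambda>t. \<alpha> * h t)" "bounded_support (\<lambda>t. \<alpha> * h1 t)"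
      "bounded_support (\<lambda>t. \<alpha> * h2 t)" for \<alpha>
    using h_0 h1_0 h2_0 unfolding bounded_support_def by (auto intro!: exI[of _ 2])
  have cm: "continuous_on UNIV (\<lambda>t. \<alpha> * h t)" "continuous_on UNIV (\<lambda>t. \<alpha> * h1 t)"
      "continuous_on UNIV (\<lambda>t. \<alpha> * h2 t)" for \<alpha>
    by (intro continuous_intros hc)+
  obtain \<kappa> where \<kappa>: "0 < \<kappa>" and R0: "\<forall>f U. smooth_on {0<..} f \<longrightarrow> (\<forall>x. x \<noteq> 0 \<longrightarrow>
      U x = norm x powr (- a) * (f (norm x) * Y x)) \<longrightarrow>
      reduces_to \<kappa> (rellich_integrand m U)
        (\<lambda>r. euler (euler f) r + (b - a) * euler f r - (c + a * b) * f r)"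
    and H0: "\<forall>f U. smooth_on {0<..} f \<longrightarrow> (\<forall>x. x \<noteq> 0 \<longrightarrow> U x = norm x powr (- a) * (f (norm x) * Y x)) \<longrightarrow>
      reduces_to \<kappa> (hardy_integrand m U) (\<lambda>r. euler f r - a * f r)"
    by (rule integrals_sph_eigen[OF Y a b], rule that)
  note R = R0[rule_format, unfolded reduces_to_def] and H = H0[rule_format, unfolded reduces_to_def]
  have Ys: "smooth_on (-{0}) Y" using Y by (auto simp: sph_eigen_def)
  have key: "C * (LINT t|lborel. (s * h1 t - a * h t)\<^sup>2)
      \<le> (LINT t|lborel. (s\<^sup>2 * h2 t + (b - a) * (s * h1 t) - (c + a * b) * h t)\<^sup>2)"
    if s: "0 < s" for s
  proof -
    define f where "f r = h (s * ln r)" for r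
    have f: "smooth_on {0<..} f" unfolding f_def[abs_def] by (rule smooth_on_log_profile[OF h])
    define U where "U x = norm x powr (- a) * (f (norm x) * Y x)" for x
    have "radial (\<lambda>x::'a. f (norm x))" by (rule radial_compose[OF radial_norm f]) auto
    then have Us: "smooth_on (-{0}) U"
      unfolding U_def[abs_def] by (intro smooth_on_mult smooth_on_norm_powr radial_smooth Ys open_punctured)
    have "U x = 0" if x: "norm x < exp (- (2 / s)) \<or> exp (2 / s) < norm x" for x
    proof (cases "x = 0")
      case False
      then have "ln (norm x) < - (2 / s) \<or> 2 / s < ln (norm x)"
        using x ln_less_cancel_iff[of "norm x" "exp (- (2 / s))"] ln_less_cancel_iff[of "exp (2 / s)"
            "norm x"] by auto
      then have "2 < \<bar>s * ln (norm x)\<bar>" using s by (auto simp: field_simps abs_if)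
      then show ?thesis by (simp add: U_def f_def h_0)
    qed (simp add: U_def)
    then have Ua: "annular U" unfolding annular_def using exp_gt_zero by blast
    have "U \<in> test_functions"
    proof -
      obtain R where "\<And>x. R < norm x \<Longrightarrow> U x = 0" using annular_imp_bounded_support[OF Ua]
          by (auto simp: bounded_support_def)
      then have "bounded {x. U x \<noteq> 0}" unfolding bounded_iff
          by (intro exI[of _ R]) (auto simp: not_less[symmetric])
      then show ?thesis using smooth_on_annular[OF Us Ua] by (simp add: test_functions_def compact_closure)
    qed
    then have ineq: "C * (LINT x|lborel. hardy_integrand m U x) \<le> (LINT x|lborel. rellich_integrand m U x)"
      using adm by (simp add: admissible_constant_def)
    have e1: "euler f r = s * h1 (s * ln r)" if "0 < r" for r
      unfolding f_def[abs_def] h1_def by (rule euler_log_profile[OF h that])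
    have e2: "euler (euler f) r = s\<^sup>2 * h2 (s * ln r)" if r: "0 < r" for r
    proof -
      have "euler (euler f) r = euler (\<lambda>r. s * h1 (s * ln r)) r"
        using e1 r by (intro euler_cong[of "{0<..}"]) auto
      also have "\<dots> = s * euler (\<lambda>r. h1 (s * ln r)) r"
        using r by (intro euler_cmult[OF open_greaterThan smooth_on_log_profile[OF h1]]) auto
      also have "\<dots> = s * (s * h2 (s * ln r))" unfolding h2_def euler_log_profile[OF h1 r] ..
      finally show ?thesis by (simp add: power2_eq_square)
    qed
    define \<Psi>1 where "\<Psi>1 t = (s\<^sup>2 * h2 t + (b - a) * (s * h1 t) - (c + a * b) * h t)\<^sup>2" for t
    define \<Psi>2 where "\<Psi>2 t = (s * h1 t - a * h t)\<^sup>2" for t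
    have "(LINT x|lborel. rellich_integrand m U x)
        = \<kappa> * (LINT r|lborel. indicator {0<..} r * (\<Psi>1 (s * ln r) / r))"
      unfolding R[OF f U_def, THEN conjunct2] \<Psi>1_def
      by (intro arg_cong[where f = "\<lambda>t. \<kappa> * t"] Bochner_Integration.integral_cong refl)
        (auto simp: indicator_def e1 e2 f_def)
    also have "\<dots> = \<kappa> * ((LINT t|lborel. \<Psi>1 t) / s)"
      using s h_0 h1_0 h2_0 by (subst integral_log_profile)
        (auto simp: \<Psi>1_def[abs_def] intro!: continuous_intros hc)
    finally have r: "(LINT x|lborel. rellich_integrand m U x) = \<kappa> / s * (LINT t|lborel. \<Psi>1 t)" by simp
    have "(LINT x|lborel. hardy_integrand m U x)
        = \<kappa> * (LINT r|lborel. indicator {0<..} r * (\<Psi>2 (s * ln r) / r))"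
      unfolding H[OF f U_def, THEN conjunct2] \<Psi>2_def
      by (intro arg_cong[where f = "\<lambda>t. \<kappa> * t"] Bochner_Integration.integral_cong refl)
        (auto simp: indicator_def e1 f_def)
    also have "\<dots> = \<kappa> * ((LINT t|lborel. \<Psi>2 t) / s)"
      using s h_0 h1_0 h2_0 by (subst integral_log_profile)
        (auto simp: \<Psi>2_def[abs_def] intro!: continuous_intros hc)
    finally have "(LINT x|lborel. hardy_integrand m U x) = \<kappa> / s * (LINT t|lborel. \<Psi>2 t)" by simp
    with r ineq have "\<kappa> / s * (C * (LINT t|lborel. \<Psi>2 t))
        \<le> \<kappa> / s * (LINT t|lborel. \<Psi>1 t)" by (simp add: mult.left_commute)
    then have "C * (LINT t|lborel. \<Psi>2 t) \<le> (LINT t|lborel. \<Psi>1 t)"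
      using \<kappa> s mult_le_cancel_left_pos[of "\<kappa> / s"] by simp
    then show ?thesis by (simp only: \<Psi>1_def \<Psi>2_def)
  qed
  have pos: "0 < (LINT t|lborel. (k t)\<^sup>2)" if "continuous_on UNIV k" "\<And>t. 2 < \<bar>t\<bar> \<Longrightarrow>
      k t = 0" "k z \<noteq> 0" for k :: "real \<Rightarrow> real" and z
  proof (rule integral_pos_if_continuous[where S = UNIV and ?x0.0 = z])
    show "integrable lborel (\<lambda>t. (k t)\<^sup>2)"
      using that by (intro integrable_continuous_bounded_support continuous_intros)
        (auto simp: bounded_support_def intro!: exI[of _ 2])
  qed (use that in \<open>auto intro!: continuous_intros\<close>)
  have l1: "(\<lambda>n. LINT t|lborel. ((1 / real (Suc n))\<^sup>2 * (0 * h t) + (1 / real (Suc n)) * (1 * h1 t)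
      + (- a) * h t)\<^sup>2)
      \<longlonglongrightarrow> (LINT t|lborel. ((- a) * h t)\<^sup>2)"
    by (intro integral_square_limit cm bs)
  have l2: "(\<lambda>n. LINT t|lborel. ((1 / real (Suc n))\<^sup>2 * (1 * h2 t)
      + (1 / real (Suc n)) * ((b - a) * h1 t) + (- (c + a * b)) * h t)\<^sup>2)
      \<longlonglongrightarrow> (LINT t|lborel. (- (c + a * b) * h t)\<^sup>2)"
    by (intro integral_square_limit cm bs)
  have "C * (LINT t|lborel. ((- a) * h t)\<^sup>2) \<le> (LINT t|lborel. (- (c + a * b) * h t)\<^sup>2)"
  proof (rule LIMSEQ_le[OF tendsto_mult_left[OF l1] l2], intro exI allI impI)
    fix n
    show "C * (LINT t|lborel. ((1 / real (Suc n))\<^sup>2 * (0 * h t) + (1 / real (Suc n)) * (1 * h1 t)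
        + (- a) * h t)\<^sup>2)
      \<le> (LINT t|lborel. ((1 / real (Suc n))\<^sup>2 * (1 * h2 t) + (1 / real (Suc n)) * ((b - a) * h1 t)
          + (- (c + a * b)) * h t)\<^sup>2)"
    proof -
      define s where "s = 1 / real (Suc n)"
      have "(\<lambda>t. (s\<^sup>2 * (0 * h t) + s * (1 * h1 t) + (- a) * h t)\<^sup>2) = (\<lambda>t. (s * h1 t - a * h t)\<^sup>2)"
        "(\<lambda>t. (s\<^sup>2 * (1 * h2 t) + s * ((b - a) * h1 t) + (- (c + a * b)) * h t)\<^sup>2)
          = (\<lambda>t. (s\<^sup>2 * h2 t + (b - a) * (s * h1 t) - (c + a * b) * h t)\<^sup>2)"
        by (auto intro!: ext arg_cong[where f = "\<lambda>y. y\<^sup>2"] simp: algebra_simps)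
      then show ?thesis using key[of s] by (simp only: s_def[symmetric]) (simp add: s_def)
    qed
  qed
  moreover have "0 < (LINT t|lborel. (h t)\<^sup>2)"
    using cutoff_eq(1)[OF g, of 0] by (intro pos[of h 0] hc h_0) (auto simp: h_def)
  moreover have "(- c - a * b)\<^sup>2 = (c + a * b)\<^sup>2" by (simp add: power2_eq_square algebra_simps)
  ultimately show "C * a\<^sup>2 \<le> (c + a * b)\<^sup>2"
    by (simp add: power_mult_distrib mult.assoc[symmetric])
  assume ac: "a = 0" "c = 0"
  \<comment> \<open>For \<open>a = c = 0\<close> both sides of \<open>key\<close> are of order
    \<open>s\<^sup>2\<close>. After division by \<open>s\<^sup>2\<close> the derivative
    \<open>h1\<close> takes over the role of \<open>h\<close>, and the limit compares
    \<open>C\<close> with \<open>b\<^sup>2\<close>.\<close>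
  have l3: "(\<lambda>n. LINT t|lborel. ((1 / real (Suc n))\<^sup>2 * (0 * h t) + (1 / real (Suc n)) * (1 * h2 t)
      + b * h1 t)\<^sup>2)
      \<longlonglongrightarrow> (LINT t|lborel. (b * h1 t)\<^sup>2)"
    by (intro integral_square_limit cm bs)
  have "C * (LINT t|lborel. (h1 t)\<^sup>2) \<le> (LINT t|lborel. (b * h1 t)\<^sup>2)"
  proof (rule LIMSEQ_le[OF tendsto_const l3], intro exI allI impI)
    fix n
    define s where "s = 1 / real (Suc n)"
    have s: "0 < s" by (simp add: s_def)
    have "s\<^sup>2 * (C * (LINT t|lborel. (h1 t)\<^sup>2)) = C * (LINT t|lborel. (s * h1 t - a * h t)\<^sup>2)"
      by (simp add: ac power_mult_distrib)
    also have "\<dots> \<le> (LINT t|lborel. (s\<^sup>2 * h2 t + (b - a) * (s * h1 t) - (c + a * b) * h t)\<^sup>2)"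
      by (rule key[OF s])
    also have "\<dots> = (LINT t|lborel. s\<^sup>2 * (s\<^sup>2 * (0 * h t) + s * (1 * h2 t) + b * h1 t)\<^sup>2)"
      by (intro Bochner_Integration.integral_cong refl) (simp add: ac power2_eq_square algebra_simps)
    also have "\<dots> = s\<^sup>2 * (LINT t|lborel. (s\<^sup>2 * (0 * h t) + s * (1 * h2 t) + b * h1 t)\<^sup>2)" by simp
    finally show "C * (LINT t|lborel. (h1 t)\<^sup>2) \<le>
        (LINT t|lborel. ((1 / real (Suc n))\<^sup>2 * (0 * h t) + (1 / real (Suc n)) * (1 * h2 t) + b * h1 t)\<^sup>2)"
      using s mult_le_cancel_left_pos[of "s\<^sup>2"] unfolding s_def by simp
  qed
  moreover have "0 < (LINT t|lborel. (h1 t)\<^sup>2)"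
  proof -
    have "\<exists>z. 0 < z \<and> z < 2 \<and> h 2 - h 0 = (2 - 0) * h1 z"
      unfolding h1_def by (intro MVT2 DERIV_partial_deriv[OF h]) auto
    then obtain z where "h 2 - h 0 = 2 * h1 z" by auto
    moreover have "h 2 = 0" "h 0 = 1" using cutoff_eq(2)[OF g, of 2] cutoff_eq(1)[OF g, of 0]
        by (auto simp: h_def)
    ultimately show ?thesis by (intro pos[of h1 z] hc h1_0) auto
  qed
  ultimately show "C \<le> b\<^sup>2" by (simp add: power_mult_distrib)
qed

section \<open>The optimal constants\<close>

lemma sphere_eigenvalue_0 [simp]: "sphere_eigenvalue N 0 = 0"
  by (simp add: sphere_eigenvalue_def)

lemma sphere_eigenvalue_1: "sphere_eigenvalue N 1 = real N - 1"
  by (simp add: sphere_eigenvalue_def)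

lemma sphere_eigenvalue_mono:
  assumes "2 \<le> N" "j \<le> k" shows "sphere_eigenvalue N j \<le> sphere_eigenvalue N k"
  using sphere_eigenvalue_strict_mono[OF assms(1), of j k] assms(2) by (cases "j = k") auto

lemma sphere_eigenvalue_nonneg: "2 \<le> N \<Longrightarrow> 0 \<le> sphere_eigenvalue N k"
  using sphere_eigenvalue_mono[of N 0 k] by simp

text \<open>\<open>(c + y)\<^sup>2 - y\<^sup>2 = c * (c + 2 * y)\<close>. With
  \<open>y = a * b\<close> and \<open>c\<close> an eigenvalue this compares a mode with the radial
  one.\<close>

lemma power2_le_add_power2:
  fixes c y :: real
  assumes "0 \<le> c" "0 \<le> c + 2 * y"
  shows "y\<^sup>2 \<le> (c + y)\<^sup>2"
  using mult_nonneg_nonneg[OF assms] by (simp add: power2_eq_square algebra_simps)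

text \<open>The assumption on \<open>m\<close> says exactly that \<open>c_1 + 2 a b \<ge> 0\<close>,
  and \<open>c_k + 2 a b\<close> grows with \<open>k\<close>.\<close>

lemma eigenvalue_bound_central:
  assumes a: "a = (real N + m - 4) / 2" and b: "b = (real N - m) / 2"
    and m: "2 \<le> N \<Longrightarrow> (m - 2)\<^sup>2 \<le> (real N - 1)\<^sup>2 + 1"
    and k: "k = 0 \<or> 2 \<le> N"
  shows "b\<^sup>2 * a\<^sup>2 \<le> (sphere_eigenvalue N k + a * b)\<^sup>2"
proof (cases "k = 0")
  case True
  then show ?thesis by (simp add: power_mult_distrib)
next
  case False
  then have N: "2 \<le> N" using k by simp
  have "real N - 1 \<le> sphere_eigenvalue N k"
    using sphere_eigenvalue_mono[OF N, of 1 k] False unfolding sphere_eigenvalue_1 by simp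
  moreover have "2 * (a * b) = ((real N - 2)\<^sup>2 - (m - 2)\<^sup>2) / 2"
    by (simp add: a b power2_eq_square field_simps)
  moreover have "(real N - 2)\<^sup>2 = (real N - 1)\<^sup>2 + 1 - 2 * (real N - 1)"
    by (simp add: power2_eq_square algebra_simps)
  ultimately have "0 \<le> sphere_eigenvalue N k + 2 * (a * b)" using m[OF N] by argo
  from power2_le_add_power2[OF sphere_eigenvalue_nonneg[OF N] this]
  show ?thesis by (simp add: power_mult_distrib mult.commute)
qed

text \<open>At \<open>a = 0\<close> the exponent \<open>m\<close> is approached from above by
  exponents with \<open>a \<noteq> 0\<close>, whose constants \<open>((N - m) / 2)\<^sup>2\<close>
  converge to \<open>b\<^sup>2\<close>; this is why \<open>C = b\<^sup>2\<close> is assumed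
  there.\<close>

lemma admissible_constantI:
  fixes m a b C :: real
  assumes g: "cutoff g" and m: "m > 2 - real DIM('a::euclidean_space)"
    and a: "a = (real DIM('a) + m - 4) / 2" and b: "b = (real DIM('a) - m) / 2"
    and C: "C \<le> b\<^sup>2" "\<And>k. k = 0 \<or> 2 \<le> DIM('a) \<Longrightarrow> C * a\<^sup>2 \<le> (sphere_eigenvalue DIM('a) k + a * b)\<^sup>2"
    and a0: "a = 0 \<Longrightarrow> C = b\<^sup>2"
  shows "admissible_constant TYPE('a) m C"
  unfolding admissible_constant_def
proof
  fix u :: "'a \<Rightarrow> real" assume u: "u \<in> test_functions"
  show "C * (LINT x|lborel. hardy_integrand m u x) \<le> (LINT x|lborel. rellich_integrand m u x)"
  proof (cases "a = 0")
    case False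
    then show ?thesis using rellich_hardy_test_function[OF g u m a False b C] by simp
  next
    case True
    let ?m = "\<lambda>n. m + 1 / real (Suc n)"
    have m4: "m = 4 - real DIM('a)" using True a by simp
    have "(\<lambda>n. ((real DIM('a) - ?m n) / 2)\<^sup>2) \<longlonglongrightarrow> ((real DIM('a) - (m + 0)) / 2)\<^sup>2"
      by (intro tendsto_intros LIMSEQ_Suc[OF lim_const_over_n]) auto
    then have lim: "(\<lambda>n. ((real DIM('a) - ?m n) / 2)\<^sup>2) \<longlonglongrightarrow> C" using a0[OF True] b by simp
    show ?thesis
    proof (rule rellich_hardy_limit[OF u m lim])
      fix n
      define d where "d = 1 / real (Suc n)"
      have d: "0 < d" "d \<le> 1" by (auto simp: d_def)
      have "(m + d - 2)\<^sup>2 \<le> (real DIM('a) - 1)\<^sup>2 + 1" if "2 \<le> DIM('a)"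
      proof -
        \<comment> \<open>Since \<open>m - 2 = 2 - N\<close>, the perturbed exponents stay in the
          central range: \<open>|2 - N + d| \<le> N - 1\<close> for \<open>0 < d \<le> 1\<close> and
          \<open>N \<ge> 2\<close>.\<close>
        have "\<bar>m + d - 2\<bar> \<le> \<bar>real DIM('a) - 1\<bar>" using that d m4 by auto
        then show ?thesis unfolding abs_le_square_iff by simp
      qed
      then have "((real DIM('a) - (m + d)) / 2)\<^sup>2 * ((real DIM('a) + (m + d) - 4) / 2)\<^sup>2
          \<le> (sphere_eigenvalue DIM('a) k + (real DIM('a) + (m + d) - 4) / 2 * ((real DIM('a) - (m
              + d)) / 2))\<^sup>2"
        if "k = 0 \<or> 2 \<le> DIM('a)" for k
        using that by (intro eigenvalue_bound_central[OF refl refl]) auto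
      moreover have "(real DIM('a) + (m + d) - 4) / 2 \<noteq> 0" "m + d > 2 - real DIM('a)" using d m4 m by auto
      ultimately show "((real DIM('a) - ?m n) / 2)\<^sup>2 * (LINT x|lborel. hardy_integrand (?m n) u x)
          \<le> (LINT x|lborel. rellich_integrand (?m n) u x)"
        unfolding d_def[symmetric] by (intro rellich_hardy_test_function[OF g u _ refl _ refl]) auto
    qed
  qed
qed

text \<open>Minimality against \<open>k = 0\<close> reads \<open>(c + a b)^2 \<le> (a b)^2\<close>,
  which is the condition \<open>C \<le> b\<^sup>2\<close> of the lower bound. The eigenfunction
  \<open>Y\<close> shows that the minimal value is attained by a mode and gives the upper
  bound.\<close>

lemma optimal_constant_sph_eigen:
  fixes Y :: "'a::euclidean_space \<Rightarrow> real" and m a b :: real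
  assumes g: "cutoff g" and m: "m > 2 - real DIM('a)"
    and a: "a = (real DIM('a) + m - 4) / 2" "a \<noteq> 0" and b: "b = (real DIM('a) - m) / 2"
    and Y: "sph_eigen c Y"
    and min: "\<And>k. k = 0 \<or> 2 \<le> DIM('a) \<Longrightarrow> (c + a * b)\<^sup>2 \<le> (sphere_eigenvalue DIM('a) k + a * b)\<^sup>2"
  shows "optimal_constant TYPE('a) m ((c + a * b)\<^sup>2 / a\<^sup>2)"
  unfolding optimal_constant_def
proof (intro conjI allI impI)
  have "(c + a * b)\<^sup>2 / a\<^sup>2 \<le> b\<^sup>2"
    using min[of 0] a(2) by (simp add: power_mult_distrib divide_le_eq mult.commute)
  then show "admissible_constant TYPE('a) m ((c + a * b)\<^sup>2 / a\<^sup>2)"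
    using min a(2) by (intro admissible_constantI[OF g m a(1) b]) auto
  fix C assume "admissible_constant TYPE('a) m C"
  from admissible_constant_upper_bound(1)[OF this Y g a(1) b]
  show "C \<le> (c + a * b)\<^sup>2 / a\<^sup>2" using a(2) by (simp add: le_divide_eq)
qed

text \<open>The radial mode, kept apart because it includes \<open>a = 0\<close>, where
  \<open>(c + a * b)\<^sup>2 / a\<^sup>2\<close> degenerates and the upper bound comes from the
  second part of \<open>admissible_constant_upper_bound\<close>.\<close>

lemma optimal_constant_central:
  fixes m a b :: real
  assumes g: "cutoff g" and m: "m > 2 - real DIM('a::euclidean_space)"
    and a: "a = (real DIM('a) + m - 4) / 2" and b: "b = (real DIM('a) - m) / 2"
    and range: "2 \<le> DIM('a) \<Longrightarrow> (m - 2)\<^sup>2 \<le> (real DIM('a) - 1)\<^sup>2 + 1"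
  shows "optimal_constant TYPE('a) m (b\<^sup>2)"
  unfolding optimal_constant_def
proof (intro conjI allI impI)
  show "admissible_constant TYPE('a) m (b\<^sup>2)"
    by (rule admissible_constantI[OF g m a b _ eigenvalue_bound_central[OF a b range]]) auto
  fix C assume "admissible_constant TYPE('a) m C"
  note ub = admissible_constant_upper_bound[OF this sph_eigen_const g a b]
  show "C \<le> b\<^sup>2"
  proof (cases "a = 0")
    case False
    then have "0 < a\<^sup>2" by simp
    moreover have "C * a\<^sup>2 \<le> b\<^sup>2 * a\<^sup>2" using ub(1) by (simp add: power_mult_distrib mult.commute)
    ultimately show ?thesis by (rule mult_right_le_imp_le[rotated])
  qed (use ub(2) in simp)
qed

text \<open>\<open>c_l + a b = (l + a) (l + b)\<close>, because \<open>a + b = N - 2\<close>; the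
  two factors in \<open>C_mode\<close> are \<open>-2 (l + b)\<close> and
  \<open>2 (l + a)\<close>.\<close>

lemma C_mode_eq:
  assumes a: "a = (real N + m - 4) / 2" and b: "b = (real N - m) / 2"
  shows "C_mode N m l = (sphere_eigenvalue N l + a * b)\<^sup>2 / a\<^sup>2"
proof -
  have "(- real N + m - 2 * real l) * (2 * real l + m + real N - 4) = - 4 * (sphere_eigenvalue N l + a * b)"
    by (simp add: a b sphere_eigenvalue_def field_simps)
  then have "(- real N + m - 2 * real l)\<^sup>2 * (2 * real l + m + real N - 4)\<^sup>2
      = 16 * (sphere_eigenvalue N l + a * b)\<^sup>2"
    by (simp flip: power_mult_distrib) (simp add: power2_eq_square algebra_simps)
  moreover have "4 * (m + real N - 4)\<^sup>2 = 16 * a\<^sup>2" by (simp add: a power2_eq_square field_simps)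
  ultimately show ?thesis by (simp add: C_mode_def)
qed

text \<open>Because \<open>b = a - (m - 2)\<close>, the part \<open>2 a^2 - 2 (m - 2) a\<close> is
  \<open>2 a b\<close>. So the sign of \<open>I_coeff\<close> is the one that decides in
  \<open>power2_le_add_power2\<close>.\<close>

lemma I_coeff_eq:
  assumes a: "a = (real N + m - 4) / 2" and b: "b = (real N - m) / 2"
  shows "I_coeff N m k = sphere_eigenvalue N k + 2 * (a * b)"
  by (simp add: I_coeff_def a b power2_eq_square field_simps)

text \<open>The eigenvalues are unbounded, so the \<open>LEAST\<close> in \<open>k_min\<close> is
  attained.\<close>

lemma I_coeff_k_min:
  assumes N: "2 \<le> N"
  shows "0 \<le> I_coeff N m (k_min N m)"
proof -
  define y where "y = 2 * ((real N + m - 4) / 2)\<^sup>2 - (m - 2) * (real N + m - 4)"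
  obtain k :: nat where k: "max 1 (- y) < real k" using reals_Archimedean2 by blast
  have "real k * 1 \<le> real k * (real k + real N - 2)" using k N by (intro mult_left_mono) auto
  then have "0 \<le> y + real k * (real k + real N - 2)" using k by linarith
  then have "0 \<le> I_coeff N m k" by (simp add: I_coeff_def sphere_eigenvalue_def y_def)
  then show ?thesis unfolding k_min_def by (rule LeastI)
qed

text \<open>Beyond \<open>k_min\<close> no mode is better than the radial one, which takes part in
  the minimum as \<open>l = 0\<close>. So the finite minimum is the minimum over all modes.\<close>

lemma Min_C_mode_le:
  assumes N: "2 \<le> N" and a: "a = (real N + m - 4) / 2" "a \<noteq> 0" and b: "b = (real N - m) / 2"
  shows "(MIN l\<in>{0..k_min N m}. C_mode N m l) \<le> C_mode N m k"
proof (cases "k \<le> k_min N m")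
  case True
  then show ?thesis by (intro Min_le) auto
next
  case False
  have "0 \<le> sphere_eigenvalue N k + 2 * (a * b)"
    using I_coeff_k_min[OF N, of m] sphere_eigenvalue_mono[OF N, of "k_min N m" k] False
    by (simp add: I_coeff_eq[OF a(1) b])
  from power2_le_add_power2[OF sphere_eigenvalue_nonneg[OF N] this]
  have "C_mode N m 0 \<le> C_mode N m k"
    using a(2) by (simp add: C_mode_eq[OF a(1) b] divide_right_mono)
  moreover have "(MIN l\<in>{0..k_min N m}. C_mode N m l) \<le> C_mode N m 0" by (intro Min_le) auto
  ultimately show ?thesis by linarith
qed

lemma sqrt_range:
  fixes y s :: real
  assumes "0 \<le> s"
  shows "y \<in> {2 - sqrt s .. 2 + sqrt s} \<longleftrightarrow> (y - 2)\<^sup>2 \<le> s"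
proof -
  have "y \<in> {2 - sqrt s .. 2 + sqrt s} \<longleftrightarrow> \<bar>y - 2\<bar> \<le> sqrt s" by auto
  also have "\<dots> \<longleftrightarrow> (y - 2)\<^sup>2 \<le> s" using assms by (metis real_le_rsqrt real_sqrt_abs real_sqrt_le_iff)
  finally show ?thesis .
qed

theorem theorem2p1:
  fixes N :: nat and m :: real and g :: "real \<Rightarrow> real"
  assumes N: "N = CARD('n::finite)"
    and m: "m > 2 - real N"
    and g: "cutoff g"
  shows
    "((N = 1 \<and> m > 1) \<or>
      (N \<ge> 2 \<and> m \<in> {2 - sqrt ((real N - 1)\<^sup>2 + 1) .. 2 + sqrt ((real N - 1)\<^sup>2 + 1)}) \<longrightarrow>
        optimal_constant TYPE(real^'n) m (((real N - m) / 2)\<^sup>2) \<and>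
        (m \<noteq> 4 - real N \<longrightarrow>
          approximated_by m (((real N - m) / 2)\<^sup>2)
            (\<lambda>\<epsilon> x :: real^'n. norm x powr (- ((real N + m - 4) / 2) + \<epsilon>) * g (norm x))))
     \<and>
     (N \<ge> 2 \<and> m \<in> {2 - real N <..< 2 - sqrt ((real N - 1)\<^sup>2 + 1)} \<longrightarrow>
        optimal_constant TYPE(real^'n) m (((m - 2)\<^sup>2 - (real N)\<^sup>2)\<^sup>2 / (4 * (real N + m - 4)\<^sup>2)) \<and>
        (\<forall>\<phi> :: real^'n \<Rightarrow> real. spherical_harmonic 1 \<phi> \<and> sphere_L2_norm \<phi> = 1 \<longrightarrow>
          approximated_by m (((m - 2)\<^sup>2 - (real N)\<^sup>2)\<^sup>2 / (4 * (real N + m - 4)\<^sup>2))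
            (\<lambda>\<epsilon> x. norm x powr (- ((real N + m - 4) / 2) + \<epsilon>) * g (norm x) * \<phi> (x /\<^sub>R norm x))))
     \<and>
     (N \<ge> 2 \<and> m \<in> {2 + sqrt ((real N - 1)\<^sup>2 + 1) <..} \<longrightarrow>
        optimal_constant TYPE(real^'n) m (MIN l\<in>{0..k_min N m}. C_mode N m l) \<and>
        (\<forall>l_min. is_arg_min (C_mode N m) (\<lambda>l. l \<in> {0..k_min N m}) l_min \<longrightarrow>
          (\<forall>\<phi> :: real^'n \<Rightarrow> real. spherical_harmonic l_min \<phi> \<and> sphere_L2_norm \<phi> = 1 \<longrightarrow>
            approximated_by m (MIN l\<in>{0..k_min N m}. C_mode N m l)
              (\<lambda>\<epsilon> x. norm x powr (- ((real N + m - 4) / 2) + \<epsilon>) * g (norm x) * \<phi> (x /\<^sub>R norm x)))))"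
proof -
  have DIM: "DIM(real^'n) = N" using N by simp
  define a where "a = (real N + m - 4) / 2"
  define b where "b = (real N - m) / 2"
  have m': "m > 2 - real DIM(real^'n)" and a': "a = (real DIM(real^'n) + m - 4) / 2"
    and b': "b = (real DIM(real^'n) - m) / 2" using m by (simp_all only: DIM a_def b_def)
  have s_nonneg: "0 \<le> (real N - 1)\<^sup>2 + 1" by simp
  note sqrt_range' = sqrt_range[OF s_nonneg]
  have approx: "approximated_by m ((sphere_eigenvalue N k + a * b)\<^sup>2 / a\<^sup>2)
      (\<lambda>\<epsilon> x. norm x powr (- ((real N + m - 4) / 2) + \<epsilon>) * g (norm x) * \<phi> (x /\<^sub>R norm x))"
    if "spherical_harmonic k \<phi>" "a \<noteq> 0" for k and \<phi> :: "real^'n \<Rightarrow> real"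
    using sph_eigen_radial_extension[OF that(1)] unfolding DIM
    by (rule approximated_by_sph_eigen[OF _ g a' that(2) b']) (simp add: a_def radial_extension_def)
  have opt: "optimal_constant TYPE(real^'n) m ((sphere_eigenvalue N l + a * b)\<^sup>2 / a\<^sup>2)"
    if "2 \<le> N" "a \<noteq> 0" "\<And>k. (sphere_eigenvalue N l + a * b)\<^sup>2 \<le> (sphere_eigenvalue N k + a * b)\<^sup>2" for l
  proof -
    obtain Y :: "real^'n \<Rightarrow> real" where "sph_eigen (sphere_eigenvalue N l) Y"
      using sph_eigen_exists[where 'a = "real^'n", of l] \<open>2 \<le> N\<close> unfolding DIM by blast
    from optimal_constant_sph_eigen[OF g m' a' that(2) b' this] that(3) show ?thesis unfolding DIM by blast
  qed
  have ab: "4 * (a * b) = (real N - 2)\<^sup>2 - (m - 2)\<^sup>2"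
    by (simp add: a_def b_def power2_eq_square field_simps)
  \<comment> \<open>\<open>a = 0\<close> means \<open>m - 2 = 2 - N\<close>, and
    \<open>(N - 2)^2\<close> lies below \<open>(N - 1)^2 + 1\<close>: the degenerate exponent
    belongs to the central range.\<close>
  have outside: "(real N - 1)\<^sup>2 + 1 < (m - 2)\<^sup>2 \<and> a \<noteq> 0"
    if "2 \<le> N" "m \<notin> {2 - sqrt ((real N - 1)\<^sup>2 + 1) .. 2 + sqrt ((real N - 1)\<^sup>2 + 1)}"
  proof
    show *: "(real N - 1)\<^sup>2 + 1 < (m - 2)\<^sup>2" using that(2) unfolding sqrt_range' by simp
    show "a \<noteq> 0"
    proof
      assume "a = 0"
      then have "m - 2 = 2 - real N" by (simp add: a_def)
      then have "(m - 2)\<^sup>2 = (2 - real N)\<^sup>2" by (simp only:)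
      also have "\<dots> = (real N - 1)\<^sup>2 + 1 - 2 * (real N - 1)"
        by (simp add: power2_eq_square algebra_simps)
      finally have "(m - 2)\<^sup>2 = (real N - 1)\<^sup>2 + 1 - 2 * (real N - 1)" .
      then show False using * \<open>2 \<le> N\<close> by simp
    qed
  qed
  have case_i: "optimal_constant TYPE(real^'n) m (b\<^sup>2) \<and> (m \<noteq> 4 - real N \<longrightarrow> approximated_by m (b\<^sup>2)
      (\<lambda>\<epsilon> x :: real^'n. norm x powr (- ((real N + m - 4) / 2) + \<epsilon>) * g (norm x)))"
    if "(N = 1 \<and> m > 1) \<or> (N \<ge> 2 \<and> m \<in> {2 - sqrt ((real N - 1)\<^sup>2 + 1) .. 2 + sqrt ((real N - 1)\<^sup>2 + 1)})"
  proof (intro conjI impI)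
    show "optimal_constant TYPE(real^'n) m (b\<^sup>2)"
      using that unfolding sqrt_range' by (intro optimal_constant_central[OF g m' a' b']) (auto simp: N)
    assume "m \<noteq> 4 - real N"
    then have "a \<noteq> 0" by (simp add: a_def)
    then have "approximated_by m ((0 + a * b)\<^sup>2 / a\<^sup>2)
      (\<lambda>\<epsilon> x :: real^'n. norm x powr (- ((real N + m - 4) / 2) + \<epsilon>) * g (norm x))"
      by (intro approximated_by_sph_eigen[OF sph_eigen_const g a' _ b']) (simp_all add: a_def)
    then show "approximated_by m (b\<^sup>2)
      (\<lambda>\<epsilon> x :: real^'n. norm x powr (- ((real N + m - 4) / 2) + \<epsilon>) * g (norm x))"
      using \<open>a \<noteq> 0\<close> by (simp add: power_mult_distrib)
  qed
  \<comment> \<open>On this range \<open>c_1 + 2 a b \<le> 0\<close>, so mode 1 is at least as good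
    as mode 0, while \<open>m > 2 - N\<close> gives \<open>c_1 + a b \<ge> 0\<close>, from where on
    the squares increase with the eigenvalue.\<close>
  have case_ii: "a \<noteq> 0 \<and> ((m - 2)\<^sup>2 - (real N)\<^sup>2)\<^sup>2 / (4 * (real N + m - 4)\<^sup>2)
      = (sphere_eigenvalue N 1 + a * b)\<^sup>2 / a\<^sup>2 \<and>
      (\<forall>k. (sphere_eigenvalue N 1 + a * b)\<^sup>2 \<le> (sphere_eigenvalue N k + a * b)\<^sup>2)"
    if NN: "2 \<le> N" and r: "m \<in> {2 - real N <..< 2 - sqrt ((real N - 1)\<^sup>2 + 1)}"
  proof (intro conjI allI)
    have out: "(real N - 1)\<^sup>2 + 1 < (m - 2)\<^sup>2" "a \<noteq> 0" using outside[OF NN] r by auto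
    then show "a \<noteq> 0" by simp
    have eq: "4 * (sphere_eigenvalue N 1 + a * b) = (real N)\<^sup>2 - (m - 2)\<^sup>2"
      using ab unfolding sphere_eigenvalue_1 by (simp add: power2_eq_square algebra_simps)
    have "(4 * t)\<^sup>2 = 16 * t\<^sup>2" for t :: real by (simp add: power_mult_distrib)
    then have "((m - 2)\<^sup>2 - (real N)\<^sup>2)\<^sup>2 = 16 * (sphere_eigenvalue N 1 + a * b)\<^sup>2"
      unfolding power2_commute[of "(m - 2)\<^sup>2"] eq[symmetric] .
    moreover have "4 * (real N + m - 4)\<^sup>2 = 16 * a\<^sup>2" by (simp add: a_def power2_eq_square field_simps)
    ultimately show "((m - 2)\<^sup>2 - (real N)\<^sup>2)\<^sup>2 / (4 * (real N + m - 4)\<^sup>2)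
        = (sphere_eigenvalue N 1 + a * b)\<^sup>2 / a\<^sup>2"
      by (simp add: power_mult_distrib)
    have "m < 2" using r real_sqrt_ge_zero[OF s_nonneg] unfolding greaterThanLessThan_iff by linarith
    then have "\<bar>m - 2\<bar> \<le> \<bar>real N\<bar>" using r by auto
    then have "0 \<le> sphere_eigenvalue N 1 + a * b" using eq unfolding abs_le_square_iff by simp
    fix k
    show "(sphere_eigenvalue N 1 + a * b)\<^sup>2 \<le> (sphere_eigenvalue N k + a * b)\<^sup>2"
    proof (cases "k = 0")
      case False
      then show ?thesis
        using sphere_eigenvalue_mono[OF NN, of 1 k] \<open>0
            \<le> sphere_eigenvalue N 1 + a * b\<close> by (intro power_mono) auto
    next
      case True
      have "(real N - 2)\<^sup>2 = (real N - 1)\<^sup>2 + 1 - 2 * (real N - 1)"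
        by (simp add: power2_eq_square algebra_simps)
      then have "sphere_eigenvalue N 1 + 2 * (a * b) \<le> 0"
        using ab out(1) unfolding sphere_eigenvalue_1 by argo
      then have "sphere_eigenvalue N 1 * (sphere_eigenvalue N 1 + 2 * (a * b)) \<le> 0"
        using sphere_eigenvalue_nonneg[OF NN] by (rule mult_nonneg_nonpos[rotated])
      then show ?thesis using True by (simp add: power2_eq_square algebra_simps)
    qed
  qed
  have case_iii: "a \<noteq> 0 \<and> (\<forall>l. is_arg_min (C_mode N m) (\<lambda>l. l \<in> {0..k_min N m}) l \<longrightarrow>
      (MIN l\<in>{0..k_min N m}. C_mode N m l) = (sphere_eigenvalue N l + a * b)\<^sup>2 / a\<^sup>2)
      \<and> optimal_constant TYPE(real^'n) m (MIN l\<in>{0..k_min N m}. C_mode N m l)"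
    if NN: "2 \<le> N" and r: "m \<in> {2 + sqrt ((real N - 1)\<^sup>2 + 1) <..}"
  proof (intro conjI allI impI)
    show a0: "a \<noteq> 0" using outside[OF NN] r by auto
    note C_eq = C_mode_eq[OF a_def b_def]
    let ?M = "MIN l\<in>{0..k_min N m}. C_mode N m l"
    show "?M = (sphere_eigenvalue N l + a * b)\<^sup>2 / a\<^sup>2"
      if "is_arg_min (C_mode N m) (\<lambda>l. l \<in> {0..k_min N m}) l" for l
      using that unfolding C_eq[symmetric] is_arg_min_def
      by (intro Min_eqI) (auto simp: not_less)
    have "?M \<in> C_mode N m ` {0..k_min N m}" by (intro Min_in) auto
    then obtain l where l: "?M = C_mode N m l" by (rule imageE)
    have "(sphere_eigenvalue N l + a * b)\<^sup>2 \<le> (sphere_eigenvalue N k + a * b)\<^sup>2" for k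
    proof -
      have "C_mode N m l \<le> C_mode N m k" using Min_C_mode_le[OF NN a_def a0 b_def, of k] unfolding l .
      then show ?thesis using a0 by (simp add: C_eq divide_le_cancel)
    qed
    from opt[OF NN a0 this] show "optimal_constant TYPE(real^'n) m ?M" unfolding l unfolding C_eq .
  qed
  show ?thesis
    unfolding b_def[symmetric]
  proof (rule conjI[OF impI conjI[OF impI impI]], goal_cases)
    case 1
    then show ?case by (rule case_i)
  next
    case 2
    then have NN: "2 \<le> N" by simp
    note * = case_ii[OF NN conjunct2[OF 2]]
    show ?case
      unfolding *[THEN conjunct2, THEN conjunct1]
      using opt[OF NN, of 1] approx[of 1] * by blast
  next
    case 3
    then have NN: "2 \<le> N" by simp
    note * = case_iii[OF NN conjunct2[OF 3]]
    show ?case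
    proof (intro conjI allI impI)
      show "optimal_constant TYPE(real^'n) m (MIN l\<in>{0..k_min N m}. C_mode N m l)" using * by blast
      fix l and \<phi> :: "real^'n \<Rightarrow> real"
      assume l: "is_arg_min (C_mode N m) (\<lambda>l. l \<in> {0..k_min N m}) l"
        and \<phi>: "spherical_harmonic l \<phi> \<and> sphere_L2_norm \<phi> = 1"
      have "(MIN l\<in>{0..k_min N m}. C_mode N m l) = (sphere_eigenvalue N l + a * b)\<^sup>2 / a\<^sup>2"
        using * l by blast
      then show "approximated_by m (MIN l\<in>{0..k_min N m}. C_mode N m l)
          (\<lambda>\<epsilon> x. norm x powr (- ((real N + m - 4) / 2) + \<epsilon>) * g (norm x) * \<phi> (x /\<^sub>R norm x))"
        using approx[OF conjunct1[OF \<phi>] conjunct1[OF *]] by (simp only:)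
    qed
  qed
qed

end
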